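(* Let $\mathfrak{A}$ be a PLH relational structure with finite relational signature $\tau$, where each relation $R^{\mathfrak{A}}$ ($R\in\tau$) is defined over $\mathfrak{L}$ by a fixed quantifier-free negation-free formula $\phi_R$ whose atomic subformulas are in the normal form described below. Let $\mathfrak{A}^\star$ be the $\tau$-structure with domain $\mathbb{Q}^\star$ in which each $R\in\tau$ is interpreted by the relation defined by the same formula $\phi_R$ over $\mathbb{Q}^\star$. Then there is an efficient sampling algorithm for $\mathfrak{A}^\star$.
   Context: $\mathfrak{L}$ is the structure with domain $\mathbb{Q}$ in the signature $\tau_0$ consisting of the relation $<$ (strict order), the constant $1$, and unary function symbols $c\cdot$ for $c\in\mathbb{Q}$ interpreted as $x\mapsto cx$. A relational structure with domain $\mathbb{Q}$ is PLH if all its relations are first-order definable over $\mathfrak{L}$. Normal form: each atomic $\tau_0$-formula is either $\top$ or $\bot$, or of one of the forms $c_1\cdot1\ \sigma\ x_i$, $x_i\ \sigma\ c_2\cdot 1$, $c_1\cdot x_i\ \sigma\ c_2\cdot x_j$ with $\sigma\in\{<,=\}$, rational constants $c_1,c_2$ not both negative, and no composition of the symbols $c\cdot$. $\mathbb{Q}^\star=\{x+y\epsilon: x,y\in\mathbb{Q}\}$ is the ordered $\mathbb{Q}$-vector space of formal pairs with componentwise addition and scalar multiplication $c(x+y\epsilon)=cx+cy\epsilon$, $\mathbb{Q}$ embedded via $x\mapsto x+0\epsilon$, and lexicographic order: $x_1+y_1\epsilon<x_2+y_2\epsilon$ iff $x_1<x_2$, or $x_1=x_2$ and $y_1<y_2$.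 $\tau_0$-formulas are interpreted in $\mathbb{Q}^\star$ in the obvious way. For structures $\mathfrak{C},\mathfrak{D}$ with the same relational signature, a homomorphism is a map $h$ with $h(a)\in R^{\mathfrak{D}}$ whenever $a\in R^{\mathfrak{C}}$ (componentwise). A sampling algorithm for a structure $\mathfrak{C}$ with finite relational signature $\tau$ takes a positive integer $d$ and computes a finite structure $\mathfrak{D}$ that is homomorphic to $\mathfrak{C}$ such that every finite conjunction of atomic $\tau$-formulas with at most $d$ distinct free variables is satisfiable in $\mathfrak{C}$ iff it is satisfiable in $\mathfrak{D}$. It is efficient if its running time is polynomial in $d$. *)

theory Defs
  imports Main "HOL.Rat"
begin

type_synonym qstar = "rat \<times> rat"   \<comment> \<open>(x, y) stands for x + y epsilon\<close>

definition qlt :: "qstar \<Rightarrow> qstar \<Rightarrow> bool" where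
  "qlt p q \<longleftrightarrow> fst p < fst q \<or> (fst p = fst q \<and> snd p < snd q)"

definition qscale :: "rat \<Rightarrow> qstar \<Rightarrow> qstar" where
  "qscale c p = (c * fst p, c * snd p)"

definition qone :: qstar where
  "qone = (1, 0)"

datatype sigma = SLess | SEq

fun sigma_sem :: "sigma \<Rightarrow> qstar \<Rightarrow> qstar \<Rightarrow> bool" where
  "sigma_sem SLess p q = qlt p q"
| "sigma_sem SEq p q = (p = q)"

text \<open>Normal-form atoms: top, bottom, c1*1 sigma x_i, x_i sigma c2*1, c1*x_i sigma c2*x_j.\<close>
datatype nf_atom =
    ATop
  | ABot
  | ConstVar rat sigma nat
  | VarConst nat sigma rat
  | VarVar rat nat sigma rat nat

datatype qf = Atom nf_atom | And qf qf | Or qf qf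

fun nf_atom_wf :: "nat \<Rightarrow> nf_atom \<Rightarrow> bool" where
  "nf_atom_wf k ATop = True"
| "nf_atom_wf k ABot = True"
| "nf_atom_wf k (ConstVar c s i) = (i < k)"
| "nf_atom_wf k (VarConst i s c) = (i < k)"
| "nf_atom_wf k (VarVar c1 i s c2 j) = (i < k \<and> j < k \<and> \<not> (c1 < 0 \<and> c2 < 0))"

fun qf_wf :: "nat \<Rightarrow> qf \<Rightarrow> bool" where
  "qf_wf k (Atom a) = nf_atom_wf k a"
| "qf_wf k (And f g) = (qf_wf k f \<and> qf_wf k g)"
| "qf_wf k (Or f g) = (qf_wf k f \<and> qf_wf k g)"

fun nf_atom_sem :: "nf_atom \<Rightarrow> (nat \<Rightarrow> qstar) \<Rightarrow> bool" where
  "nf_atom_sem ATop s = True"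
| "nf_atom_sem ABot s = False"
| "nf_atom_sem (ConstVar c r i) s = sigma_sem r (qscale c qone) (s i)"
| "nf_atom_sem (VarConst i r c) s = sigma_sem r (s i) (qscale c qone)"
| "nf_atom_sem (VarVar c1 i r c2 j) s = sigma_sem r (qscale c1 (s i)) (qscale c2 (s j))"

fun qf_sem :: "qf \<Rightarrow> (nat \<Rightarrow> qstar) \<Rightarrow> bool" where
  "qf_sem (Atom a) s = nf_atom_sem a s"
| "qf_sem (And f g) s = (qf_sem f s \<and> qf_sem g s)"
| "qf_sem (Or f g) s = (qf_sem f s \<or> qf_sem g s)"

text \<open>A finite relational signature with defining formulas: the i-th relation symbol
  (i < length sig) has arity fst (sig ! i) and is defined by the formula snd (sig ! i).\<close>
type_synonym signature = "(nat \<times> qf) list"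

definition relA :: "signature \<Rightarrow> nat \<Rightarrow> qstar list set" where
  "relA sig i = {t. length t = fst (sig ! i) \<and> qf_sem (snd (sig ! i)) (\<lambda>j. t ! j)}"

text \<open>A finite structure is given by n (domain {0..<n}) and a list of facts (i, t)
  meaning t is in R_i.\<close>
definition wf_struct :: "signature \<Rightarrow> nat \<Rightarrow> (nat \<times> nat list) list \<Rightarrow> bool" where
  "wf_struct sig n facts \<longleftrightarrow>
     (\<forall>(i, t) \<in> set facts. i < length sig \<and> length t = fst (sig ! i) \<and> (\<forall>a \<in> set t. a < n))"

definition encode_struct :: "nat \<Rightarrow> (nat \<times> nat list) list \<Rightarrow> nat list" where
  "encode_struct n facts = n # concat (map (\<lambda>(i, t). i # t) facts)"

definition is_hom_to_Astar :: "signature \<Rightarrow> (nat \<times> nat list) list \<Rightarrow> (nat \<Rightarrow> qstar) \<Rightarrow> bool" where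
  "is_hom_to_Astar sig facts h \<longleftrightarrow> (\<forall>(i, t) \<in> set facts. map h t \<in> relA sig i)"

datatype tatom = TRel nat "nat list" | TEq nat nat

fun tatom_wf :: "signature \<Rightarrow> tatom \<Rightarrow> bool" where
  "tatom_wf sig (TRel i vs) = (i < length sig \<and> length vs = fst (sig ! i))"
| "tatom_wf sig (TEq v w) = True"

fun tatom_vars :: "tatom \<Rightarrow> nat set" where
  "tatom_vars (TRel i vs) = set vs"
| "tatom_vars (TEq v w) = {v, w}"

definition conj_vars :: "tatom list \<Rightarrow> nat set" where
  "conj_vars as = (\<Union>a \<in> set as. tatom_vars a)"

fun holds_Astar :: "signature \<Rightarrow> (nat \<Rightarrow> qstar) \<Rightarrow> tatom \<Rightarrow> bool" where
  "holds_Astar sig s (TRel i vs) = (map s vs \<in> relA sig i)"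
| "holds_Astar sig s (TEq v w) = (s v = s w)"

fun holds_D :: "(nat \<times> nat list) list \<Rightarrow> (nat \<Rightarrow> nat) \<Rightarrow> tatom \<Rightarrow> bool" where
  "holds_D facts s (TRel i vs) = ((i, map s vs) \<in> set facts)"
| "holds_D facts s (TEq v w) = (s v = s w)"

definition sat_Astar :: "signature \<Rightarrow> tatom list \<Rightarrow> bool" where
  "sat_Astar sig as \<longleftrightarrow> (\<exists>s. \<forall>a \<in> set as. holds_Astar sig s a)"

definition sat_D :: "nat \<Rightarrow> (nat \<times> nat list) list \<Rightarrow> tatom list \<Rightarrow> bool" where
  "sat_D n facts as \<longleftrightarrow>
     (\<exists>s. (\<forall>v \<in> conj_vars as. s v < n) \<and> (\<forall>a \<in> set as. holds_D facts s a))"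

section \<open>Machine model: unit-cost RAM with addition, truncated subtraction, indirect addressing\<close>

datatype instr =
    Const nat nat
  | Add nat nat nat
  | Sub nat nat nat
  | Load nat nat
  | Store nat nat
  | Jz nat nat
  | Halt

type_synonym config = "nat \<times> (nat \<Rightarrow> nat)"

definition halted :: "instr list \<Rightarrow> config \<Rightarrow> bool" where
  "halted P c \<longleftrightarrow> fst c \<ge> length P \<or> P ! fst c = Halt"

fun exec :: "instr \<Rightarrow> config \<Rightarrow> config" where
  "exec (Const a k) (pc, m) = (Suc pc, m(a := k))"
| "exec (Add a b c) (pc, m) = (Suc pc, m(a := m b + m c))"
| "exec (Sub a b c) (pc, m) = (Suc pc, m(a := m b - m c))"
| "exec (Load a b) (pc, m) = (Suc pc, m(a := m (m b)))"
| "exec (Store a b) (pc, m) = (Suc pc, m(m a := m b))"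
| "exec (Jz a t) (pc, m) = (if m a = 0 then (t, m) else (Suc pc, m))"
| "exec Halt (pc, m) = (pc, m)"

definition step :: "instr list \<Rightarrow> config \<Rightarrow> config" where
  "step P c = (if halted P c then c else exec (P ! fst c) c)"

definition init_config :: "nat \<Rightarrow> config" where
  "init_config d = (0, (\<lambda>_. 0)(0 := d))"

definition run :: "instr list \<Rightarrow> nat \<Rightarrow> nat \<Rightarrow> config" where
  "run P d t = (step P ^^ t) (init_config d)"

definition halts_within :: "instr list \<Rightarrow> nat \<Rightarrow> nat \<Rightarrow> bool" where
  "halts_within P d T \<longleftrightarrow> (\<exists>t \<le> T. halted P (run P d t))"

definition output_of :: "config \<Rightarrow> nat list" where
  "output_of c = map (snd c) [1..<snd c 0 + 1]"

definition sampling_output :: "signature \<Rightarrow> nat \<Rightarrow> nat \<Rightarrow> (nat \<times> nat list) list \<Rightarrow> bool" where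
  "sampling_output sig d n facts \<longleftrightarrow>
     wf_struct sig n facts \<and>
     (\<exists>h. is_hom_to_Astar sig facts h) \<and>
     (\<forall>as. (\<forall>a \<in> set as. tatom_wf sig a) \<and> card (conj_vars as) \<le> d \<longrightarrow>
           (sat_Astar sig as \<longleftrightarrow> sat_D n facts as))"

definition efficient_sampling_algorithm :: "signature \<Rightarrow> instr list \<Rightarrow> bool" where
  "efficient_sampling_algorithm sig P \<longleftrightarrow>
     (\<exists>c e::nat. \<forall>d \<ge> 1.
        halts_within P d (c * d ^ e) \<and>
        (\<exists>n facts. output_of (run P d (c * d ^ e)) = encode_struct n facts \<and>
                   sampling_output sig d n facts))"

end

theory Submission
  imports Defs
begin

text \<open>
  After clearing denominators every atom compares \<open>\<alpha> x\<close> with \<open>\<beta> y\<close> for integers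
  \<open>\<alpha>, \<beta>\<close> from a finite set, where \<open>x, y\<close> are variables or 1. A solution in at most \<open>d\<close> variables
  can be moved from \<open>\<rat>\<^sup>\<star>\<close> into \<open>\<rat>\<close> by substituting a small rational for
  \<open>\<epsilon>\<close>. Between absolute values the constraints are multiplicative, \<open>r x \<le> y\<close> with \<open>r\<close> from a finite
  set of ratios; rescaling whole groups of variables until constraints become tight
  connects every variable to 1 by at most \<open>d\<close> ratios, so its value becomes a product of powers of the
  coefficients with exponents in \<open>[-d, d]\<close>. The strict inequalities lost in this way are restored by factors
  \<open>(H + i) / (H + d)\<close> with \<open>i \<le> 2 d\<close> and a huge \<open>H\<close>. Hence polynomially many
  rational samples suffice, and the structure they induce is the output.

  With the common denominator taken out, the samples are differences of natural numbers that a
  unit-cost machine builds by additions, taking \<open>H = B\<^sup>d\<close> for a constant \<open>B\<close>. The relations are then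
  tabulated by nested loops around a jump-free evaluation of the defining formulas.
\<close>

section \<open>Random access machines\<close>

type_synonym mem = "nat \<Rightarrow> nat"

text \<open>The facts are exactly the tuples of sample elements that satisfy the formulas. Only
  satisfiability in the output needs rounding, and there it is enough to preserve true atoms,
  because the formulas are negation-free.

  The obstacle is strictness: making constraints tight may turn \<open>r x < y\<close> into an
  equality. The repair must break neither the intended equalities nor the inequalities that stayed
  strict. Shifts by rank respect equalities, since equal quotients of old and new value get equal
  ranks. Inequalities that stayed strict compare distinct integers of size at most exponential in
  \<open>d\<close>, so their ratio keeps a distance from 1 that is only exponentially small. This
  forces \<open>H\<close> to be exponential in \<open>d\<close>, whereas the number of samples
  depends only on the range of the exponents and of \<open>i\<close>, which is polynomial.

  The same \<open>H\<close> also serves as an address: it lies beyond registers and table, so the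
  output can be collected there.\<close>

fun basic :: "instr \<Rightarrow> bool" where
  "basic (Jz a t) = False"
| "basic Halt = False"
| "basic _ = True"

definition upd :: "instr \<Rightarrow> mem \<Rightarrow> mem" where
  "upd i m = snd (exec i (0, m))"

lemma upd_simps [simp]:
  "upd (Const a k) m = m(a := k)"
  "upd (Add a b c) m = m(a := m b + m c)"
  "upd (Sub a b c) m = m(a := m b - m c)"
  "upd (Load a b) m = m(a := m (m b))"
  "upd (Store a b) m = m(m a := m b)"
  by (simp_all add: upd_def)

lemma exec_basic: "basic i \<Longrightarrow> exec i (pc, m) = (Suc pc, upd i m)"
  by (cases i) auto

text \<open>Register 1 is reserved for the bookkeeping of loops: it supplies the constant 1 of the
  decrement and the 0 that makes the backward jump unconditional.\<close>
datatype com = Block "instr list" | Seq com com (infixr ";;" 60) | Rep nat com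

fun clen :: "com \<Rightarrow> nat" where
  "clen (Block is) = length is"
| "clen (a ;; b) = clen a + clen b"
| "clen (Rep r c) = clen c + 5"

fun code :: "com \<Rightarrow> nat \<Rightarrow> instr list" where
  "code (Block is) pc = is"
| "code (a ;; b) pc = code a pc @ code b (pc + clen a)"
| "code (Rep r c) pc =
     Jz r (pc + clen c + 5) # code c (Suc pc) @ [Const 1 1, Sub r r 1, Const 1 0, Jz 1 pc]"

lemma length_code [simp]: "length (code c pc) = clen c"
  by (induction c arbitrary: pc) auto

definition runs :: "com \<Rightarrow> mem \<Rightarrow> nat \<Rightarrow> mem \<Rightarrow> bool" where
  "runs c m T m' \<longleftrightarrow> (\<forall>pre post. \<exists>t\<le>T.
     (step (pre @ code c (length pre) @ post) ^^ t) (length pre, m) = (length pre + clen c, m'))"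

lemma runsI:
  assumes "\<And>pre post. \<exists>t\<le>T.
     (step (pre @ code c (length pre) @ post) ^^ t) (length pre, m) = (length pre + clen c, m')"
  shows "runs c m T m'"
  using assms unfolding runs_def by blast

lemma step_at:
  assumes "P = pre @ i # post" "pc = length pre" "i \<noteq> Halt"
  shows "step P (pc, m) = exec i (pc, m)"
  using assms by (simp add: step_def halted_def)

lemma funpow_trans:
  "(f ^^ s) x = y \<Longrightarrow> (f ^^ t) y = z \<Longrightarrow> (f ^^ (s + t)) x = z"
  by (simp add: add.commute[of s] funpow_add)

lemma runs_block: "list_all basic is \<Longrightarrow> runs (Block is) m (length is) (fold upd is m)"
proof (rule runsI)
  fix pre post :: "instr list" assume "list_all basic is"
  then have "(step (pre @ is @ post) ^^ length is) (length pre, m)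
      = (length pre + length is, fold upd is m)"
  proof (induction "is" arbitrary: pre m)
    case (Cons i "is")
    have "step (pre @ (i # is) @ post) (length pre, m) = (Suc (length pre), upd i m)"
      using Cons.prems by (subst step_at[of _ pre i "is @ post"]) (auto simp: exec_basic)
    then show ?case
      using Cons.IH[of "pre @ [i]" "upd i m"] Cons.prems
      by (simp add: funpow_swap1 del: funpow.simps add: funpow_Suc_right)
  qed simp
  then show "\<exists>t\<le>length is. (step (pre @ code (Block is) (length pre) @ post) ^^ t) (length pre, m)
      = (length pre + clen (Block is), fold upd is m)" by auto
qed

lemma runs_seq:
  assumes "runs a m T1 m1" "runs b m1 T2 m2"
  shows "runs (a ;; b) m (T1 + T2) m2"
proof (rule runsI)
  fix pre post :: "instr list"
  let ?P = "pre @ code (a ;; b) (length pre) @ post"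
  obtain t1 where t1: "t1 \<le> T1" "(step ?P ^^ t1) (length pre, m) = (length pre + clen a, m1)"
    using assms(1)[unfolded runs_def, rule_format, of pre "code b (length pre + clen a) @ post"]
    by auto
  obtain t2 where t2: "t2 \<le> T2"
      "(step ?P ^^ t2) (length pre + clen a, m1) = (length pre + clen a + clen b, m2)"
    using assms(2)[unfolded runs_def, rule_format, of "pre @ code a (length pre)" post] by auto
  show "\<exists>t\<le>T1 + T2. (step ?P ^^ t) (length pre, m) = (length pre + clen (a ;; b), m2)"
    using funpow_trans[OF t1(2) t2(2)] t1(1) t2(1) by (intro exI[of _ "t1 + t2"]) simp
qed

lemma runs_rep_done: "m r = 0 \<Longrightarrow> runs (Rep r c) m 1 m"
proof (rule runsI)
  fix pre post :: "instr list" assume "m r = 0"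
  then have "(step (pre @ code (Rep r c) (length pre) @ post) ^^ 1) (length pre, m)
      = (length pre + clen (Rep r c), m)"
    by (simp add: step_def halted_def)
  then show "\<exists>t\<le>1. (step (pre @ code (Rep r c) (length pre) @ post) ^^ t) (length pre, m)
      = (length pre + clen (Rep r c), m)" by blast
qed

text \<open>The five extra steps are the test at the head of the loop and the four bookkeeping
  instructions after the body.\<close>

lemma runs_rep_step:
  assumes "m r \<noteq> 0" "r \<noteq> 1" "runs c m T m1" "runs (Rep r c) (m1(r := m1 r - 1, 1 := 0)) T' m2"
  shows "runs (Rep r c) m (T + 5 + T') m2"
proof (rule runsI)
  fix pre post :: "instr list"
  let ?n = "length pre"
  let ?P = "pre @ code (Rep r c) ?n @ post"
  let ?jz = "Jz r (?n + clen c + 5)"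
  let ?body = "code c (Suc ?n)"
  let ?m1' = "m1(r := m1 r - 1, 1 := 0)"
  have s0: "(step ?P ^^ 1) (?n, m) = (Suc ?n, m)"
    using assms(1) by (simp add: step_def halted_def)
  obtain t where t: "t \<le> T" "(step ?P ^^ t) (Suc ?n, m) = (Suc ?n + clen c, m1)"
    using assms(3)[unfolded runs_def, rule_format, of "pre @ [?jz]"
        "[Const 1 1, Sub r r 1, Const 1 0, Jz 1 ?n] @ post"] by auto
  let ?pre = "pre @ ?jz # ?body"
  have e1: "step ?P (Suc ?n + clen c, m1) = (Suc ?n + clen c + 1, m1(1 := 1))"
    by (subst step_at[of _ ?pre "Const 1 1" "[Sub r r 1, Const 1 0, Jz 1 ?n] @ post"]) auto
  have e2: "step ?P (Suc ?n + clen c + 1, m1(1 := 1))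
      = (Suc ?n + clen c + 2, m1(1 := 1, r := m1 r - 1))"
    using assms(2)
    by (subst step_at[of _ "?pre @ [Const 1 1]" "Sub r r 1" "[Const 1 0, Jz 1 ?n] @ post"]) auto
  have e3: "step ?P (Suc ?n + clen c + 2, m1(1 := 1, r := m1 r - 1))
      = (Suc ?n + clen c + 3, ?m1')"
    using assms(2)
    by (subst step_at[of _ "?pre @ [Const 1 1, Sub r r 1]" "Const 1 0" "[Jz 1 ?n] @ post"])
       (auto simp: fun_upd_twist)
  have e4: "step ?P (Suc ?n + clen c + 3, ?m1') = (?n, ?m1')"
    by (subst step_at[of _ "?pre @ [Const 1 1, Sub r r 1, Const 1 0]" "Jz 1 ?n" "post"]) auto
  have s1: "(step ?P ^^ 4) (Suc ?n + clen c, m1) = (?n, ?m1')"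
    by (simp only: eval_nat_numeral funpow.simps o_apply id_apply e1 e2 e3 e4 BitM.simps One_nat_def)
       (use e1 e2 e3 e4 in \<open>simp add: eval_nat_numeral\<close>)
  obtain t' where t': "t' \<le> T'" "(step ?P ^^ t') (?n, ?m1') = (?n + clen (Rep r c), m2)"
    using assms(4) unfolding runs_def by blast
  have "(step ?P ^^ (((1 + t) + 4) + t')) (?n, m) = (?n + clen (Rep r c), m2)"
    by (rule funpow_trans[OF funpow_trans[OF funpow_trans[OF s0 t(2)] s1] t'(2)])
  then show "\<exists>s\<le>T + 5 + T'. (step ?P ^^ s) (?n, m) = (?n + clen (Rep r c), m2)"
    using t(1) t'(1) by (intro exI[of _ "((1 + t) + 4) + t'"]) auto
qed

section \<open>Hoare triples for total correctness with a time bound\<close>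

definition hoare :: "(mem \<Rightarrow> bool) \<Rightarrow> com \<Rightarrow> nat \<Rightarrow> (mem \<Rightarrow> bool) \<Rightarrow> bool" where
  "hoare P c T Q \<longleftrightarrow> (\<forall>m. P m \<longrightarrow> (\<exists>m'. runs c m T m' \<and> Q m'))"

lemma runs_mono: "runs c m T m' \<Longrightarrow> T \<le> T' \<Longrightarrow> runs c m T' m'"
  unfolding runs_def by (meson order_trans)

lemma hoare_block:
  assumes "list_all basic is" "\<And>m. P m \<Longrightarrow> Q (fold upd is m)" "length is \<le> T"
  shows "hoare P (Block is) T Q"
  using assms runs_block runs_mono unfolding hoare_def by blast

lemma hoare_seq:
  assumes "hoare P a T1 R" "hoare R b T2 Q"
  shows "hoare P (a ;; b) (T1 + T2) Q"
  using assms runs_seq unfolding hoare_def by meson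

lemma hoare_conseq:
  assumes "hoare P c T Q" "\<And>m. P' m \<Longrightarrow> P m" "\<And>m. Q m \<Longrightarrow> Q' m" "T \<le> T'"
  shows "hoare P' c T' Q'"
  using assms runs_mono unfolding hoare_def by meson

lemma hoare_exists: "(\<And>x. hoare (P x) c T Q) \<Longrightarrow> hoare (\<lambda>m. \<exists>x. P x m) c T Q"
  unfolding hoare_def by blast

text \<open>The body may read the counter, as the enumeration of tuples does, but has to leave it
  intact. The invariant is demanded on the memory after the decrement and the reset of register 1,
  since this is what the next iteration sees.\<close>

lemma hoare_rep:
  assumes body: "\<And>i. i < n \<Longrightarrow> hoare (\<lambda>m. I i m \<and> m r = n - i) c T
      (\<lambda>m. m r = n - i \<and> I (Suc i) (m(r := n - Suc i, 1 := 0)))"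
    and r: "r \<noteq> 1"
  shows "hoare (\<lambda>m. I 0 m \<and> m r = n) (Rep r c) (n * (T + 5) + 1) (\<lambda>m. I n m \<and> m r = 0)"
proof -
  have "\<exists>m'. runs (Rep r c) m ((n - i) * (T + 5) + 1) m' \<and> I n m' \<and> m' r = 0"
    if "i \<le> n" "I i m" "m r = n - i" for i m
    using that
  proof (induction "n - i" arbitrary: i m)
    case 0
    then show ?case using runs_rep_done[of m r c] by (intro exI[of _ m]) auto
  next
    case (Suc k)
    then have "i < n" by simp
    from body[OF this, unfolded hoare_def, rule_format, of m] Suc.prems(2,3) obtain m1 where m1: "runs c m T m1" "m1 r = n - i"
        "I (Suc i) (m1(r := n - Suc i, 1 := 0))"
      by blast
    let ?m = "m1(r := n - Suc i, 1 := 0)"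
    have m_r: "?m r = n - Suc i" using r by simp
    have k: "k = n - Suc i" "Suc i \<le> n" using Suc.hyps(2) by auto
    from Suc.hyps(1)[OF k m1(3) m_r] obtain m' where m': "runs (Rep r c) ?m ((n - Suc i) * (T + 5) + 1) m'" "I n m'" "m' r = 0"
      by blast
    have eq: "(n - i) * (T + 5) + 1 = T + 5 + ((n - Suc i) * (T + 5) + 1)"
      using Suc.hyps(2) by (metis Suc_diff_Suc add.assoc mult_Suc zero_less_Suc zero_less_diff)
    have "runs (Rep r c) m ((n - i) * (T + 5) + 1) m'" unfolding eq
    proof (rule runs_rep_step[OF _ r m1(1)])
      show "m r \<noteq> 0" using Suc.hyps(2) Suc.prems by simp
      show "runs (Rep r c) (m1(r := m1 r - 1, 1 := 0)) ((n - Suc i) * (T + 5) + 1) m'"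
        using m'(1) m1(2) by simp
    qed
    then show ?case using m'(2,3) by blast
  qed
  from this[of 0] show ?thesis unfolding hoare_def by auto
qed

lemma hoare_halts:
  assumes "hoare P c T Q" "P (snd (init_config d))" "T \<le> T'"
  shows "halts_within (code c 0 @ [Halt]) d T'"
    and "Q (snd (run (code c 0 @ [Halt]) d T'))"
proof -
  let ?P = "code c 0 @ [Halt]"
  obtain m' where m': "runs c (snd (init_config d)) T m'" "Q m'"
    using assms unfolding hoare_def by blast
  obtain t where t: "t \<le> T" "(step ?P ^^ t) (0, snd (init_config d)) = (clen c, m')"
    using m'(1)[unfolded runs_def, rule_format, of "[]" "[Halt]"] by auto
  have run_t: "run ?P d t = (clen c, m')"
    using t(2) by (simp add: run_def init_config_def)
  have h: "halted ?P (clen c, m')" by (simp add: halted_def nth_append)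
  \<comment> \<open>A halted configuration is a fixed point of \<open>step\<close>, so the memory at
    the later time \<open>T'\<close> is still the final one.\<close>
  have "(step ?P ^^ s) (clen c, m') = (clen c, m')" for s
    using h by (induction s) (simp_all add: step_def)
  then have "run ?P d (t + s) = (clen c, m')" for s
    using run_t funpow_trans[of t "step ?P" "init_config d"] unfolding run_def by blast
  from this[of "T' - t"] show "Q (snd (run ?P d T'))" using t(1) assms(3) m'(2) by simp
  show "halts_within ?P d T'"
    unfolding halts_within_def using run_t h t(1) assms(3) by (metis le_trans)
qed

section \<open>Finite sample sets\<close>

text \<open>Each single comparison holds for all sufficiently small positive \<delta>, and finitely
  many thresholds have a positive minimum. To make thresholds combine, the induction speaks about
  all \<delta> up to \<open>e\<close> and not about one witness.\<close>

lemma infinitesimal_elim: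
  assumes "finite S"
  shows "\<exists>\<delta>>0::rat. \<forall>p\<in>S. \<forall>q\<in>S. qlt p q \<longrightarrow> fst p + \<delta> * snd p < fst q + \<delta> * snd q"
proof -
  have "finite R \<Longrightarrow> \<exists>e>0::rat. \<forall>\<delta>. 0 < \<delta> \<and> \<delta> \<le> e \<longrightarrow>
      (\<forall>(p, q)\<in>R. qlt p q \<longrightarrow> fst p + \<delta> * snd p < fst q + \<delta> * snd q)" for R
  proof (induction R rule: finite_induct)
    case empty
    then show ?case by (intro exI[of _ 1]) auto
  next
    case (insert pq R)
    obtain p q where pq: "pq = (p, q)" by (rule prod.exhaust)
    obtain e where e: "e > 0" "\<forall>\<delta>. 0 < \<delta> \<and> \<delta> \<le> e \<longrightarrow>
      (\<forall>(p, q)\<in>R. qlt p q \<longrightarrow> fst p + \<delta> * snd p < fst q + \<delta> * snd q)"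
      using insert.IH by blast
    \<comment> \<open>If the first components differ, \<delta> times the difference of the second
      ones must stay below their gap. The added 1 avoids division by zero and keeps the result
      strict.\<close>
    define e' where "e' = (if fst p < fst q then (fst q - fst p) / (1 + \<bar>snd p - snd q\<bar>) else 1)"
    have den: "1 + \<bar>snd p - snd q\<bar> > 0" by linarith
    have e': "e' > 0" using den by (simp add: e'_def)
    have "fst p + \<delta> * snd p < fst q + \<delta> * snd q" if d: "0 < \<delta>" "\<delta> \<le> e'" and lt: "qlt p q" for \<delta>
    proof (cases "fst p < fst q")
      case True
      then have "\<delta> * (1 + \<bar>snd p - snd q\<bar>) \<le> fst q - fst p"
        using d(2) den by (simp add: e'_def pos_le_divide_eq)
      moreover have "\<delta> * (snd p - snd q) \<le> \<delta> * \<bar>snd p - snd q\<bar>"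
        using d(1) by (intro mult_left_mono) auto
      ultimately show ?thesis using d(1) by (simp add: algebra_simps)
    next
      case False
      then show ?thesis using lt d(1) by (simp add: qlt_def)
    qed
    then show ?case using e e' pq by (intro exI[of _ "min e e'"]) auto
  qed
  from this[of "S \<times> S"] assms obtain e where "e > 0" "\<forall>\<delta>. 0 < \<delta> \<and> \<delta> \<le> e \<longrightarrow>
      (\<forall>(p, q)\<in>S \<times> S. qlt p q \<longrightarrow> fst p + \<delta> * snd p < fst q + \<delta> * snd q)" by auto
  then show ?thesis by (intro exI[of _ e]) auto
qed

text \<open>\<open>weak G Y h\<close> says that \<open>h\<close> solves the non-strict two-variable system
  satisfied by the identity on \<open>Y\<close>.\<close>
definition weak :: "rat set \<Rightarrow> rat set \<Rightarrow> (rat \<Rightarrow> rat) \<Rightarrow> bool" where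
  "weak G Y h \<longleftrightarrow> (\<forall>y\<in>Y. h y > 0) \<and> (\<forall>x\<in>Y. \<forall>y\<in>Y. \<forall>r\<in>G. r * x \<le> y \<longrightarrow> r * h x \<le> h y)"

text \<open>Rescaling all values outside \<open>S\<close> by a common factor keeps the constraints inside and
  outside \<open>S\<close>; the extreme admissible factor makes a constraint across the border tight.\<close>
lemma weak_extend:
  assumes fin: "finite Y" "finite G" and G: "1 \<in> G" "\<And>r. r \<in> G \<Longrightarrow> r > 0" "\<And>r. r \<in> G \<Longrightarrow> 1 / r \<in> G"
    and S: "S \<subset> Y" "S \<noteq> {}" and w: "weak G Y h"
  obtains h' x y r where "weak G Y h'" "\<And>s. s \<in> S \<Longrightarrow> h' s = h s"
    "x \<in> S" "y \<in> Y - S" "r \<in> G" "h' y = r * h x"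
proof -
  have pos: "h y > 0" if "y \<in> Y" for y using w that by (simp add: weak_def)
  have le: "r * h x \<le> h y" if "x \<in> Y" "y \<in> Y" "r \<in> G" "r * x \<le> y" for x y r
    using w that by (simp add: weak_def)
  \<comment> \<open>For a factor \<open>t\<close> on the values outside \<open>S\<close>,
    constraints leading from outside into \<open>S\<close> give the upper bounds \<open>?U\<close>,
    and constraints leading out of \<open>S\<close> give the lower bounds \<open>?D\<close>.\<close>
  let ?U = "(\<lambda>(x, y, r). h y / (r * h x)) ` {(x, y, r) \<in> (Y - S) \<times> S \<times> G. r * x \<le> y}"
  let ?D = "(\<lambda>(x, y, r). r * h x / h y) ` {(x, y, r) \<in> S \<times> (Y - S) \<times> G. r * x \<le> y}"
  let ?h = "\<lambda>t y. if y \<in> S then h y else t * h y"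
  have fin3: "finite (Y \<times> Y \<times> G)" using fin by simp
  have finU: "finite ?U" by (rule finite_imageI, rule finite_subset[OF _ fin3]) (use S in auto)
  have finD: "finite ?D" by (rule finite_imageI, rule finite_subset[OF _ fin3]) (use S in auto)
  obtain a b where ab: "a \<in> S" "b \<in> Y - S" using S by blast
  \<comment> \<open>As \<open>1 \<in> G\<close>, any two elements are related by a constraint, so
    some bound exists. Upper bounds are at least 1 and lower bounds at most 1, because
    \<open>h\<close> itself is a solution; hence moving \<open>t\<close> from 1 to the nearest bound
    on one side violates none on the other.\<close>
  consider "?U \<noteq> {}" | "?D \<noteq> {}"
  proof (cases "b \<le> a")
    case True
    then have "(b, a, 1) \<in> {(x, y, r) \<in> (Y - S) \<times> S \<times> G. r * x \<le> y}" using ab G by auto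
    then show ?thesis using that by blast
  next
    case False
    then have "(a, b, 1) \<in> {(x, y, r) \<in> S \<times> (Y - S) \<times> G. r * x \<le> y}" using ab G by auto
    then show ?thesis using that by blast
  qed
  then show ?thesis
  proof cases
    case 1
    define t where "t = Min ?U"
    have "t \<in> ?U" unfolding t_def using 1 finU by (rule Min_in[rotated])
    then obtain x0 y0 r0 where t0: "x0 \<in> Y - S" "y0 \<in> S" "r0 \<in> G" "r0 * x0 \<le> y0"
        "t = h y0 / (r0 * h x0)" by auto
    have tle: "t \<le> h y / (r * h x)" if "x \<in> Y - S" "y \<in> S" "r \<in> G" "r * x \<le> y" for x y r
      unfolding t_def by (rule Min_le[OF finU]) (use that in \<open>auto intro!: image_eqI[of _ _ "(x, y, r)"]\<close>)
    have p0: "r0 * h x0 > 0" using t0 G pos by simp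
    have t1: "t \<ge> 1" using t0 S le[of x0 y0 r0] p0 by auto
    have "weak G Y (?h t)" unfolding weak_def
    proof (intro conjI ballI impI)
      fix y assume "y \<in> Y" then show "?h t y > 0" using pos t1 by (auto intro: mult_pos_pos)
    next
      fix x y r assume h: "x \<in> Y" "y \<in> Y" "r \<in> G" "r * x \<le> y"
      note l = le[OF h]
      have p: "r * h x > 0" using h G pos by simp
      consider "x \<in> S" "y \<in> S" | "x \<in> S" "y \<notin> S" | "x \<notin> S" "y \<in> S" | "x \<notin> S" "y \<notin> S" by blast
      then show "r * ?h t x \<le> ?h t y"
      proof cases
        case 2
        have "h y \<le> t * h y" using t1 pos[OF h(2)] by simp
        then show ?thesis using 2 l by simp
      next
        case 3
        then show ?thesis using tle[of x y r] h p by (simp add: pos_le_divide_eq mult_ac)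
      next
        case 4
        then show ?thesis using l t1 mult_left_mono[OF l, of t] by (simp add: mult_ac)
      qed (use l in simp_all)
    qed
    \<comment> \<open>Here the new element stands on the left of the tight constraint, hence the
      inverse ratio.\<close>
    moreover have "?h t x0 = (1 / r0) * h y0"
      using t0 p0 by (auto simp: field_simps)
    ultimately show ?thesis using that[of "?h t" y0 x0 "1 / r0"] t0 G by auto
  next
    case 2
    define t where "t = Max ?D"
    have "t \<in> ?D" unfolding t_def using 2 finD by (rule Max_in[rotated])
    then obtain x0 y0 r0 where t0: "x0 \<in> S" "y0 \<in> Y - S" "r0 \<in> G" "r0 * x0 \<le> y0"
        "t = r0 * h x0 / h y0" by auto
    have tge: "r * h x / h y \<le> t" if "x \<in> S" "y \<in> Y - S" "r \<in> G" "r * x \<le> y" for x y r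
      unfolding t_def by (rule Max_ge[OF finD]) (use that in \<open>auto intro!: image_eqI[of _ _ "(x, y, r)"]\<close>)
    have p0: "h y0 > 0" "h x0 > 0" "r0 > 0" using t0 S G pos by auto
    have t1: "t \<le> 1" "t > 0" using t0 S le[of x0 y0 r0] p0 by auto
    have "weak G Y (?h t)" unfolding weak_def
    proof (intro conjI ballI impI)
      fix y assume "y \<in> Y" then show "?h t y > 0" using pos t1 by (auto intro: mult_pos_pos)
    next
      fix x y r assume h: "x \<in> Y" "y \<in> Y" "r \<in> G" "r * x \<le> y"
      note l = le[OF h]
      have p: "r * h x > 0" using h G pos by simp
      consider "x \<in> S" "y \<in> S" | "x \<in> S" "y \<notin> S" | "x \<notin> S" "y \<in> S" | "x \<notin> S" "y \<notin> S" by blast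
      then show "r * ?h t x \<le> ?h t y"
      proof cases
        case 3
        have "t * (r * h x) \<le> r * h x" using t1 p by (intro mult_left_le_one_le) auto
        then show ?thesis using 3 l by (simp add: mult_ac)
      next
        case 2
        then show ?thesis using tge[of x y r] h pos[of y] by (simp add: pos_divide_le_eq mult_ac)
      next
        case 4
        then show ?thesis using l t1 mult_left_mono[OF l, of t] by (simp add: mult_ac)
      qed (use l in simp_all)
    qed
    moreover have "?h t y0 = r0 * h x0"
      using t0 p0 by auto
    ultimately show ?thesis using that[of "?h t" x0 y0 r0] t0 by auto
  qed
qed

text \<open>The identity solves its own system, so start with \<open>S = {1}\<close>. Each use of
  \<open>weak_extend\<close> attaches one more element to \<open>S\<close> at the price of one
  ratio, and \<open>d\<close> rounds exhaust \<open>Y\<close>. \<open>M k\<close> stands for values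
  reachable by \<open>k\<close> ratios; it stays abstract so that a representation over a fixed
  denominator can be plugged in.\<close>

lemma weak_rounding:
  fixes M :: "nat \<Rightarrow> rat set"
  assumes fin: "finite Y" "finite G" and G: "1 \<in> G" "\<And>r. r \<in> G \<Longrightarrow> r > 0" "\<And>r. r \<in> G \<Longrightarrow> 1 / r \<in> G"
    and Y: "1 \<in> Y" "\<And>y. y \<in> Y \<Longrightarrow> y > 0" "card Y \<le> Suc d"
    and M: "1 \<in> M 0" "\<And>k z. z \<in> M k \<Longrightarrow> k < d \<Longrightarrow> z \<in> M (Suc k)"
      "\<And>k z r. z \<in> M k \<Longrightarrow> k < d \<Longrightarrow> r \<in> G \<Longrightarrow> r * z \<in> M (Suc k)"
  obtains h where "weak G Y h" "h 1 = 1" "\<And>y. y \<in> Y \<Longrightarrow> h y \<in> M d"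
proof -
  have "\<exists>S h. S \<subseteq> Y \<and> 1 \<in> S \<and> card S \<ge> min (Suc k) (card Y) \<and> weak G Y h \<and> h 1 = 1
      \<and> (\<forall>y\<in>S. h y \<in> M k)" if "k \<le> d" for k
    using that
  proof (induction k)
    case 0
    then show ?case using Y M(1)
      by (intro exI[of _ "{1}"] exI[of _ id]) (auto simp: weak_def)
  next
    case (Suc k)
    then obtain S h where S: "S \<subseteq> Y" "1 \<in> S" "card S \<ge> min (Suc k) (card Y)" "weak G Y h" "h 1 = 1"
      "\<forall>y\<in>S. h y \<in> M k" by auto
    show ?case
    proof (cases "S = Y")
      case True
      then show ?thesis using S M(2) Suc.prems by (intro exI[of _ S] exI[of _ h]) auto
    next
      case False
      then have "S \<subset> Y" using S by blast
      moreover have "S \<noteq> {}" using S by blast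
      ultimately obtain h' x y r where h': "weak G Y h'" "\<And>s. s \<in> S \<Longrightarrow> h' s = h s"
        "x \<in> S" "y \<in> Y - S" "r \<in> G" "h' y = r * h x"
        using weak_extend[of Y G S h] fin G S(4) by metis
      have "finite S" using S fin finite_subset by blast
      then have "card (insert y S) \<ge> min (Suc (Suc k)) (card Y)" using S h' by auto
      moreover have "\<forall>y\<in>insert y S. h' y \<in> M (Suc k)" using h' S M Suc.prems by auto
      ultimately show ?thesis using h' S by (intro exI[of _ "insert y S"] exI[of _ h']) auto
    qed
  qed
  from this[of d] obtain S h where S: "S \<subseteq> Y" "card S \<ge> card Y" "weak G Y h" "h 1 = 1"
      "\<forall>y\<in>S. h y \<in> M d" using Y(3) by auto
  then have "S = Y" using fin by (meson card_seteq)
  then show ?thesis using that S by auto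
qed

section \<open>Restoring the strict inequalities\<close>

lemma rank_less_card:
  fixes f :: "'a \<Rightarrow> rat"
  assumes "finite Y" "y \<in> Y"
  shows "card {z \<in> f ` Y. z < f y} < card Y"
proof -
  have "card {z \<in> f ` Y. z < f y} < card (f ` Y)"
    using assms by (intro psubset_card_mono) auto
  also have "\<dots> \<le> card Y" using assms card_image_le by blast
  finally show ?thesis .
qed

lemma rank_strict_mono:
  fixes f :: "'a \<Rightarrow> rat"
  assumes "finite Y" "x \<in> Y" "f x < f y"
  shows "card {z \<in> f ` Y. z < f x} < card {z \<in> f ` Y. z < f y}"
  using assms by (intro psubset_card_mono) auto

text \<open>A weak solution loses strictness only where a constraint becomes tight; there the quotients
  \<open>y / h y\<close> still see it, so it is restored by shifts that follow the rank of these quotients.\<close>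
lemma strict_rounding:
  assumes "finite Y" "1 \<in> Y" "card Y \<le> Suc d" and w: "weak G Y h" and h1: "h 1 = 1"
    and G: "\<And>r. r \<in> G \<Longrightarrow> r > 0" "\<And>r. r \<in> G \<Longrightarrow> 1 / r \<in> G"
    and Y: "\<And>y. y \<in> Y \<Longrightarrow> y > 0"
    and gap: "\<And>x y r. x \<in> Y \<Longrightarrow> y \<in> Y \<Longrightarrow> r \<in> G \<Longrightarrow> r * h x < h y \<Longrightarrow>
        r * h x * rat_of_nat (H + 2 * d) < h y * rat_of_nat H"
  obtains i :: "rat \<Rightarrow> nat" where "i 1 = d" "\<And>y. y \<in> Y \<Longrightarrow> i y \<le> 2 * d"
    "\<And>x y r. x \<in> Y \<Longrightarrow> y \<in> Y \<Longrightarrow> r \<in> G \<Longrightarrow> r * x = y \<Longrightarrow>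
        r * (h x * rat_of_nat (H + i x)) = h y * rat_of_nat (H + i y)"
    "\<And>x y r. x \<in> Y \<Longrightarrow> y \<in> Y \<Longrightarrow> r \<in> G \<Longrightarrow> r * x < y \<Longrightarrow>
        r * (h x * rat_of_nat (H + i x)) < h y * rat_of_nat (H + i y)"
proof -
  define f where "f y = y / h y" for y
  define rk where "rk y = card {z \<in> f ` Y. z < f y}" for y
  \<comment> \<open>Centred so that the element 1 gets the shift \<open>d\<close>; its factor
    \<open>(H + d) / (H + d)\<close> then leaves 1 fixed. Ranks are at most \<open>d\<close>, so the
    subtraction does not truncate.\<close>
  define i where "i y = d + rk y - rk 1" for y
  have rk: "rk y \<le> d" if "y \<in> Y" for y
    using rank_less_card[OF assms(1) that, of f] assms(3) by (simp add: rk_def)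
  have pos: "h y > 0" if "y \<in> Y" for y using w that by (simp add: weak_def)
  have le: "r * h x \<le> h y" if "x \<in> Y" "y \<in> Y" "r \<in> G" "r * x \<le> y" for x y r
    using w that by (simp add: weak_def)
  have rk1: "rk 1 \<le> d" using rk assms(2) by blast
  show ?thesis
  proof (rule that[of i])
    show "i 1 = d" by (simp add: i_def)
    show "i y \<le> 2 * d" if "y \<in> Y" for y using rk[OF that] by (simp add: i_def)
  next
    fix x y r assume h: "x \<in> Y" "y \<in> Y" "r \<in> G" "r * x = y"
    have r: "r > 0" using G h by blast
    \<comment> \<open>An equality is two weak constraints, with \<open>r\<close> and with its
      inverse, so it survives as an equality.\<close>
    have "(1 / r) * h y \<le> h x" using le[of y x "1 / r"] h(1-3) h(4)[symmetric] G(2) r by simp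
    then have eq: "r * h x = h y" using le[of x y r] h r by (simp add: field_simps)
    have "f x = f y" unfolding f_def using r eq h(4) by (metis mult_divide_mult_cancel_left less_irrefl)
    then have "i x = i y" by (simp add: i_def rk_def)
    then show "r * (h x * rat_of_nat (H + i x)) = h y * rat_of_nat (H + i y)"
      by (simp add: eq[symmetric])
  next
    fix x y r assume h: "x \<in> Y" "y \<in> Y" "r \<in> G" "r * x < y"
    have r: "r > 0" using G h by blast
    have "r * h x \<le> h y" using le h by simp
    then consider "r * h x < h y" | "r * h x = h y" by linarith
    then show "r * (h x * rat_of_nat (H + i x)) < h y * rat_of_nat (H + i y)"
    proof cases
      case 1
      have "i x \<le> 2 * d" using rk[OF h(1)] by (simp add: i_def)
      then have "r * h x * rat_of_nat (H + i x) \<le> r * h x * rat_of_nat (H + 2 * d)"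
        using r pos[OF h(1)] by (intro mult_left_mono) auto
      also have "\<dots> < h y * rat_of_nat H" using gap h 1 by blast
      also have "\<dots> \<le> h y * rat_of_nat (H + i y)"
        using pos[OF h(2)] by (intro mult_left_mono) auto
      finally show ?thesis by (simp add: mult.assoc)
    next
      case 2
      \<comment> \<open>The constraint has become tight, so both quotients can be written over
        \<open>h y\<close>, where they inherit the strict inequality between \<open>r * x\<close>
        and \<open>y\<close>.\<close>
      have "f x = r * x / h y" unfolding f_def 2[symmetric] using r by simp
      also have "\<dots> < f y" unfolding f_def using h(4) pos[OF h(2)] by (simp add: divide_strict_right_mono)
      finally have "rk x < rk y" unfolding rk_def by (rule rank_strict_mono[OF assms(1) h(1)])
      then have "i x < i y" unfolding i_def using rk1 by linarith
      then have "rat_of_nat (H + i x) < rat_of_nat (H + i y)" by simp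
      then show ?thesis using pos[OF h(2)] 2 by (simp add: mult.assoc[symmetric])
    qed
  qed
qed

section \<open>The sample set and why it suffices\<close>

definition monomials :: "nat set \<Rightarrow> nat \<Rightarrow> nat set" where
  "monomials Q n = {\<Prod>q\<in>Q. q ^ f q | f. \<forall>q\<in>Q. f q \<le> n}"

text \<open>Exponents in \<open>[-d, d]\<close> appear as exponents in \<open>[0, 2 d]\<close> over
  the fixed denominator \<open>\<Prod>Q ^ d\<close>. All samples thus share one denominator, and the
  machine only has to produce natural numerators.\<close>

definition samples :: "nat set \<Rightarrow> nat \<Rightarrow> nat \<Rightarrow> rat set" where
  "samples Q d H = insert 0 {s * rat_of_nat (u * (H + i)) / rat_of_nat (\<Prod>Q ^ d * (H + d)) | s u i.
     s \<in> {1, -1} \<and> u \<in> monomials Q (2 * d) \<and> i \<le> 2 * d}"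

lemma monomials_bounds:
  assumes "finite Q" "\<And>q. q \<in> Q \<Longrightarrow> q > 0" "u \<in> monomials Q n"
  shows "u > 0" "u \<le> \<Prod>Q ^ n"
proof -
  obtain f where f: "u = (\<Prod>q\<in>Q. q ^ f q)" "\<forall>q\<in>Q. f q \<le> n"
    using assms(3) by (auto simp: monomials_def)
  show "u > 0" using assms(2) f(1) by (simp add: prod_pos)
  have "u \<le> (\<Prod>q\<in>Q. q ^ n)" unfolding f(1)
    by (rule prod_mono) (use assms(2) f(2) in \<open>auto intro: power_increasing simp: Suc_leI\<close>)
  then show "u \<le> \<Prod>Q ^ n" by (simp add: prod_power_distrib)
qed

text \<open>Multiplication by \<open>a / b\<close> with the division cleared: one unit of exponent
  moves from \<open>b\<close> to \<open>a\<close>, while the common denominator stays as it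
  is.\<close>

lemma prod_power_shift:
  fixes f :: "nat \<Rightarrow> nat"
  assumes "finite Q" "a \<in> Q" "b \<in> Q" "a \<noteq> b" "f b > 0"
  shows "a * (\<Prod>q\<in>Q. q ^ f q) = b * (\<Prod>q\<in>Q. q ^ (f(a := Suc (f a), b := f b - 1)) q)"
proof -
  let ?g = "f(a := Suc (f a), b := f b - 1)"
  let ?R = "Q - {a} - {b}"
  have split: "(\<Prod>q\<in>Q. q ^ e q) = a ^ e a * (b ^ e b * (\<Prod>q\<in>?R. q ^ e q))" for e
    using assms by (subst prod.remove[of Q a], simp, simp, subst prod.remove[of "Q - {a}" b]) auto
  have "(\<Prod>q\<in>?R. q ^ ?g q) = (\<Prod>q\<in>?R. q ^ f q)" by (rule prod.cong) auto
  moreover obtain n where "f b = Suc n" using assms(5) gr0_conv_Suc by blast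
  ultimately show ?thesis unfolding split using assms(4) by simp
qed

text \<open>Different signs decide the comparison alone. For equal signs the absolute values decide,
  in reverse order if both are negative, hence the two premises about them.\<close>

lemma sgn_abs_less:
  fixes u v u' v' :: rat
  assumes "sgn u' = sgn u" "sgn v' = sgn v" "u < v"
    "u \<noteq> 0 \<Longrightarrow> v \<noteq> 0 \<Longrightarrow> \<bar>u\<bar> < \<bar>v\<bar> \<Longrightarrow> \<bar>u'\<bar> < \<bar>v'\<bar>"
    "u \<noteq> 0 \<Longrightarrow> v \<noteq> 0 \<Longrightarrow> \<bar>v\<bar> < \<bar>u\<bar> \<Longrightarrow> \<bar>v'\<bar> < \<bar>u'\<bar>"
  shows "u' < v'"
  using assms by (auto simp: sgn_if abs_if split: if_splits)

lemma sgn_abs_eq: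
  fixes u v u' v' :: rat
  assumes "sgn u' = sgn u" "sgn v' = sgn v" "u = v"
    "u \<noteq> 0 \<Longrightarrow> v \<noteq> 0 \<Longrightarrow> \<bar>u\<bar> = \<bar>v\<bar> \<Longrightarrow> \<bar>u'\<bar> = \<bar>v'\<bar>"
  shows "u' = v'"
  using assms by (auto simp: sgn_if abs_if split: if_splits)

lemma sample_positive_solution:
  assumes Q: "finite Q" "Q \<noteq> {}" "\<forall>q\<in>Q. q > 0"
    and Y: "finite Y" "1 \<in> Y" "\<forall>y\<in>Y. (y::rat) > 0" "card Y \<le> Suc d"
    and H: "H > 2 * d * \<Prod>Q ^ (2 * d + 1)"
  shows "\<exists>g. g 1 = 1 \<and>
    (\<forall>y\<in>Y. g y > 0 \<and> (\<exists>u\<in>monomials Q (2 * d). \<exists>i\<le>2 * d.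
        g y = rat_of_nat (u * (H + i)) / rat_of_nat (\<Prod>Q ^ d * (H + d)))) \<and>
    (\<forall>a\<in>Q. \<forall>b\<in>Q. \<forall>x\<in>Y. \<forall>y\<in>Y.
        (rat_of_nat a * x = rat_of_nat b * y \<longrightarrow> rat_of_nat a * g x = rat_of_nat b * g y) \<and>
        (rat_of_nat a * x < rat_of_nat b * y \<longrightarrow> rat_of_nat a * g x < rat_of_nat b * g y))"
proof -
  note Q3 = Q(3)[rule_format] and Y3 = Y(3)[rule_format]
  define G where "G = (\<lambda>(a, b). rat_of_nat a / rat_of_nat b) ` (Q \<times> Q)"
  define U where "U = \<Prod>Q ^ d"
  \<comment> \<open>Over the denominator \<open>U\<close> these are the exponents in
    \<open>[-k, k]\<close>; one further ratio changes each exponent by at most 1.\<close>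
  define M where "M k = {rat_of_nat (\<Prod>q\<in>Q. q ^ f q) / rat_of_nat U | f.
      \<forall>q\<in>Q. d \<le> f q + k \<and> f q \<le> d + k}" for k
  have P: "\<Prod>Q > 0" using Q by (simp add: prod_pos)
  then have U: "U > 0" by (simp add: U_def)
  have finG: "finite G" using Q by (simp add: G_def)
  have posG: "r > 0" if "r \<in> G" for r using that Q3 by (auto simp: G_def)
  have G1: "1 \<in> G"
  proof -
    obtain q where "q \<in> Q" using Q(2) by blast
    then show ?thesis unfolding G_def using Q3 by (intro image_eqI[of _ _ "(q, q)"]) force+
  qed
  have invG: "1 / r \<in> G" if "r \<in> G" for r
    using that unfolding G_def by (auto intro!: image_eqI[of _ _ "(b, a)" for a b])
  have M0: "1 \<in> M 0"
  proof -
    have "(\<Prod>q\<in>Q. q ^ d) = U" by (simp add: U_def prod_power_distrib)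
    then show ?thesis unfolding M_def using U by (intro CollectI exI[of _ "\<lambda>_. d"]) simp
  qed
  have M1: "z \<in> M (Suc k)" if "z \<in> M k" "k < d" for k z
    using that unfolding M_def by force
  have M2: "r * z \<in> M (Suc k)" if z: "z \<in> M k" and k: "k < d" and r: "r \<in> G" for k z r
  proof -
    obtain a b where ab: "a \<in> Q" "b \<in> Q" "r = rat_of_nat a / rat_of_nat b" using r by (auto simp: G_def)
    have b0: "rat_of_nat b \<noteq> 0" using Q3 ab(2) by force
    show ?thesis
    proof (cases "a = b")
      case True
      then show ?thesis using ab b0 M1[OF z k] by simp
    next
      case False
      obtain f where f: "z = rat_of_nat (\<Prod>q\<in>Q. q ^ f q) / rat_of_nat U"
          "\<forall>q\<in>Q. d \<le> f q + k \<and> f q \<le> d + k" using z by (auto simp: M_def)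
      have fb: "f b > 0" using f(2) ab(2) k by fastforce
      let ?f = "f(a := Suc (f a), b := f b - 1)"
      have "rat_of_nat a * rat_of_nat (\<Prod>q\<in>Q. q ^ f q) = rat_of_nat b * rat_of_nat (\<Prod>q\<in>Q. q ^ ?f q)"
        using prod_power_shift[of Q a b f, OF Q(1) ab(1,2) False fb] by (metis of_nat_mult)
      then have "r * z = rat_of_nat (\<Prod>q\<in>Q. q ^ ?f q) / rat_of_nat U"
        using b0 unfolding ab(3) f(1) by (simp add: field_simps)
      moreover have "\<forall>q\<in>Q. d \<le> ?f q + Suc k \<and> ?f q \<le> d + Suc k"
        using f(2) False fb by force
      ultimately show ?thesis unfolding M_def by blast
    qed
  qed
  obtain h where h: "weak G Y h" "h 1 = 1" "\<And>y. y \<in> Y \<Longrightarrow> h y \<in> M d"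
    by (rule weak_rounding[OF Y(1) finG G1 posG invG Y(2) Y3 Y(4) M0 M1 M2]) auto
  have hu: "\<exists>u\<in>monomials Q (2 * d). h y = rat_of_nat u / rat_of_nat U" if "y \<in> Y" for y
    using h(3)[OF that] unfolding M_def monomials_def by (force simp: mult_2)
  have gap: "r * h x * rat_of_nat (H + 2 * d) < h y * rat_of_nat H"
    if xy: "x \<in> Y" "y \<in> Y" and r: "r \<in> G" and lt: "r * h x < h y" for x y r
  proof -
    obtain a b where ab: "a \<in> Q" "b \<in> Q" "r = rat_of_nat a / rat_of_nat b" using r by (auto simp: G_def)
    obtain u v where u: "u \<in> monomials Q (2 * d)" "h x = rat_of_nat u / rat_of_nat U"
      and v: "v \<in> monomials Q (2 * d)" "h y = rat_of_nat v / rat_of_nat U" using hu xy by blast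
    have b0: "rat_of_nat b > 0" using Q3 ab(2) by force
    have U0: "rat_of_nat U > 0" using U by simp
    have "rat_of_nat (a * u) < rat_of_nat (b * v)"
      using lt b0 U0 unfolding ab(3) u(2) v(2) by (simp add: field_simps)
    \<comment> \<open>With denominators cleared, strictly ordered integers differ by at least 1.
      Since \<open>a\<close> is at most \<open>\<Prod>Q\<close> and \<open>u\<close> at most
      \<open>\<Prod>Q ^ (2 * d)\<close>, the bound on \<open>H\<close> is what keeps the worst
      shift, \<open>2 * d * (a * u)\<close>, below this difference times \<open>H\<close>.\<close>
    then have "a * u + 1 \<le> b * v" by linarith
    then have 1: "(a * u + 1) * H \<le> b * v * H" by (rule mult_le_mono1)
    have "a \<le> \<Prod>Q" using Q ab(1) P by (metis dvd_imp_le dvd_prod_eqI)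
    then have "a * u \<le> \<Prod>Q * \<Prod>Q ^ (2 * d)"
      using monomials_bounds(2)[OF Q(1) Q3 u(1)] by (intro mult_le_mono) auto
    then have "2 * d * (a * u) \<le> 2 * d * \<Prod>Q ^ (2 * d + 1)" by simp
    then have "2 * d * (a * u) < H" using H by (rule le_less_trans)
    then have "a * u * (H + 2 * d) < (a * u + 1) * H" by (simp add: algebra_simps)
    then have "a * u * (H + 2 * d) < b * v * H" using 1 by (rule less_le_trans)
    then have "rat_of_nat (a * u * (H + 2 * d)) < rat_of_nat (b * v * H)" by (simp only: of_nat_less_iff)
    from divide_strict_right_mono[OF this mult_pos_pos[OF b0 U0]] show ?thesis
      using b0 U0 unfolding ab(3) u(2) v(2) by (simp add: mult_ac)
  qed
  obtain i where i: "i 1 = d" "\<And>y. y \<in> Y \<Longrightarrow> i y \<le> 2 * d"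
    "\<And>x y r. x \<in> Y \<Longrightarrow> y \<in> Y \<Longrightarrow> r \<in> G \<Longrightarrow> r * x = y \<Longrightarrow>
        r * (h x * rat_of_nat (H + i x)) = h y * rat_of_nat (H + i y)"
    "\<And>x y r. x \<in> Y \<Longrightarrow> y \<in> Y \<Longrightarrow> r \<in> G \<Longrightarrow> r * x < y \<Longrightarrow>
        r * (h x * rat_of_nat (H + i x)) < h y * rat_of_nat (H + i y)"
    by (rule strict_rounding[OF Y(1,2,4) h(1,2) posG invG Y3 gap]) auto
  have H0: "rat_of_nat (H + d) > 0" using H by simp
  define g where "g y = h y * rat_of_nat (H + i y) / rat_of_nat (H + d)" for y
  show ?thesis
  proof (intro exI[of _ g] conjI[of "g 1 = 1"] conjI[of "\<forall>y\<in>Y. P y" for P] conjI[of "A \<longrightarrow> B" for A B] ballI impI)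
    show "g 1 = 1" unfolding g_def h(2) i(1) using H0 by simp
  next
    fix y assume y: "y \<in> Y"
    obtain u where u: "u \<in> monomials Q (2 * d)" "h y = rat_of_nat u / rat_of_nat U" using hu y by blast
    have "u > 0" using monomials_bounds(1)[OF Q(1) Q3 u(1)] .
    then have "g y > 0" unfolding g_def u(2) using U H0 H by simp
    moreover have "g y = rat_of_nat (u * (H + i y)) / rat_of_nat (\<Prod>Q ^ d * (H + d))"
      unfolding g_def u(2) U_def[symmetric] by simp
    ultimately show "g y > 0 \<and> (\<exists>u\<in>monomials Q (2 * d). \<exists>i\<le>2 * d.
        g y = rat_of_nat (u * (H + i)) / rat_of_nat (\<Prod>Q ^ d * (H + d)))" using u(1) i(2)[OF y] by blast
  next
    fix a b x y assume a: "a \<in> Q" "b \<in> Q" "x \<in> Y" "y \<in> Y"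
    have r: "rat_of_nat a / rat_of_nat b \<in> G" using a by (auto simp: G_def)
    have b0: "rat_of_nat b > 0" using Q3 a(2) by force
    {
      assume "rat_of_nat a * x = rat_of_nat b * y"
      then have "rat_of_nat a / rat_of_nat b * x = y" using b0 by (simp add: field_simps)
      from i(3)[OF a(3,4) r this] show "rat_of_nat a * g x = rat_of_nat b * g y"
        unfolding g_def using b0 H0 by (simp add: field_simps)
    next
      assume "rat_of_nat a * x < rat_of_nat b * y"
      then have "rat_of_nat a / rat_of_nat b * x < y" using b0 by (simp add: field_simps)
      from i(4)[OF a(3,4) r this]
      have "rat_of_nat a * (h x * rat_of_nat (H + i x)) < rat_of_nat b * (h y * rat_of_nat (H + i y))"
        using b0 by (simp add: field_simps)
      from divide_strict_right_mono[OF this H0] show "rat_of_nat a * g x < rat_of_nat b * g y"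
        unfolding g_def by simp
    }
  qed
qed

definition coeff_abs :: "int set \<Rightarrow> nat set" where
  "coeff_abs Z = (\<lambda>z. nat \<bar>z\<bar>) ` (Z - {0})"

text \<open>Signs and zeros are kept and only absolute values are rounded, so the signs of both
  sides of a constraint do not change and the comparison reduces to the positive case.\<close>

lemma sample_solution:
  assumes Z: "finite Z" "\<not> Z \<subseteq> {0}" and X: "finite X" "card X \<le> d"
    and H: "H > 2 * d * \<Prod>(coeff_abs Z) ^ (2 * d + 1)"
  shows "\<exists>g :: rat \<Rightarrow> rat. g 1 = 1 \<and> (\<forall>x\<in>X. g x \<in> samples (coeff_abs Z) d H) \<and>
    (\<forall>\<alpha>\<in>Z. \<forall>\<beta>\<in>Z. \<forall>x\<in>insert 1 X. \<forall>y\<in>insert 1 X.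
        (of_int \<alpha> * x = of_int \<beta> * y \<longrightarrow> of_int \<alpha> * g x = of_int \<beta> * g y) \<and>
        (of_int \<alpha> * x < of_int \<beta> * y \<longrightarrow> of_int \<alpha> * g x < of_int \<beta> * g y))"
proof -
  let ?Q = "coeff_abs Z"
  let ?Y = "abs ` insert 1 X - {0}"
  have "card ?Y \<le> card (insert 1 X)"
    using X(1) by (meson card_Diff1_le card_image_le finite_insert le_trans)
  also have "\<dots> \<le> Suc d" using X by (simp add: card_insert_if)
  finally have cY: "card ?Y \<le> Suc d" .
  have Q: "finite ?Q" "?Q \<noteq> {}" "\<forall>q\<in>?Q. q > 0" using Z by (auto simp: coeff_abs_def)
  have Y: "finite ?Y" "1 \<in> ?Y" "\<forall>y\<in>?Y. y > 0" using X(1) by auto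
  obtain \<gamma> where \<gamma>: "\<gamma> 1 = 1"
    "\<forall>y\<in>?Y. \<gamma> y > 0 \<and> (\<exists>u\<in>monomials ?Q (2 * d). \<exists>i\<le>2 * d.
        \<gamma> y = rat_of_nat (u * (H + i)) / rat_of_nat (\<Prod>?Q ^ d * (H + d)))"
    "\<forall>a\<in>?Q. \<forall>b\<in>?Q. \<forall>x\<in>?Y. \<forall>y\<in>?Y.
        (rat_of_nat a * x = rat_of_nat b * y \<longrightarrow> rat_of_nat a * \<gamma> x = rat_of_nat b * \<gamma> y) \<and>
        (rat_of_nat a * x < rat_of_nat b * y \<longrightarrow> rat_of_nat a * \<gamma> x < rat_of_nat b * \<gamma> y)"
    using sample_positive_solution[OF Q Y cY H] by (elim exE conjE) (rule that)
  define g where "g x = sgn x * \<gamma> \<bar>x\<bar>" for x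
  have pos: "\<gamma> \<bar>x\<bar> > 0" if "x \<in> insert 1 X" "x \<noteq> 0" for x
  proof -
    have "\<bar>x\<bar> \<in> ?Y" using that by auto
    then show ?thesis using \<gamma>(2) by blast
  qed
  have sgn_g: "sgn (of_int \<alpha> * g x) = sgn (of_int \<alpha> * x)" if "x \<in> insert 1 X" for \<alpha> x
    using pos[OF that] by (cases "x = 0") (auto simp: g_def sgn_mult)
  have abs_g: "\<bar>of_int \<alpha> * g x\<bar> = rat_of_nat (nat \<bar>\<alpha>\<bar>) * \<gamma> \<bar>x\<bar>"
    if "x \<in> insert 1 X" "x \<noteq> 0" for \<alpha> x
    using pos[OF that] that(2) by (simp add: g_def abs_mult abs_sgn_eq)
  have abs_id: "\<bar>of_int \<alpha> * x\<bar> = rat_of_nat (nat \<bar>\<alpha>\<bar>) * \<bar>x\<bar>" for \<alpha> and x :: rat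
    by (simp add: abs_mult)
  have less: "\<bar>of_int \<alpha> * g x\<bar> < \<bar>of_int \<beta> * g y\<bar>"
    if h: "\<alpha> \<in> Z" "\<beta> \<in> Z" "x \<in> insert 1 X" "y \<in> insert 1 X" "of_int \<alpha> * x \<noteq> 0" "of_int \<beta> * y \<noteq> 0"
      "\<bar>of_int \<alpha> * x\<bar> < \<bar>of_int \<beta> * y\<bar>" for \<alpha> \<beta> x y
  proof -
    have nz: "x \<noteq> 0" "y \<noteq> 0" using h by auto
    have "nat \<bar>\<alpha>\<bar> \<in> ?Q" "nat \<bar>\<beta>\<bar> \<in> ?Q" "\<bar>x\<bar> \<in> ?Y" "\<bar>y\<bar> \<in> ?Y"
      using h by (auto simp: coeff_abs_def)
    from \<gamma>(3)[rule_format, OF this] show ?thesis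
      using h(7) unfolding abs_g[OF h(3) nz(1)] abs_g[OF h(4) nz(2)] unfolding abs_id by blast
  qed
  have eq: "\<bar>of_int \<alpha> * g x\<bar> = \<bar>of_int \<beta> * g y\<bar>"
    if h: "\<alpha> \<in> Z" "\<beta> \<in> Z" "x \<in> insert 1 X" "y \<in> insert 1 X" "of_int \<alpha> * x \<noteq> 0" "of_int \<beta> * y \<noteq> 0"
      "\<bar>of_int \<alpha> * x\<bar> = \<bar>of_int \<beta> * y\<bar>" for \<alpha> \<beta> x y
  proof -
    have nz: "x \<noteq> 0" "y \<noteq> 0" using h by auto
    have "nat \<bar>\<alpha>\<bar> \<in> ?Q" "nat \<bar>\<beta>\<bar> \<in> ?Q" "\<bar>x\<bar> \<in> ?Y" "\<bar>y\<bar> \<in> ?Y"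
      using h by (auto simp: coeff_abs_def)
    from \<gamma>(3)[rule_format, OF this] show ?thesis
      using h(7) unfolding abs_g[OF h(3) nz(1)] abs_g[OF h(4) nz(2)] unfolding abs_id by blast
  qed
  show ?thesis
  proof (intro exI[of _ g] conjI[of "g 1 = 1"] conjI[of "\<forall>x\<in>X. P x" for P] conjI[of "A \<longrightarrow> B" for A B] ballI impI)
    show "g 1 = 1" using \<gamma>(1) by (simp add: g_def)
    fix x assume x: "x \<in> X"
    show "g x \<in> samples ?Q d H"
    proof (cases "x = 0")
      case False
      then have "sgn x \<in> {1, -1}" by (auto simp: sgn_if)
      moreover obtain u i where "u\<in>monomials ?Q (2 * d)" "i\<le>2 * d"
        "\<gamma> \<bar>x\<bar> = rat_of_nat (u * (H + i)) / rat_of_nat (\<Prod>?Q ^ d * (H + d))"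
      proof -
        have "\<bar>x\<bar> \<in> ?Y" using x False by auto
        then show ?thesis using \<gamma>(2) that by blast
      qed
      ultimately show ?thesis unfolding samples_def g_def
        by (intro insertI2 CollectI exI[of _ "sgn x"] exI[of _ u] exI[of _ i]) simp
    qed (simp add: samples_def g_def)
  next
    fix \<alpha> \<beta> x y
    assume h: "\<alpha> \<in> Z" "\<beta> \<in> Z" "x \<in> insert 1 X" "y \<in> insert 1 X"
    {
      assume "of_int \<alpha> * x = of_int \<beta> * y"
      then show "of_int \<alpha> * g x = of_int \<beta> * g y"
        by (rule sgn_abs_eq[OF sgn_g[OF h(3)] sgn_g[OF h(4)]]) (rule eq[OF h])
    next
      assume "of_int \<alpha> * x < of_int \<beta> * y"
      then show "of_int \<alpha> * g x < of_int \<beta> * g y"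
        by (rule sgn_abs_less[OF sgn_g[OF h(3)] sgn_g[OF h(4)]])
          (rule less[OF h], assumption+, rule less[OF h(2,1,4,3)], assumption+)
    }
  qed
qed

text \<open>\<open>None\<close> is the constant 1, so the two sides of an atom need no distinction
  between constants and variables.\<close>

fun operand :: "(nat \<Rightarrow> qstar) \<Rightarrow> nat option \<Rightarrow> qstar" where
  "operand s None = qone"
| "operand s (Some v) = s v"

text \<open>Substituting \<delta> for the infinitesimal is linear and fixes 1; it preserves
  equations for any \<delta> and the finitely many relevant strict inequalities for a small one.
  What remains is a system over the rationals.\<close>

lemma sample_assignment:
  assumes Z: "finite Z" "\<not> Z \<subseteq> {0}" and V: "finite V" "card V \<le> d"
    and H: "H > 2 * d * \<Prod>(coeff_abs Z) ^ (2 * d + 1)"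
  obtains s' where "\<And>v. s' v \<in> samples (coeff_abs Z) d H"
    "\<And>v w. s v = s w \<Longrightarrow> s' v = s' w"
    "\<And>\<alpha> \<beta> p q \<sigma>. \<alpha> \<in> Z \<Longrightarrow> \<beta> \<in> Z \<Longrightarrow> p \<in> insert None (Some ` V) \<Longrightarrow> q \<in> insert None (Some ` V) \<Longrightarrow>
        sigma_sem \<sigma> (qscale (of_int \<alpha>) (operand s p)) (qscale (of_int \<beta>) (operand s q)) \<Longrightarrow>
        sigma_sem \<sigma> (qscale (of_int \<alpha>) (operand (\<lambda>v. (s' v, 0)) p))
          (qscale (of_int \<beta>) (operand (\<lambda>v. (s' v, 0)) q))"
proof -
  let ?O = "insert None (Some ` V)"
  let ?S = "(\<lambda>(\<alpha>, p). qscale (of_int \<alpha>) (operand s p)) ` (Z \<times> ?O)"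
  have "finite ?S" using Z V by simp
  from infinitesimal_elim[OF this] obtain \<delta> where
    \<delta>: "\<forall>p\<in>?S. \<forall>q\<in>?S. qlt p q \<longrightarrow> fst p + \<delta> * snd p < fst q + \<delta> * snd q" by (elim exE conjE)
  define e where "e p = fst p + \<delta> * snd p" for p :: qstar
  have lt: "of_int \<alpha> * e (operand s p) < of_int \<beta> * e (operand s q)"
    if "\<alpha> \<in> Z" "\<beta> \<in> Z" "p \<in> ?O" "q \<in> ?O"
      "qlt (qscale (of_int \<alpha>) (operand s p)) (qscale (of_int \<beta>) (operand s q))" for \<alpha> \<beta> p q
  proof -
    have "qscale (of_int \<alpha>) (operand s p) \<in> ?S"
      using that(1,3) by (intro image_eqI[of _ _ "(\<alpha>, p)"]) auto
    moreover have "qscale (of_int \<beta>) (operand s q) \<in> ?S"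
      using that(2,4) by (intro image_eqI[of _ _ "(\<beta>, q)"]) auto
    ultimately have "fst (qscale (of_int \<alpha>) (operand s p)) + \<delta> * snd (qscale (of_int \<alpha>) (operand s p))
      < fst (qscale (of_int \<beta>) (operand s q)) + \<delta> * snd (qscale (of_int \<beta>) (operand s q))"
      using \<delta> that(5) by blast
    then show ?thesis
      by (simp add: e_def qscale_def algebra_simps)
  qed
  have eq: "of_int \<alpha> * e (operand s p) = of_int \<beta> * e (operand s q)"
    if "qscale (of_int \<alpha>) (operand s p) = qscale (of_int \<beta>) (operand s q)" for \<alpha> \<beta> p q
  proof -
    have "of_int \<alpha> * fst (operand s p) = of_int \<beta> * fst (operand s q)"
      "of_int \<alpha> * snd (operand s p) = of_int \<beta> * snd (operand s q)"
      using that by (simp_all add: qscale_def)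
    then show ?thesis unfolding e_def by (metis distrib_left mult.left_commute)
  qed
  have "finite ((\<lambda>v. e (s v)) ` V)" "card ((\<lambda>v. e (s v)) ` V) \<le> d" using V card_image_le[of V "\<lambda>v. e (s v)"] by auto
  from sample_solution[OF Z this H] obtain g where g: "g 1 = 1" "\<forall>x\<in>(\<lambda>v. e (s v)) ` V. g x \<in> samples (coeff_abs Z) d H"
    "\<forall>\<alpha>\<in>Z. \<forall>\<beta>\<in>Z. \<forall>x\<in>insert 1 ((\<lambda>v. e (s v)) ` V). \<forall>y\<in>insert 1 ((\<lambda>v. e (s v)) ` V).
        (of_int \<alpha> * x = of_int \<beta> * y \<longrightarrow> of_int \<alpha> * g x = of_int \<beta> * g y) \<and>
        (of_int \<alpha> * x < of_int \<beta> * y \<longrightarrow> of_int \<alpha> * g x < of_int \<beta> * g y)"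
    by (elim exE conjE) (rule that)
  \<comment> \<open>The test is on the value and not on membership of \<open>v\<close> in
    \<open>V\<close>, so that \<open>s'\<close> depends on \<open>s v\<close> alone and respects
    equality of any two variables. The default 0 is itself a sample.\<close>
  define s' where "s' v = (if e (s v) \<in> (\<lambda>v. e (s v)) ` V then g (e (s v)) else 0)" for v
  have op: "operand (\<lambda>v. (s' v, 0)) p = (g (e (operand s p)), 0)"
    and op_in: "e (operand s p) \<in> insert 1 ((\<lambda>v. e (s v)) ` V)" if "p \<in> ?O" for p
    using that g(1) by (auto simp: s'_def e_def qone_def)
  show ?thesis
  proof (rule that[of s'])
    show "s' v \<in> samples (coeff_abs Z) d H" for v
      using g(2)[rule_format, of "e (s v)"] by (auto simp: s'_def samples_def)
    show "s' v = s' w" if "s v = s w" for v w using that by (simp add: s'_def)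
  next
    fix \<alpha> \<beta> p q \<sigma>
    assume h: "\<alpha> \<in> Z" "\<beta> \<in> Z" "p \<in> ?O" "q \<in> ?O"
      "sigma_sem \<sigma> (qscale (of_int \<alpha>) (operand s p)) (qscale (of_int \<beta>) (operand s q))"
    note g' = g(3)[rule_format, OF h(1,2) op_in[OF h(3)] op_in[OF h(4)]]
    show "sigma_sem \<sigma> (qscale (of_int \<alpha>) (operand (\<lambda>v. (s' v, 0)) p))
          (qscale (of_int \<beta>) (operand (\<lambda>v. (s' v, 0)) q))"
      unfolding op[OF h(3)] op[OF h(4)]
    proof (cases \<sigma>)
      case SLess
      then have "of_int \<alpha> * e (operand s p) < of_int \<beta> * e (operand s q)" using lt[OF h(1-4)] h(5) by simp
      then have "of_int \<alpha> * g (e (operand s p)) < of_int \<beta> * g (e (operand s q))" using g' by blast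
      then show "sigma_sem \<sigma> (qscale (of_int \<alpha>) (g (e (operand s p)), 0))
          (qscale (of_int \<beta>) (g (e (operand s q)), 0))" unfolding SLess by (simp add: qlt_def qscale_def)
    next
      case SEq
      then have "of_int \<alpha> * e (operand s p) = of_int \<beta> * e (operand s q)" by (intro eq) (use h(5) in simp)
      then have "of_int \<alpha> * g (e (operand s p)) = of_int \<beta> * g (e (operand s q))" using g' by blast
      then show "sigma_sem \<sigma> (qscale (of_int \<alpha>) (g (e (operand s p)), 0))
          (qscale (of_int \<beta>) (g (e (operand s q)), 0))" unfolding SEq by (simp add: qscale_def)
    qed
  qed
qed

section \<open>Evaluating formulas\<close>

fun atoms :: "qf \<Rightarrow> nf_atom set" where
  "atoms (Atom a) = {a}"
| "atoms (And f g) = atoms f \<union> atoms g"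
| "atoms (Or f g) = atoms f \<union> atoms g"

fun atom_coeffs :: "nf_atom \<Rightarrow> rat set" where
  "atom_coeffs ATop = {}"
| "atom_coeffs ABot = {}"
| "atom_coeffs (ConstVar c \<sigma> i) = {c}"
| "atom_coeffs (VarConst i \<sigma> c) = {c}"
| "atom_coeffs (VarVar c1 i \<sigma> c2 j) = {c1, c2}"

type_synonym lin = "int \<times> nat option \<times> sigma \<times> int \<times> nat option"

fun lin_sem :: "lin \<Rightarrow> (nat \<Rightarrow> qstar) \<Rightarrow> bool" where
  "lin_sem (\<alpha>, p, \<sigma>, \<beta>, q) s \<longleftrightarrow>
     sigma_sem \<sigma> (qscale (of_int \<alpha>) (operand s p)) (qscale (of_int \<beta>) (operand s q))"

fun lin_coeffs :: "lin \<Rightarrow> int set" where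
  "lin_coeffs (\<alpha>, p, \<sigma>, \<beta>, q) = {\<alpha>, \<beta>}"

fun lin_vars :: "lin \<Rightarrow> nat set" where
  "lin_vars (\<alpha>, p, \<sigma>, \<beta>, q) = set_option p \<union> set_option q"

text \<open>The floor is only taken of integers: \<open>\<Delta>\<close> will be a common denominator.\<close>
definition scaled :: "int \<Rightarrow> rat \<Rightarrow> int" where
  "scaled \<Delta> c = \<lfloor>of_int \<Delta> * c\<rfloor>"

text \<open>Multiplication by \<Delta> gives a bare variable or the constant 1 opposite a scaled
  constant the coefficient \<Delta>. Truth and falsity become \<open>1 = 1\<close> and
  \<open>1 < 1\<close> scaled by \<Delta>, so the evaluator has a single kind of atom.\<close>

fun normal :: "int \<Rightarrow> nf_atom \<Rightarrow> lin" where
  "normal \<Delta> ATop = (\<Delta>, None, SEq, \<Delta>, None)"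
| "normal \<Delta> ABot = (\<Delta>, None, SLess, \<Delta>, None)"
| "normal \<Delta> (ConstVar c \<sigma> i) = (scaled \<Delta> c, None, \<sigma>, \<Delta>, Some i)"
| "normal \<Delta> (VarConst i \<sigma> c) = (\<Delta>, Some i, \<sigma>, scaled \<Delta> c, None)"
| "normal \<Delta> (VarVar c1 i \<sigma> c2 j) = (scaled \<Delta> c1, Some i, \<sigma>, scaled \<Delta> c2, Some j)"

lemma qscale_mult: "qscale (a * b) p = qscale a (qscale b p)"
  by (simp add: qscale_def mult.assoc)

lemma qscale_one [simp]: "qscale 1 p = p"
  by (simp add: qscale_def)

lemma sigma_sem_qscale:
  "c > 0 \<Longrightarrow> sigma_sem \<sigma> (qscale c p) (qscale c q) \<longleftrightarrow> sigma_sem \<sigma> p q"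
  by (cases \<sigma>; cases p; cases q) (auto simp: qscale_def qlt_def)

lemma lin_sem_normal:
  assumes "\<Delta> > 0" "\<forall>c\<in>atom_coeffs a. of_int (scaled \<Delta> c) = of_int \<Delta> * c"
  shows "lin_sem (normal \<Delta> a) s \<longleftrightarrow> nf_atom_sem a s"
proof -
  have D: "sigma_sem \<sigma> (qscale (of_int \<Delta> * a) p) (qscale (of_int \<Delta> * b) q)
      \<longleftrightarrow> sigma_sem \<sigma> (qscale a p) (qscale b q)" for \<sigma> a b p q
    using assms(1) by (simp add: qscale_mult sigma_sem_qscale)
  show ?thesis
    using assms(2) D[of _ _ _ 1] D[of _ 1] D[of _ 1 _ 1]
    by (cases a) (auto simp: D qlt_def)
qed

lemma common_denominator:
  fixes F :: "rat set"
  assumes "finite F"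
  obtains \<Delta> :: int where "\<Delta> > 0" "\<forall>c\<in>F. of_int (scaled \<Delta> c) = of_int \<Delta> * c"
proof -
  have "\<exists>\<Delta>::int. \<Delta> > 0 \<and> (\<forall>c\<in>F. \<exists>z::int. of_int \<Delta> * c = of_int z)"
    using assms
  proof (induction F rule: finite_induct)
    case empty
    then show ?case by (intro exI[of _ 1]) auto
  next
    case (insert c F)
    then obtain \<Delta> :: int where \<Delta>: "\<Delta> > 0" "\<forall>c\<in>F. \<exists>z::int. of_int \<Delta> * c = of_int z" by blast
    obtain a b where c: "c = of_int a / of_int b" "b > 0"
      using quotient_of_div[of c] quotient_of_denom_pos[of c] by (cases "quotient_of c") auto
    have "\<exists>z::int. of_int (\<Delta> * b) * x = (of_int z :: rat)" if "x \<in> insert c F" for x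
    proof (cases "x = c")
      case True
      then show ?thesis using c by (intro exI[of _ "\<Delta> * a"]) simp
    next
      case False
      then obtain z :: int where "of_int \<Delta> * x = of_int z" using \<Delta>(2) \<open>x \<in> insert c F\<close> by blast
      then show ?thesis by (intro exI[of _ "b * z"]) (simp add: mult_ac)
    qed
    then show ?case using \<Delta>(1) c(2) by (intro exI[of _ "\<Delta> * b"]) auto
  qed
  then obtain \<Delta> :: int where "\<Delta> > 0" "\<forall>c\<in>F. \<exists>z::int. of_int \<Delta> * c = of_int z" by blast
  then show ?thesis using that[of \<Delta>] by (force simp: scaled_def)
qed

section \<open>Straight-line code for atoms and formulas\<close>

text \<open>The machine has no multiplication. The factors are constants of the program, so unrolled
  additions cost only constant time.\<close>

definition addmul :: "nat \<Rightarrow> nat \<Rightarrow> nat \<Rightarrow> instr list" where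
  "addmul a b k = replicate k (Add a a b)"

lemma basic_addmul [simp]: "list_all basic (addmul a b k)"
  by (simp add: addmul_def list_all_iff)

lemma length_addmul [simp]: "length (addmul a b k) = k"
  by (simp add: addmul_def)

lemma fold_addmul [simp]: "a \<noteq> b \<Longrightarrow> fold upd (addmul a b k) m = m(a := m a + k * m b)"
  by (induction k arbitrary: m) (auto simp: addmul_def)

text \<open>Register 10 holds the representation of 1, register 11 the offset of the table of values
  (the element \<open>t\<close> has the value \<open>m (t + m 11) - m (t + m 11 + 1)\<close>), and register
  \<open>13 + j\<close> the \<open>j\<close>-th component of the current tuple.\<close>
fun load_operand :: "nat \<Rightarrow> nat option \<Rightarrow> instr list" where
  "load_operand r None = [Const (r + 1) 0, Add r 10 (r + 1)]"
| "load_operand r (Some j) =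
     [Add r (13 + j) 11, Const (r + 1) 1, Add (r + 1) r (r + 1), Load r r, Load (r + 1) (r + 1)]"

fun operand_pos :: "mem \<Rightarrow> nat option \<Rightarrow> nat" where
  "operand_pos m None = m 10"
| "operand_pos m (Some j) = m (m (13 + j) + m 11)"

fun operand_neg :: "mem \<Rightarrow> nat option \<Rightarrow> nat" where
  "operand_neg m None = 0"
| "operand_neg m (Some j) = m (m (13 + j) + m 11 + 1)"

definition operand_value :: "mem \<Rightarrow> nat option \<Rightarrow> int" where
  "operand_value m p = int (operand_pos m p) - int (operand_neg m p)"

text \<open>\<open>K\<close> separates registers from the table: a lookup at or above
  \<open>K\<close> cannot hit a scratch register that the evaluation overwrites.\<close>

fun operand_ok :: "nat \<Rightarrow> mem \<Rightarrow> nat option \<Rightarrow> bool" where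
  "operand_ok K m None = True"
| "operand_ok K m (Some j) = (m (13 + j) + m 11 \<ge> K)"

lemma fold_load_operand:
  assumes "\<forall>j\<in>set_option p. 13 + j < r" "11 < r" "r + 1 < K" "operand_ok K m p"
  shows "fold upd (load_operand r p) m = m(r := operand_pos m p, r + 1 := operand_neg m p)"
  using assms by (cases p) (auto simp: fun_eq_iff)

lemma operand_cong:
  assumes "\<forall>j\<in>set_option p. 13 + j < r" "11 < r" "r \<le> K" "operand_ok K m p"
    "\<forall>a. a < r \<or> K \<le> a \<longrightarrow> n a = m a"
  shows "operand_pos n p = operand_pos m p" "operand_neg n p = operand_neg m p" "operand_ok K n p"
  using assms by (cases p; auto)+

text \<open>Truncated subtraction decides the order: \<open>y - x\<close> is nonzero iff
  \<open>x < y\<close>. For equality, the two truncated differences add up to the distance, and 1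
  minus the distance is nonzero iff the distance is 0.\<close>

fun compare :: "nat \<Rightarrow> sigma \<Rightarrow> instr list" where
  "compare r SLess = [Sub r (r + 1) r]"
| "compare r SEq = [Sub (r + 2) r (r + 1), Sub (r + 3) (r + 1) r, Add (r + 2) (r + 2) (r + 3),
     Const r 1, Sub r r (r + 2)]"

fun int_rel :: "sigma \<Rightarrow> int \<Rightarrow> int \<Rightarrow> bool" where
  "int_rel SLess x y = (x < y)"
| "int_rel SEq x y = (x = y)"

text \<open>Registers hold natural numbers, while coefficients and values may be negative. Each
  product of a coefficient with a part of an operand is added to the side where it counts
  positively; \<open>r\<close> and \<open>r + 1\<close> end with the same difference as the two
  sides of the atom.\<close>

fun lin_code :: "nat \<Rightarrow> lin \<Rightarrow> instr list" where
  "lin_code r (\<alpha>, p, \<sigma>, \<beta>, q) = [Const r 0, Const (r + 1) 0]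
     @ load_operand (r + 2) p
     @ addmul r (r + 2) (nat \<alpha>) @ addmul r (r + 3) (nat (- \<alpha>))
     @ addmul (r + 1) (r + 3) (nat \<alpha>) @ addmul (r + 1) (r + 2) (nat (- \<alpha>))
     @ load_operand (r + 2) q
     @ addmul (r + 1) (r + 2) (nat \<beta>) @ addmul (r + 1) (r + 3) (nat (- \<beta>))
     @ addmul r (r + 3) (nat \<beta>) @ addmul r (r + 2) (nat (- \<beta>))
     @ compare r \<sigma>"

lemma basic_load_operand [simp]: "list_all basic (load_operand r p)"
  by (cases p) auto

lemma basic_compare [simp]: "list_all basic (compare r \<sigma>)"
  by (cases \<sigma>) auto

lemma basic_lin_code [simp]: "list_all basic (lin_code r l)"
  by (cases l) auto

lemma fold_compare:
  "let m' = fold upd (compare r \<sigma>) m in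
    (m' r \<noteq> 0 \<longleftrightarrow> int_rel \<sigma> (int (m r)) (int (m (r + 1)))) \<and> (\<forall>a. a < r \<or> r + 4 \<le> a \<longrightarrow> m' a = m a)"
  by (cases \<sigma>) (auto simp: Let_def)

lemma int_rel_shift: "x - y = x' - y' \<Longrightarrow> int_rel \<sigma> x y \<longleftrightarrow> int_rel \<sigma> x' y'"
  by (cases \<sigma>) auto

lemma nat_diff_mult:
  "int (nat \<alpha> * x + nat (- \<alpha>) * y) - int (nat \<alpha> * y + nat (- \<alpha>) * x) = \<alpha> * (int x - int y)"
  by (cases "\<alpha> \<ge> 0") (auto simp: algebra_simps)

lemma fold_lin_code:
  assumes "\<forall>j\<in>lin_vars l. 13 + j < r" "11 < r" "r + 4 \<le> K" "l = (\<alpha>, p, \<sigma>, \<beta>, q)"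
    "operand_ok K m p" "operand_ok K m q"
  defines "m' \<equiv> fold upd (lin_code r l) m"
  shows "m' r \<noteq> 0 \<longleftrightarrow> int_rel \<sigma> (\<alpha> * operand_value m p) (\<beta> * operand_value m q)"
    and "a < r \<or> r + 4 \<le> a \<Longrightarrow> m' a = m a"
proof -
  define m0 where "m0 = m(r := 0, r + 1 := 0)"
  let ?x = "operand_pos m p" and ?y = "operand_neg m p"
  let ?x' = "operand_pos m q" and ?y' = "operand_neg m q"
  have vars: "\<forall>j\<in>set_option p. 13 + j < r" "\<forall>j\<in>set_option q. 13 + j < r"
    using assms(1,4) by auto
  have r: "r \<le> K" using assms(3) by simp
  define m1 where "m1 = m0(r := nat \<alpha> * ?x + nat (- \<alpha>) * ?y, r + 1 := nat \<alpha> * ?y + nat (- \<alpha>) * ?x,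
     r + 2 := ?x, r + 3 := ?y)"
  have m0: "\<forall>a. a < r \<or> K \<le> a \<longrightarrow> m0 a = m a" using assms(3) by (auto simp: m0_def)
  have m1: "a < r \<or> r + 4 \<le> a \<Longrightarrow> m1 a = m a" for a by (auto simp: m1_def m0_def)
  have m1': "\<forall>a. a < r \<or> K \<le> a \<longrightarrow> m1 a = m a" using m1 assms(3) by auto
  note c0 = operand_cong[OF vars(1) assms(2) r assms(5) m0]
  note c1 = operand_cong[OF vars(2) assms(2) r assms(6) m1']
  have xy: "fold upd (load_operand (r + 2) p) m0 = m0(r + 2 := ?x, r + 3 := ?y)"
  proof -
    have "fold upd (load_operand (r + 2) p) m0 = m0(r + 2 := operand_pos m0 p, r + 2 + 1 := operand_neg m0 p)"
      by (rule fold_load_operand) (use vars(1) assms(2,3) c0 in auto)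
    then show ?thesis unfolding c0 by (simp add: numeral_eq_Suc)
  qed
  have xy': "fold upd (load_operand (r + 2) q) m1 = m1(r + 2 := ?x', r + 3 := ?y')"
  proof -
    have "fold upd (load_operand (r + 2) q) m1 = m1(r + 2 := operand_pos m1 q, r + 2 + 1 := operand_neg m1 q)"
      by (rule fold_load_operand) (use vars(2) assms(2,3) c1 in auto)
    then show ?thesis unfolding c1 by (simp add: numeral_eq_Suc)
  qed
  define m2 where "m2 = m1(r := nat \<alpha> * ?x + nat (- \<alpha>) * ?y + nat \<beta> * ?y' + nat (- \<beta>) * ?x',
     r + 1 := nat \<alpha> * ?y + nat (- \<alpha>) * ?x + nat \<beta> * ?x' + nat (- \<beta>) * ?y', r + 2 := ?x', r + 3 := ?y')"
  have m2: "a < r \<or> r + 4 \<le> a \<Longrightarrow> m2 a = m a" for a using m1 by (auto simp: m2_def)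
  define L1 where "L1 = addmul r (r + 2) (nat \<alpha>) @ addmul r (r + 3) (nat (- \<alpha>))
     @ addmul (r + 1) (r + 3) (nat \<alpha>) @ addmul (r + 1) (r + 2) (nat (- \<alpha>))"
  define L2 where "L2 = addmul (r + 1) (r + 2) (nat \<beta>) @ addmul (r + 1) (r + 3) (nat (- \<beta>))
     @ addmul r (r + 3) (nat \<beta>) @ addmul r (r + 2) (nat (- \<beta>))"
  have e0: "fold upd [Const r 0, Const (r + 1) 0] m = m0" by (simp add: m0_def)
  have e1: "fold upd L1 (m0(r + 2 := ?x, r + 3 := ?y)) = m1"
    by (auto simp: L1_def m1_def m0_def fun_eq_iff)
  have e2: "fold upd L2 (m1(r + 2 := ?x', r + 3 := ?y')) = m2"
    by (auto simp: L2_def m1_def m2_def m0_def fun_eq_iff)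
  have "lin_code r l = [Const r 0, Const (r + 1) 0] @ load_operand (r + 2) p @ L1
      @ load_operand (r + 2) q @ L2 @ compare r \<sigma>"
    unfolding assms(4) lin_code.simps L1_def L2_def by (simp only: append_assoc)
  then have m': "m' = fold upd (compare r \<sigma>) m2"
    unfolding m'_def by (simp only: fold_append o_apply e0 xy e1 xy' e2)
  have "int (m2 r) - int (m2 (r + 1)) = \<alpha> * operand_value m p - \<beta> * operand_value m q"
    unfolding operand_value_def nat_diff_mult[symmetric] by (simp add: m2_def)
  then show "m' r \<noteq> 0 \<longleftrightarrow> int_rel \<sigma> (\<alpha> * operand_value m p) (\<beta> * operand_value m q)"
    using fold_compare[of r \<sigma> m2] int_rel_shift unfolding m' Let_def by blast
  show "a < r \<or> r + 4 \<le> a \<Longrightarrow> m' a = m a"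
    using fold_compare[of r \<sigma> m2] m2 unfolding m' Let_def by metis
qed

text \<open>Truth is represented by any nonzero number: a disjunction is a sum and a conjunction is
  a minimum, so no jumps are needed.\<close>
fun qf_code :: "int \<Rightarrow> nat \<Rightarrow> qf \<Rightarrow> instr list" where
  "qf_code \<Delta> r (Atom a) = lin_code r (normal \<Delta> a)"
| "qf_code \<Delta> r (And f g) =
     qf_code \<Delta> r f @ qf_code \<Delta> (r + 1) g @ [Sub (r + 1) r (r + 1), Sub r r (r + 1)]"
| "qf_code \<Delta> r (Or f g) = qf_code \<Delta> r f @ qf_code \<Delta> (r + 1) g @ [Add r r (r + 1)]"

text \<open>Counts scratch registers from \<open>r\<close> on: an atom uses four, and the right
  operand of a connective starts one higher because the left result waits in
  \<open>r\<close>.\<close>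

fun depth :: "qf \<Rightarrow> nat" where
  "depth (Atom a) = 4"
| "depth (And f g) = max (depth f) (depth g + 1)"
| "depth (Or f g) = max (depth f) (depth g + 1)"

lemma basic_qf_code [simp]: "list_all basic (qf_code \<Delta> r f)"
  by (induction f arbitrary: r) auto

lemma depth_ge: "depth f \<ge> 4"
  by (induction f) auto

text \<open>Values are table differences over the denominator in register 10, and the constant 1 is
  represented by that denominator. All operands are thus scaled by one positive factor, which no
  comparison notices.\<close>

lemma fold_qf_code:
  fixes val :: "nat \<Rightarrow> rat"
  assumes "\<Delta> > 0" "\<forall>a\<in>atoms f. \<forall>c\<in>atom_coeffs a. of_int (scaled \<Delta> c) = of_int \<Delta> * c"
    and "qf_wf k f" "13 + k \<le> r" "r + depth f \<le> K"
    and one: "m 10 > 0"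
    and val: "\<And>j. j < k \<Longrightarrow> operand_ok K m (Some j) \<and>
      val j = of_int (operand_value m (Some j)) / of_nat (m 10)"
  shows "(fold upd (qf_code \<Delta> r f) m r \<noteq> 0 \<longleftrightarrow> qf_sem f (\<lambda>j. (val j, 0)))
    \<and> (\<forall>a. a < r \<or> K \<le> a \<longrightarrow> fold upd (qf_code \<Delta> r f) m a = m a)"
  using assms
proof (induction f arbitrary: r m)
  case (Atom a)
  obtain \<alpha> p \<sigma> \<beta> q where l: "normal \<Delta> a = (\<alpha>, p, \<sigma>, \<beta>, q)" by (cases "normal \<Delta> a") auto
  have vars: "j < k" if "j \<in> lin_vars (normal \<Delta> a)" for j
    using that Atom.prems(3) by (cases a) auto
  have pos: "rat_of_nat (m 10) > 0" using Atom.prems(6) by simp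
  have ok: "operand_ok K m s \<and> operand (\<lambda>j. (val j, 0)) s = (of_int (operand_value m s) / of_nat (m 10), 0)"
    if "s \<in> {p, q}" for s
  proof (cases s)
    case None
    then show ?thesis using pos by (simp add: qone_def operand_value_def)
  next
    case (Some j)
    then have "j < k" using vars that l by auto
    then show ?thesis using Atom.prems(7)[of j] Some by simp
  qed
  have "qf_sem (Atom a) (\<lambda>j. (val j, 0)) \<longleftrightarrow> lin_sem (normal \<Delta> a) (\<lambda>j. (val j, 0))"
    using lin_sem_normal[of \<Delta> a] Atom.prems(1,2) by simp
  also have "\<dots> \<longleftrightarrow> sigma_sem \<sigma> (qscale (1 / of_nat (m 10)) (of_int (\<alpha> * operand_value m p), 0))
     (qscale (1 / of_nat (m 10)) (of_int (\<beta> * operand_value m q), 0))"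
    unfolding l by (simp add: ok qscale_def)
  also have "\<dots> \<longleftrightarrow> sigma_sem \<sigma> (of_int (\<alpha> * operand_value m p), 0) (of_int (\<beta> * operand_value m q), 0)"
    using pos by (intro sigma_sem_qscale) simp
  also have "\<dots> \<longleftrightarrow> int_rel \<sigma> (\<alpha> * operand_value m p) (\<beta> * operand_value m q)"
    by (cases \<sigma>) (simp_all only: sigma_sem.simps int_rel.simps qlt_def fst_conv snd_conv of_int_less_iff
        of_int_eq_iff prod.inject less_irrefl simp_thms)
  finally have sem: "qf_sem (Atom a) (\<lambda>j. (val j, 0)) \<longleftrightarrow> \<dots>" .
  have v: "\<forall>j\<in>lin_vars (normal \<Delta> a). 13 + j < r" "11 < r" "r + 4 \<le> K"
    using vars Atom.prems(4,5) by force+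
  have okp: "operand_ok K m p" "operand_ok K m q" using ok by auto
  show ?case unfolding sem qf_code.simps
    using fold_lin_code[OF v l okp] v(3) by (meson le_trans)
next
  case (And f g)
  let ?m1 = "fold upd (qf_code \<Delta> r f) m"
  let ?m2 = "fold upd (qf_code \<Delta> (r + 1) g) ?m1"
  have 1: "(?m1 r \<noteq> 0 \<longleftrightarrow> qf_sem f (\<lambda>j. (val j, 0))) \<and> (\<forall>a. a < r \<or> K \<le> a \<longrightarrow> ?m1 a = m a)"
    by (rule And.IH(1)[OF And.prems(1) _ _ And.prems(4) _ And.prems(6,7)]) (use And.prems(2,3,5) in auto)
  have v: "j < k \<Longrightarrow> operand_ok K ?m1 (Some j) \<and>
      val j = of_int (operand_value ?m1 (Some j)) / of_nat (?m1 10)" for j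
    using 1 And.prems(4) And.prems(7)[of j] by (simp add: operand_value_def)
  have 2: "(?m2 (r + 1) \<noteq> 0 \<longleftrightarrow> qf_sem g (\<lambda>j. (val j, 0))) \<and>
      (\<forall>a. a < r + 1 \<or> K \<le> a \<longrightarrow> ?m2 a = ?m1 a)"
    by (rule And.IH(2)[OF And.prems(1) _ _ _ _ _ v]) (use 1 And.prems(2-6) in auto)
  show ?case using 1 2 And.prems(5) depth_ge[of f] by auto
next
  case (Or f g)
  let ?m1 = "fold upd (qf_code \<Delta> r f) m"
  let ?m2 = "fold upd (qf_code \<Delta> (r + 1) g) ?m1"
  have 1: "(?m1 r \<noteq> 0 \<longleftrightarrow> qf_sem f (\<lambda>j. (val j, 0))) \<and> (\<forall>a. a < r \<or> K \<le> a \<longrightarrow> ?m1 a = m a)"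
    by (rule Or.IH(1)[OF Or.prems(1) _ _ Or.prems(4) _ Or.prems(6,7)]) (use Or.prems(2,3,5) in auto)
  have v: "j < k \<Longrightarrow> operand_ok K ?m1 (Some j) \<and>
      val j = of_int (operand_value ?m1 (Some j)) / of_nat (?m1 10)" for j
    using 1 Or.prems(4) Or.prems(7)[of j] by (simp add: operand_value_def)
  have 2: "(?m2 (r + 1) \<noteq> 0 \<longleftrightarrow> qf_sem g (\<lambda>j. (val j, 0))) \<and>
      (\<forall>a. a < r + 1 \<or> K \<le> a \<longrightarrow> ?m2 a = ?m1 a)"
    by (rule Or.IH(2)[OF Or.prems(1) _ _ _ _ _ v]) (use 1 Or.prems(2-6) in auto)
  show ?case using 1 2 Or.prems(5) depth_ge[of f] by auto
qed

section \<open>Enumerating the facts\<close>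

definition store_words :: "nat list \<Rightarrow> instr list" where
  "store_words vs = concat (map (\<lambda>v. [Store 5 v, Add 5 5 7]) vs)"

lemma basic_store_words [simp]: "list_all basic (store_words vs)"
  by (induction vs) (auto simp: store_words_def)

lemma length_store_words [simp]: "length (store_words vs) = 2 * length vs"
  by (induction vs) (auto simp: store_words_def)

lemma fold_store_words:
  assumes "m 7 = 1" "7 < m 5" "\<forall>v\<in>set vs. v \<noteq> 5 \<and> v < m 5"
  shows "fold upd (store_words vs) m = (\<lambda>a. if a = 5 then m 5 + length vs
     else if m 5 \<le> a \<and> a < m 5 + length vs then m (vs ! (a - m 5)) else m a)"
  using assms
proof (induction vs arbitrary: m)
  case Nil
  then show ?case by (auto simp: store_words_def fun_eq_iff)
next
  case (Cons v vs)
  let ?m = "m(m 5 := m v, 5 := m 5 + 1)"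
  have s: "fold upd (store_words (v # vs)) m = fold upd (store_words vs) ?m"
    using Cons.prems by (simp add: store_words_def)
  have IH: "fold upd (store_words vs) ?m = (\<lambda>a. if a = 5 then ?m 5 + length vs
     else if ?m 5 \<le> a \<and> a < ?m 5 + length vs then ?m (vs ! (a - ?m 5)) else ?m a)"
    using Cons.prems by (intro Cons.IH) auto
  have v: "vs ! n \<noteq> 5 \<and> vs ! n < m 5" if "n < length vs" for n
    using Cons.prems(3) that by auto
  show ?case unfolding s IH
  proof (rule ext)
    fix a
    consider "a = 5" | "a \<noteq> 5" "a = m 5" | "a \<noteq> 5" "a \<noteq> m 5" "m 5 \<le> a" "a < m 5 + length (v # vs)"
      | "a \<noteq> 5" "\<not> (m 5 \<le> a \<and> a < m 5 + length (v # vs))" by blast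
    then show "(if a = 5 then ?m 5 + length vs
     else if ?m 5 \<le> a \<and> a < ?m 5 + length vs then ?m (vs ! (a - ?m 5)) else ?m a) =
      (if a = 5 then m 5 + length (v # vs)
       else if m 5 \<le> a \<and> a < m 5 + length (v # vs) then m ((v # vs) ! (a - m 5)) else m a)"
    proof cases
      case 3
      then have "a - m 5 = Suc (a - Suc (m 5))" "a - Suc (m 5) < length vs" by auto
      then show ?thesis using 3 v[of "a - Suc (m 5)"] by simp
    qed (use Cons.prems(2) in auto)
  qed
qed

text \<open>The fact is always written; only the advance of the output pointer (register 4) depends
  on the truth value in register \<open>r\<close>.\<close>
definition emit :: "nat \<Rightarrow> nat \<Rightarrow> nat \<Rightarrow> instr list" where
  "emit i k r = [Const 6 0, Add 5 4 6, Const 7 1, Sub 6 7 r, Sub r 7 6, Const 6 i]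
     @ store_words (6 # map (\<lambda>j. 13 + j) [0..<k]) @ addmul 4 r (k + 1)"

lemma basic_emit [simp]: "list_all basic (emit i k r)"
  by (simp add: emit_def)

lemma fold_emit:
  fixes i :: nat
  assumes "13 + k \<le> r" "r < m 4"
  defines "m' \<equiv> fold upd (emit i k r) m"
  shows "m' 4 = m 4 + (if m r \<noteq> 0 then k + 1 else 0)"
    and "j \<le> k \<Longrightarrow> m' (m 4 + j) = (i # map (\<lambda>j. m (13 + j)) [0..<k]) ! j"
    and "a \<notin> {4, 5, 6, 7, r} \<Longrightarrow> \<not> (m 4 \<le> a \<and> a \<le> m 4 + k) \<Longrightarrow> m' a = m a"
proof -
  let ?vs = "6 # map (\<lambda>j. 13 + j) [0..<k]"
  define m1 where "m1 = m(6 := i, 5 := m 4, 7 := 1, r := (if m r \<noteq> 0 then 1 else 0))"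
  \<comment> \<open>The two subtractions compute \<open>1 - (1 - r)\<close>, which turns any nonzero
    truth value into 1; it can then be multiplied by the length of the record.\<close>
  have e1: "fold upd [Const 6 0, Add 5 4 6, Const 7 1, Sub 6 7 r, Sub r 7 6, Const 6 i] m = m1"
    using assms(1,2) by (auto simp: m1_def fun_eq_iff)
  define m2 where "m2 = fold upd (store_words ?vs) m1"
  have m2: "m2 = (\<lambda>a. if a = 5 then m1 5 + length ?vs
     else if m1 5 \<le> a \<and> a < m1 5 + length ?vs then m1 (?vs ! (a - m1 5)) else m1 a)"
    unfolding m2_def using assms(1,2) by (intro fold_store_words) (auto simp: m1_def)
  have m': "m' = m2(4 := m2 4 + (k + 1) * m2 r)"
    using assms(1) unfolding m'_def emit_def
    by (simp only: fold_append o_apply e1 m2_def[symmetric]) simp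
  have m15: "m1 5 = m 4" using assms(1) by (simp add: m1_def)
  show "m' 4 = m 4 + (if m r \<noteq> 0 then k + 1 else 0)"
    using assms(1,2) unfolding m' m2 m15 by (simp add: m1_def)
  show "m' (m 4 + j) = (i # map (\<lambda>j. m (13 + j)) [0..<k]) ! j" if "j \<le> k"
  proof -
    have "m' (m 4 + j) = m1 (?vs ! j)"
      using assms(1,2) that unfolding m' m2 m15 by simp
    also have "\<dots> = (i # map (\<lambda>j. m (13 + j)) [0..<k]) ! j"
    proof (cases j)
      case 0
      then show ?thesis using assms(1) by (simp add: m1_def)
    next
      case (Suc n)
      then have "13 + n < r" "n < k" using that assms(1) by auto
      then show ?thesis unfolding Suc by (simp add: m1_def)
    qed
    finally show ?thesis .
  qed
  show "m' a = m a" if "a \<notin> {4, 5, 6, 7, r}" "\<not> (m 4 \<le> a \<and> a \<le> m 4 + k)"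
  proof -
    have "m' a = m1 a" using that unfolding m' m2 m15 by (simp add: less_Suc_eq_le) blast
    then show ?thesis using that(1) by (simp add: m1_def)
  qed
qed

text \<open>Register \<open>13 + j\<close> is at once the counter of a loop and component
  \<open>j\<close> of the tuple. Counters run down to 1, so the element 0 of the output structure
  occurs in no fact.\<close>

fun enum :: "nat \<Rightarrow> instr list \<Rightarrow> com" where
  "enum 0 b = Block b"
| "enum (Suc j) b = Block [Const 6 0, Add (13 + j) 12 6] ;; Rep (13 + j) (enum j b)"

fun enum_time :: "nat \<Rightarrow> nat \<Rightarrow> nat \<Rightarrow> nat" where
  "enum_time N b 0 = b"
| "enum_time N b (Suc j) = 2 + (N * (enum_time N b j + 5) + 1)"

definition words :: "(nat \<times> nat list) list \<Rightarrow> nat list" where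
  "words fs = concat (map (\<lambda>(i, t). i # t) fs)"

lemma words_append [simp]: "words (fs @ gs) = words fs @ words gs"
  by (simp add: words_def)

lemma words_simps [simp]: "words [] = []" "words ((i, t) # fs) = i # t @ words fs"
  by (simp_all add: words_def)

lemma nf_atom_sem_cong:
  "nf_atom_wf k a \<Longrightarrow> (\<And>j. j < k \<Longrightarrow> s j = s' j) \<Longrightarrow> nf_atom_sem a s \<longleftrightarrow> nf_atom_sem a s'"
  by (cases a) auto

lemma qf_sem_cong: "qf_wf k f \<Longrightarrow> (\<And>j. j < k \<Longrightarrow> s j = s' j) \<Longrightarrow> qf_sem f s \<longleftrightarrow> qf_sem f s'"
proof (induction f)
  case (Atom a)
  then show ?case using nf_atom_sem_cong[of k a s s'] by simp
qed simp_all

lemma all_from_Suc: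
  "j < k \<Longrightarrow> (\<forall>j'. j \<le> j' \<and> j' < k \<longrightarrow> P j') \<longleftrightarrow> P j \<and> (\<forall>j'. Suc j \<le> j' \<and> j' < k \<longrightarrow> P j')"
  by (metis Suc_leD le_neq_implies_less less_eq_Suc_le order_refl)

lemma all_from_upd:
  fixes j k :: nat
  assumes "j < k"
  shows "(\<forall>j'. j \<le> j' \<and> j' < k \<longrightarrow> P j' ((\<tau>(j := x)) j')) \<longleftrightarrow>
    P j x \<and> (\<forall>j'. Suc j \<le> j' \<and> j' < k \<longrightarrow> P j' (\<tau> j'))"
  unfolding all_from_Suc[OF assms] by auto

text \<open>The memory layout: tuple components from 13, scratch registers from \<open>E\<close>,
  the \<open>N + 1\<close> cells of the table \<open>w\<close> from \<open>K\<close>, the output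
  from \<open>H\<close>. \<open>one\<close> is the common denominator of the table.\<close>

locale value_table =
  fixes K H N one E :: nat and w :: mem and \<Delta> :: int
  assumes E: "13 \<le> E" "E < K" and H: "K + N < H" and one: "one > 0" and \<Delta>: "\<Delta> > 0"
begin

definition val :: "nat \<Rightarrow> rat" where
  "val t = (of_nat (w (t - 1)) - of_nat (w t)) / of_nat one"

text \<open>Register 11 holds \<open>K - 1\<close> because elements start at 1: element
  \<open>t\<close> reads the neighbours \<open>w (t - 1)\<close> and \<open>w t\<close>, so
  \<open>N + 1\<close> cells give \<open>N\<close> elements.\<close>

definition env :: "mem \<Rightarrow> bool" where
  "env m \<longleftrightarrow> m 0 = H \<and> m 10 = one \<and> m 11 = K - 1 \<and> m 12 = N \<and> (\<forall>t\<le>N. m (K + t) = w t)"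

text \<open>The cells \<open>H\<close> and \<open>H + 1\<close> are left free for the length of the
  output and the domain size, which are written at the end.\<close>

definition out :: "(nat \<times> nat list) list \<Rightarrow> mem \<Rightarrow> bool" where
  "out fs m \<longleftrightarrow> m 4 = H + 2 + length (words fs) \<and> (\<forall>i<length (words fs). m (H + 2 + i) = words fs ! i)"

definition sat :: "qf \<Rightarrow> nat list \<Rightarrow> bool" where
  "sat f t \<longleftrightarrow> qf_sem f (\<lambda>j. (val (t ! j), 0))"

definition rel_ok :: "nat \<Rightarrow> qf \<Rightarrow> bool" where
  "rel_ok k f \<longleftrightarrow> qf_wf k f \<and> 13 + k \<le> E \<and> E + depth f \<le> K \<and>
     (\<forall>a\<in>atoms f. \<forall>c\<in>atom_coeffs a. of_int (scaled \<Delta> c) = of_int \<Delta> * c)"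

lemma fold_body:
  fixes i :: nat
  assumes ok: "rel_ok k f" and m: "env m" "out fs m" "\<forall>j<k. m (13 + j) \<in> {1..N}"
  defines "m' \<equiv> fold upd (qf_code \<Delta> E f @ emit i k E) m"
    and "t \<equiv> map (\<lambda>j. m (13 + j)) [0..<k]"
  shows "env m'" "out (fs @ (if sat f t then [(i, t)] else [])) m'" "j < k \<Longrightarrow> m' (13 + j) = m (13 + j)"
proof -
  let ?m1 = "fold upd (qf_code \<Delta> E f) m"
  have k: "13 + k \<le> E" using ok by (simp add: rel_ok_def)
  have "operand_ok K m (Some j) \<and> val (m (13 + j)) = of_int (operand_value m (Some j)) / of_nat (m 10)"
    if "j < k" for j
  proof -
    obtain t where t: "m (13 + j) = Suc t" "t < N"
      using m(3) \<open>j < k\<close> by (metis Suc_le_eq atLeastAtMost_iff not0_implies_Suc not_one_le_zero)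
    have A: "m (13 + j) + m 11 = K + t" using t m(1) E by (simp add: env_def)
    have A': "m (13 + j) + m 11 + 1 = K + Suc t" using A by simp
    have B: "m (K + t) = w t" "m (K + Suc t) = w (Suc t)"
    proof -
      have e: "\<forall>t\<le>N. m (K + t) = w t" using m(1) by (simp add: env_def)
      show "m (K + t) = w t" "m (K + Suc t) = w (Suc t)"
        by (rule e[rule_format], use t(2) in simp)+
    qed
    have "operand_pos m (Some j) = w t" "operand_neg m (Some j) = w (Suc t)"
      by (simp only: operand_pos.simps A B) (simp only: operand_neg.simps A' B)
    moreover have "m 10 = one" using m(1) by (simp add: env_def)
    moreover have "operand_ok K m (Some j)" using A by simp
    ultimately show ?thesis unfolding val_def t(1) operand_value_def by simp
  qed
  moreover have "m 10 > 0" using m(1) one by (simp add: env_def)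
  ultimately have ev: "(?m1 E \<noteq> 0 \<longleftrightarrow> qf_sem f (\<lambda>j. (val (m (13 + j)), 0)))
    \<and> (\<forall>a. a < E \<or> K \<le> a \<longrightarrow> ?m1 a = m a)"
    using ok \<Delta> by (intro fold_qf_code[where k = k]) (auto simp: rel_ok_def)
  have sat: "?m1 E \<noteq> 0 \<longleftrightarrow> sat f t"
    using ev ok unfolding sat_def t_def rel_ok_def by (subst qf_sem_cong) auto
  have low: "?m1 a = m a" if "a < E \<or> K \<le> a" for a using ev that by blast
  have m4: "m 4 = H + 2 + length (words fs)" using m(2) by (simp add: out_def)
  have m14: "?m1 4 = m 4" using low E by simp
  have t1: "map (\<lambda>j. ?m1 (13 + j)) [0..<k] = t" unfolding t_def using low k by simp
  have lt: "length t = k" by (simp add: t_def)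
  have gt: "E < ?m1 4" using m14 m4 E H by simp
  note em = fold_emit[where m = ?m1 and i = i, OF k gt]
  have m': "m' = fold upd (emit i k E) ?m1" by (simp add: m'_def)
  have keep: "m' a = m a" if "a \<notin> {4, 5, 6, 7, E}" "a < E \<or> K \<le> a" "a < m 4" for a
    using em(3)[of a] low[of a] that m14 unfolding m' by simp
  show "env m'" using m(1) unfolding env_def using keep E H m4 by (auto simp: env_def)
  show "j < k \<Longrightarrow> m' (13 + j) = m (13 + j)" using keep k E H m4 by simp
  have old: "m' (H + 2 + n) = words fs ! n" if "n < length (words fs)" for n
    using keep[of "H + 2 + n"] that m(2) m4 E H by (simp add: out_def)
  have new: "m' (H + 2 + (length (words fs) + n)) = (i # t) ! n" if "n \<le> k" for n
    using em(2)[OF that] unfolding m' t1 m14 m4 by (simp add: add.assoc)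
  show "out (fs @ (if sat f t then [(i, t)] else [])) m'"
  proof (cases "sat f t")
    case True
    have "m' 4 = H + 2 + length (words (fs @ [(i, t)]))"
      using em(1) sat True m4 m14 lt unfolding m' by simp
    moreover have "m' (H + 2 + n) = words (fs @ [(i, t)]) ! n"
      if "n < length (words (fs @ [(i, t)]))" for n
    proof (cases "n < length (words fs)")
      case True
      then show ?thesis using old by (simp add: nth_append)
    next
      case False
      then obtain p where p: "n = length (words fs) + p" using le_Suc_ex not_less by blast
      then have "p \<le> k" using that lt by simp
      then show ?thesis using new[of p] p by simp
    qed
    ultimately show ?thesis using True by (simp add: out_def)
  next
    case False
    then have "m' 4 = m 4" using em(1) sat m14 unfolding m' by simp
    then show ?thesis using False old m4 by (simp add: out_def)
  qed
qed

text \<open>The facts still to be produced when the outer loops have fixed the components from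
  \<open>j\<close> on to \<tau>.\<close>

definition sols :: "nat \<Rightarrow> nat \<Rightarrow> qf \<Rightarrow> nat \<Rightarrow> (nat \<Rightarrow> nat) \<Rightarrow> (nat \<times> nat list) set" where
  "sols i k f j \<tau> = {(i, t) | t. length t = k \<and> set t \<subseteq> {1..N} \<and> sat f t \<and>
     (\<forall>j'. j \<le> j' \<and> j' < k \<longrightarrow> t ! j' = \<tau> j')}"

lemma env_upd: "env m \<Longrightarrow> a < E \<Longrightarrow> a \<notin> {0, 10, 11, 12} \<Longrightarrow> env (m(a := x))"
  using E H by (auto simp: env_def)

lemma out_upd: "out fs m \<Longrightarrow> a < E \<Longrightarrow> a \<noteq> 4 \<Longrightarrow> out fs (m(a := x))"
  using E H by (auto simp: out_def)

text \<open>Induction on the number of inner loops, with \<open>fs\<close> the facts already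
  written. The set of new facts says nothing about repetitions, so the length is bounded separately;
  both the running time and the choice of \<open>H\<close> need it.\<close>

lemma hoare_enum:
  assumes ok: "rel_ok k f" and "j \<le> k" "\<forall>j'. j \<le> j' \<and> j' < k \<longrightarrow> \<tau> j' \<in> {1..N}"
  shows "hoare (\<lambda>m. env m \<and> out fs m \<and> (\<forall>j'. j \<le> j' \<and> j' < k \<longrightarrow> m (13 + j') = \<tau> j'))
    (enum j (qf_code \<Delta> E f @ emit i k E)) (enum_time N (length (qf_code \<Delta> E f @ emit i k E)) j)
    (\<lambda>m. \<exists>gs. env m \<and> out (fs @ gs) m \<and> (\<forall>j'. j \<le> j' \<and> j' < k \<longrightarrow> m (13 + j') = \<tau> j') \<and>
      length gs \<le> N ^ j \<and> set gs = sols i k f j \<tau>)"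
  using assms(2,3)
proof (induction j arbitrary: fs \<tau>)
  case 0
  show ?case unfolding enum.simps enum_time.simps
  proof (rule hoare_block, goal_cases)
    case (2 m)
    let ?t = "map (\<lambda>j. m (13 + j)) [0..<k]"
    have t: "?t = map \<tau> [0..<k]" using 2 by auto
    have iff: "length s = k \<and> (\<forall>j'. 0 \<le> j' \<and> j' < k \<longrightarrow> s ! j' = \<tau> j') \<longleftrightarrow> s = ?t" for s
    proof
      assume "length s = k \<and> (\<forall>j'. 0 \<le> j' \<and> j' < k \<longrightarrow> s ! j' = \<tau> j')"
      then show "s = ?t" unfolding t by (intro nth_equalityI) simp_all
    next
      assume "s = ?t"
      then show "length s = k \<and> (\<forall>j'. 0 \<le> j' \<and> j' < k \<longrightarrow> s ! j' = \<tau> j')" unfolding t by simp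
    qed
    have "set ?t \<subseteq> {1..N}" unfolding t using 0(2) by auto
    then have "(i', s) \<in> sols i k f 0 \<tau> \<longleftrightarrow> i' = i \<and> s = ?t \<and> sat f ?t" for i' s
      unfolding sols_def using iff[of s] by auto
    then have "sols i k f 0 \<tau> = (if sat f ?t then {(i, ?t)} else {})" by auto
    moreover have m: "env m" "out fs m" "\<forall>j<k. m (13 + j) \<in> {1..N}" using 2 0(2) by auto
    note b = fold_body[OF ok m, where i = i]
    ultimately show ?case using b 2
      by (intro exI[of _ "if sat f ?t then [(i, ?t)] else []"]) auto
  qed auto
next
  case (Suc j)
  let ?b = "qf_code \<Delta> E f @ emit i k E"
  let ?T = "enum_time N (length ?b) j"
  have jk: "j < k" using Suc.prems(1) by simp
  have jE: "13 + j < E" using Suc.prems(1) ok by (simp add: rel_ok_def)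
  \<comment> \<open>After \<open>c\<close> rounds the counter has run through \<open>N\<close> down
    to \<open>N - c + 1\<close>, so exactly the tuples with a larger \<open>j\<close>-th component
    than \<open>N - c\<close> are done.\<close>
  define I where "I c m \<longleftrightarrow> (\<exists>gs. env m \<and> out (fs @ gs) m \<and>
      (\<forall>j'. Suc j \<le> j' \<and> j' < k \<longrightarrow> m (13 + j') = \<tau> j') \<and> length gs \<le> c * N ^ j \<and>
      set gs = {p \<in> sols i k f (Suc j) \<tau>. N - c < snd p ! j})" for c m
  have nth_le: "t ! j \<le> N" if "(i', t) \<in> sols i k f (Suc j) \<tau>" for i' t
  proof -
    have "length t = k" "set t \<subseteq> {1..N}" using that by (auto simp: sols_def)
    then have "t ! j \<in> {1..N}" using Suc.prems(1) by (meson Suc_le_lessD nth_mem subsetD)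
    then show ?thesis by simp
  qed
  have init: "hoare (\<lambda>m. env m \<and> out fs m \<and> (\<forall>j'. Suc j \<le> j' \<and> j' < k \<longrightarrow> m (13 + j') = \<tau> j'))
      (Block [Const 6 0, Add (13 + j) 12 6]) 2 (\<lambda>m. I 0 m \<and> m (13 + j) = N)"
  proof (rule hoare_block, goal_cases)
    case (2 m)
    let ?m = "m(6 := 0, 13 + j := N)"
    have e: "fold upd [Const 6 0, Add (13 + j) 12 6] m = ?m" using 2 by (simp add: env_def)
    have "\<not> N < snd p ! j" if "p \<in> sols i k f (Suc j) \<tau>" for p
      using nth_le[of "fst p" "snd p"] that by simp
    then have "{p \<in> sols i k f (Suc j) \<tau>. N - 0 < snd p ! j} = {}" by auto
    moreover have "env ?m" by (intro env_upd) (use 2 E jE in auto)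
    moreover have "out fs ?m" by (intro out_upd) (use 2 E jE in auto)
    moreover have "\<forall>j'. Suc j \<le> j' \<and> j' < k \<longrightarrow> ?m (13 + j') = \<tau> j'" using 2 by auto
    ultimately show ?case unfolding e I_def using E by (intro conjI exI[of _ "[]"]) simp_all
  qed simp_all
  have loop: "hoare (\<lambda>m. I 0 m \<and> m (13 + j) = N) (Rep (13 + j) (enum j ?b)) (N * (?T + 5) + 1)
      (\<lambda>m. I N m \<and> m (13 + j) = 0)"
  proof (rule hoare_rep[where I = I and n = N and r = "13 + j"])
    fix c assume c: "c < N"
    let ?\<tau> = "\<tau>(j := N - c)"
    have split: "{p \<in> sols i k f (Suc j) \<tau>. N - Suc c < snd p ! j}
        = {p \<in> sols i k f (Suc j) \<tau>. N - c < snd p ! j} \<union> sols i k f j ?\<tau>"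
    proof -
      have "p \<in> sols i k f j ?\<tau> \<longleftrightarrow> p \<in> sols i k f (Suc j) \<tau> \<and> snd p ! j = N - c" for p
        unfolding sols_def all_from_upd[OF jk, of "\<lambda>j' y. t ! j' = y" for t] mem_Collect_eq
        by (metis snd_conv)
      moreover have "N - Suc c < x \<longleftrightarrow> N - c < x \<or> x = N - c" for x using c by linarith
      ultimately show ?thesis unfolding set_eq_iff Un_iff mem_Collect_eq by metis
    qed
    have pre: "(\<forall>j'. j \<le> j' \<and> j' < k \<longrightarrow> m (13 + j') = ?\<tau> j') \<longleftrightarrow>
        (\<forall>j'. Suc j \<le> j' \<and> j' < k \<longrightarrow> m (13 + j') = \<tau> j') \<and> m (13 + j) = N - c" for m :: mem
      unfolding all_from_upd[OF jk, of "\<lambda>j' y. m (13 + j') = y"] by auto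
    have "hoare (\<lambda>m. \<exists>gs. env m \<and> out (fs @ gs) m \<and> (\<forall>j'. j \<le> j' \<and> j' < k \<longrightarrow> m (13 + j') = ?\<tau> j') \<and>
        length gs \<le> c * N ^ j \<and> set gs = {p \<in> sols i k f (Suc j) \<tau>. N - c < snd p ! j})
      (enum j ?b) ?T (\<lambda>m. m (13 + j) = N - c \<and> I (Suc c) (m(13 + j := N - Suc c, 1 := 0)))"
    proof (rule hoare_exists)
      fix gs
      have IH: "hoare (\<lambda>m. env m \<and> out (fs @ gs) m \<and> (\<forall>j'. j \<le> j' \<and> j' < k \<longrightarrow> m (13 + j') = ?\<tau> j'))
        (enum j ?b) ?T
        (\<lambda>m. \<exists>hs. env m \<and> out ((fs @ gs) @ hs) m \<and> (\<forall>j'. j \<le> j' \<and> j' < k \<longrightarrow> m (13 + j') = ?\<tau> j') \<and>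
          length hs \<le> N ^ j \<and> set hs = sols i k f j ?\<tau>)"
      proof (rule Suc.IH)
        show "j \<le> k" using jk by simp
        show "\<forall>j'. j \<le> j' \<and> j' < k \<longrightarrow> ?\<tau> j' \<in> {1..N}"
          unfolding all_from_upd[OF jk, of "\<lambda>j' y. y \<in> {1..N}"] using Suc.prems(2) c by auto
      qed
      show "hoare (\<lambda>m. env m \<and> out (fs @ gs) m \<and> (\<forall>j'. j \<le> j' \<and> j' < k \<longrightarrow> m (13 + j') = ?\<tau> j') \<and>
        length gs \<le> c * N ^ j \<and> set gs = {p \<in> sols i k f (Suc j) \<tau>. N - c < snd p ! j})
      (enum j ?b) ?T (\<lambda>m. m (13 + j) = N - c \<and> I (Suc c) (m(13 + j := N - Suc c, 1 := 0)))"
      proof (cases "length gs \<le> c * N ^ j \<and> set gs = {p \<in> sols i k f (Suc j) \<tau>. N - c < snd p ! j}")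
        case True
        show ?thesis
        proof (rule hoare_conseq[OF IH], goal_cases)
          case (2 m)
          then obtain hs where hs: "env m" "out (fs @ (gs @ hs)) m"
            "(\<forall>j'. Suc j \<le> j' \<and> j' < k \<longrightarrow> m (13 + j') = \<tau> j')" "m (13 + j) = N - c"
            "length hs \<le> N ^ j" "set hs = sols i k f j ?\<tau>" unfolding pre by auto
          have "env (m(13 + j := N - Suc c, 1 := 0))"
            using hs(1) jE E by (intro env_upd) auto
          moreover have "out (fs @ (gs @ hs)) (m(13 + j := N - Suc c, 1 := 0))"
            using hs(2) jE E by (intro out_upd) auto
          moreover have "length (gs @ hs) \<le> Suc c * N ^ j" using True hs(5) by simp
          moreover have "set (gs @ hs) = {p \<in> sols i k f (Suc j) \<tau>. N - Suc c < snd p ! j}"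
            using True hs(6) split by simp
          ultimately have "I (Suc c) (m(13 + j := N - Suc c, 1 := 0))"
            unfolding I_def using hs(3) by (intro exI[of _ "gs @ hs"]) auto
          then show ?case using hs(4) by blast
        qed auto
      next
        case False
        then show ?thesis unfolding hoare_def by blast
      qed
    qed
    then show "hoare (\<lambda>m. I c m \<and> m (13 + j) = N - c) (enum j ?b) ?T
        (\<lambda>m. m (13 + j) = N - c \<and> I (Suc c) (m(13 + j := N - Suc c, 1 := 0)))"
    proof (rule hoare_conseq)
      fix m assume "I c m \<and> m (13 + j) = N - c"
      then show "\<exists>gs. env m \<and> out (fs @ gs) m \<and> (\<forall>j'. j \<le> j' \<and> j' < k \<longrightarrow> m (13 + j') = ?\<tau> j') \<and>
        length gs \<le> c * N ^ j \<and> set gs = {p \<in> sols i k f (Suc j) \<tau>. N - c < snd p ! j}"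
        unfolding I_def pre by blast
    qed simp_all
  qed simp
  have all: "{p \<in> sols i k f (Suc j) \<tau>. N - N < snd p ! j} = sols i k f (Suc j) \<tau>"
  proof -
    have "0 < t ! j" if "(i', t) \<in> sols i k f (Suc j) \<tau>" for i' t
    proof -
      have "length t = k" "set t \<subseteq> {1..N}" using that by (auto simp: sols_def)
      then have "t ! j \<in> {1..N}" using jk by (meson nth_mem subsetD)
      then show ?thesis by simp
    qed
    then show ?thesis by auto
  qed
  show ?case unfolding enum.simps enum_time.simps
  proof (rule hoare_conseq[OF hoare_seq[OF init loop]])
    fix m assume "I N m \<and> m (13 + j) = 0"
    then obtain gs where "env m" "out (fs @ gs) m" "\<forall>j'. Suc j \<le> j' \<and> j' < k \<longrightarrow> m (13 + j') = \<tau> j'"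
      "length gs \<le> N * N ^ j" "set gs = sols i k f (Suc j) \<tau>"
      unfolding I_def all by blast
    then show "\<exists>gs. env m \<and> out (fs @ gs) m \<and> (\<forall>j'. Suc j \<le> j' \<and> j' < k \<longrightarrow> m (13 + j') = \<tau> j') \<and>
      length gs \<le> N ^ Suc j \<and> set gs = sols i k f (Suc j) \<tau>"
      by (intro exI[of _ gs]) simp
  qed simp_all
qed

end

section \<open>All relation symbols in turn\<close>

fun rels :: "int \<Rightarrow> nat \<Rightarrow> nat \<Rightarrow> signature \<Rightarrow> com" where
  "rels \<Delta> E i [] = Block []"
| "rels \<Delta> E i ((k, f) # s) = enum k (qf_code \<Delta> E f @ emit i k E) ;; rels \<Delta> E (Suc i) s"

fun rels_time :: "int \<Rightarrow> nat \<Rightarrow> nat \<Rightarrow> signature \<Rightarrow> nat" where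
  "rels_time \<Delta> E N [] = 0"
| "rels_time \<Delta> E N ((k, f) # s) =
     enum_time N (length (qf_code \<Delta> E f) + length (emit 0 k E)) k + rels_time \<Delta> E N s"

fun rels_size :: "nat \<Rightarrow> signature \<Rightarrow> nat" where
  "rels_size N [] = 0"
| "rels_size N ((k, f) # s) = (k + 1) * N ^ k + rels_size N s"

lemma length_emit: "length (emit i k r) = length (emit 0 k r)"
  by (simp add: emit_def)

lemma length_words: "\<forall>(i, t)\<in>set gs. length t = k \<Longrightarrow> length (words gs) = (k + 1) * length gs"
  by (induction gs) auto

context value_table
begin

text \<open>With \<open>k\<close> in the place of \<open>j\<close> no component is prescribed, so
  \<open>\<lambda>_. 0\<close> is a dummy.\<close>

fun facts_of :: "nat \<Rightarrow> signature \<Rightarrow> (nat \<times> nat list) set" where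
  "facts_of i [] = {}"
| "facts_of i ((k, f) # s) = sols i k f k (\<lambda>_. 0) \<union> facts_of (Suc i) s"

lemma hoare_rels:
  assumes "\<forall>(k, f)\<in>set s. rel_ok k f"
  shows "hoare (\<lambda>m. env m \<and> out fs m) (rels \<Delta> E i s) (rels_time \<Delta> E N s)
    (\<lambda>m. \<exists>gs. env m \<and> out (fs @ gs) m \<and> length (words gs) \<le> rels_size N s \<and> set gs = facts_of i s)"
  using assms
proof (induction s arbitrary: i fs)
  case Nil
  show ?case unfolding rels.simps rels_time.simps
  proof (rule hoare_block)
    fix m assume "env m \<and> out fs m"
    then show "\<exists>gs. env (fold upd [] m) \<and> out (fs @ gs) (fold upd [] m) \<and>
        length (words gs) \<le> rels_size N [] \<and> set gs = facts_of i []"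
      by (intro exI[of _ "[]"]) simp
  qed simp_all
next
  case (Cons kf s)
  obtain k f where kf: "kf = (k, f)" by (rule prod.exhaust)
  have ok: "rel_ok k f" and oks: "\<forall>(k, f)\<in>set s. rel_ok k f" using Cons.prems kf by auto
  let ?b = "qf_code \<Delta> E f @ emit i k E"
  have T: "rels_time \<Delta> E N (kf # s) = enum_time N (length ?b) k + rels_time \<Delta> E N s"
    unfolding kf rels_time.simps length_append length_emit[of i] by simp
  have c1: "hoare (\<lambda>m. env m \<and> out fs m) (enum k ?b) (enum_time N (length ?b) k)
    (\<lambda>m. \<exists>gs. env m \<and> out (fs @ gs) m \<and> length gs \<le> N ^ k \<and> set gs = sols i k f k (\<lambda>_. 0))"
    by (rule hoare_conseq[OF hoare_enum[OF ok, where j = k and \<tau> = "\<lambda>_. 0" and fs = fs and i = i]]) auto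
  have c2: "hoare (\<lambda>m. \<exists>gs. env m \<and> out (fs @ gs) m \<and> length gs \<le> N ^ k \<and> set gs = sols i k f k (\<lambda>_. 0))
    (rels \<Delta> E (Suc i) s) (rels_time \<Delta> E N s)
    (\<lambda>m. \<exists>gs. env m \<and> out (fs @ gs) m \<and> length (words gs) \<le> rels_size N (kf # s) \<and>
       set gs = facts_of i (kf # s))"
  proof (rule hoare_exists)
    fix gs
    show "hoare (\<lambda>m. env m \<and> out (fs @ gs) m \<and> length gs \<le> N ^ k \<and> set gs = sols i k f k (\<lambda>_. 0))
      (rels \<Delta> E (Suc i) s) (rels_time \<Delta> E N s)
      (\<lambda>m. \<exists>gs. env m \<and> out (fs @ gs) m \<and> length (words gs) \<le> rels_size N (kf # s) \<and>
         set gs = facts_of i (kf # s))"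
    proof (cases "length gs \<le> N ^ k \<and> set gs = sols i k f k (\<lambda>_. 0)")
      case True
      then have "length (words gs) = (k + 1) * length gs"
        by (intro length_words) (auto simp: sols_def)
      then have lw: "length (words gs) \<le> (k + 1) * N ^ k" using True by (metis mult_le_mono2)
      show ?thesis
      proof (rule hoare_conseq[OF Cons.IH[OF oks, of "fs @ gs" "Suc i"]])
        fix m assume "\<exists>hs. env m \<and> out ((fs @ gs) @ hs) m \<and> length (words hs) \<le> rels_size N s \<and>
          set hs = facts_of (Suc i) s"
        then obtain hs where "env m" "out (fs @ (gs @ hs)) m" "length (words hs) \<le> rels_size N s"
          "set hs = facts_of (Suc i) s" by auto
        then show "\<exists>gs. env m \<and> out (fs @ gs) m \<and> length (words gs) \<le> rels_size N (kf # s) \<and>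
         set gs = facts_of i (kf # s)"
          using True lw unfolding kf by (intro exI[of _ "gs @ hs"]) auto
      qed auto
    next
      case False
      then show ?thesis unfolding hoare_def by blast
    qed
  qed
  show ?case unfolding T using hoare_seq[OF c1 c2] unfolding kf by simp
qed

end

section \<open>Computing the samples\<close>

text \<open>The input \<open>d\<close> moves to register 2 because register 0 is to hold
  \<open>H\<close>. Repeated multiplication by the constant \<open>B\<close> reaches this
  exponential number in linearly many unit-cost steps.\<close>

definition init_code :: "nat \<Rightarrow> com" where
  "init_code B = Block [Const 1 0, Add 2 0 1, Const 0 1, Add 8 2 1] ;;
     Rep 8 (Block ([Const 6 0] @ addmul 6 0 B @ [Const 7 0, Add 0 6 7]))"

lemma hoare_init:
  "hoare (\<lambda>m. m = snd (init_config d)) (init_code B) (4 + (d * (B + 3 + 5) + 1))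
     (\<lambda>m. m 0 = B ^ d \<and> m 2 = d \<and> (\<forall>a\<ge>9. m a = 0))"
proof -
  define I where "I c m \<longleftrightarrow> m 0 = B ^ c \<and> m 2 = d \<and> (\<forall>a\<ge>9. m a = 0)" for c and m :: mem
  have 1: "hoare (\<lambda>m. m = snd (init_config d)) (Block [Const 1 0, Add 2 0 1, Const 0 1, Add 8 2 1]) 4
    (\<lambda>m. I 0 m \<and> m 8 = d)"
    by (rule hoare_block) (simp_all add: I_def init_config_def)
  have 2: "hoare (\<lambda>m. I 0 m \<and> m 8 = d) (Rep 8 (Block ([Const 6 0] @ addmul 6 0 B @ [Const 7 0, Add 0 6 7])))
     (d * (B + 3 + 5) + 1) (\<lambda>m. I d m \<and> m 8 = 0)"
    by (rule hoare_rep[where I = I]; (rule hoare_block)?) (simp_all add: I_def)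
  show ?thesis unfolding init_code_def
    by (rule hoare_conseq[OF hoare_seq[OF 1 2]]) (simp_all add: I_def)
qed

text \<open>Only every other cell is written. The remaining ones keep their initial 0, which is why
  \<open>hoare_init\<close> also records zeros from address 9 on.\<close>

definition base_code :: "nat \<Rightarrow> com" where
  "base_code K = Block [Const 8 1, Add 8 8 2, Add 8 8 2, Const 5 (K + 2), Const 6 0, Add 10 0 2,
       Add 6 0 6, Const 7 1] ;;
     Rep 8 (Block [Store 5 6, Add 5 5 7, Add 5 5 7, Add 6 6 7]) ;;
     Block [Const 6 K, Sub 3 5 6]"

text \<open>The zeros in between make the differences of consecutive entries run through 0 and
  all \<open>\<plusminus> (H + i)\<close>.\<close>
definition base_entry :: "nat \<Rightarrow> nat \<Rightarrow> nat" where
  "base_entry H i = (if even i \<and> 2 \<le> i then H + (i div 2 - 1) else 0)"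

definition tabulates :: "nat \<Rightarrow> nat \<Rightarrow> mem \<Rightarrow> mem \<Rightarrow> bool" where
  "tabulates K A w m \<longleftrightarrow> m 3 = A \<and> (\<forall>i<A. m (K + i) = w i)"

lemma hoare_base:
  assumes "K \<ge> 13"
  shows "hoare (\<lambda>m. m 0 = H \<and> m 2 = d \<and> (\<forall>a\<ge>9. m a = 0)) (base_code K)
    (8 + ((2 * d + 1) * (4 + 5) + 1) + 2)
    (\<lambda>m. m 0 = H \<and> m 2 = d \<and> m 10 = H + d \<and> tabulates K (4 * d + 4) (base_entry H) m)"
proof -
  define I where "I c m \<longleftrightarrow> m 0 = H \<and> m 2 = d \<and> m 10 = H + d \<and> m 5 = K + 2 + 2 * c \<and> m 6 = H + c \<and> m 7 = 1 \<and>
    (\<forall>i. m (K + i) = (if i < 2 + 2 * c then base_entry H i else 0))" for c and m :: mem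
  have b0: "base_entry H 0 = 0" "base_entry H (Suc 0) = 0" by (simp_all add: base_entry_def)
  have b1: "base_entry H (2 + 2 * c) = H + c" "base_entry H (3 + 2 * c) = 0" for c
    by (simp_all add: base_entry_def)
  have 1: "hoare (\<lambda>m. m 0 = H \<and> m 2 = d \<and> (\<forall>a\<ge>9. m a = 0))
    (Block [Const 8 1, Add 8 8 2, Add 8 8 2, Const 5 (K + 2), Const 6 0, Add 10 0 2, Add 6 0 6, Const 7 1])
    8 (\<lambda>m. I 0 m \<and> m 8 = 2 * d + 1)"
  proof (rule hoare_block)
    fix m :: mem assume m: "m 0 = H \<and> m 2 = d \<and> (\<forall>a\<ge>9. m a = 0)"
    have "(if i < 2 then base_entry H i else 0) = 0" for i using b0 by (cases i) auto
    then show "I 0 (fold upd [Const 8 1, Add 8 8 2, Add 8 8 2, Const 5 (K + 2), Const 6 0, Add 10 0 2,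
      Add 6 0 6, Const 7 1] m) \<and> fold upd [Const 8 1, Add 8 8 2, Add 8 8 2, Const 5 (K + 2), Const 6 0,
      Add 10 0 2, Add 6 0 6, Const 7 1] m 8 = 2 * d + 1"
      using m assms by (simp add: I_def)
  qed simp_all
  have 2: "hoare (\<lambda>m. I 0 m \<and> m 8 = 2 * d + 1) (Rep 8 (Block [Store 5 6, Add 5 5 7, Add 5 5 7, Add 6 6 7]))
    ((2 * d + 1) * (4 + 5) + 1) (\<lambda>m. I (2 * d + 1) m \<and> m 8 = 0)"
  proof (rule hoare_rep[where I = I], rule hoare_block)
    fix c m assume c: "c < 2 * d + 1" and m: "I c m \<and> m 8 = 2 * d + 1 - c"
    let ?m = "m(K + 2 + 2 * c := H + c, 5 := K + 2 + 2 * Suc c, 6 := H + Suc c)"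
    have e: "fold upd [Store 5 6, Add 5 5 7, Add 5 5 7, Add 6 6 7] m = ?m"
      using m assms by (simp add: I_def)
    have "(?m(8 := 2 * d + 1 - Suc c, 1 := 0)) (K + i) = (if i < 2 + 2 * Suc c then base_entry H i else 0)" for i
    proof (cases "i = 2 + 2 * c \<or> i = 3 + 2 * c")
      case True
      then show ?thesis using b1[of c] m assms unfolding I_def by auto
    next
      case False
      then have "i < 2 + 2 * Suc c \<longleftrightarrow> i < 2 + 2 * c" by auto
      then show ?thesis using False m assms unfolding I_def by simp
    qed
    then have "I (Suc c) (?m(8 := 2 * d + 1 - Suc c, 1 := 0))"
      unfolding I_def using m assms by (simp add: I_def)
    then show "fold upd [Store 5 6, Add 5 5 7, Add 5 5 7, Add 6 6 7] m 8 = 2 * d + 1 - c \<and>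
        I (Suc c) ((fold upd [Store 5 6, Add 5 5 7, Add 5 5 7, Add 6 6 7] m)(8 := 2 * d + 1 - Suc c, 1 := 0))"
      unfolding e using m assms by simp
  qed simp_all
  have 3: "hoare (\<lambda>m. I (2 * d + 1) m \<and> m 8 = 0) (Block [Const 6 K, Sub 3 5 6]) 2
    (\<lambda>m. m 0 = H \<and> m 2 = d \<and> m 10 = H + d \<and> tabulates K (4 * d + 4) (base_entry H) m)"
    by (rule hoare_block) (use assms in \<open>simp_all add: I_def tabulates_def\<close>)
  show ?thesis unfolding base_code_def
    by (rule hoare_conseq[OF hoare_seq[OF 1 hoare_seq[OF 2 3]]]) simp_all
qed

text \<open>A single loop appends the multiples of the table by all powers of \<open>q\<close> up to the
  \<open>2 * d\<close>-th, since entry \<open>A + i\<close> is \<open>q\<close> times entry \<open>i\<close>.\<close>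
definition stage_code :: "nat \<Rightarrow> nat \<Rightarrow> com" where
  "stage_code K q = Block [Add 8 2 2, Const 9 0] ;; Rep 8 (Block [Add 9 9 3]) ;;
     Block [Const 5 K, Add 4 5 3] ;;
     Rep 9 (Block ([Load 7 5, Const 6 0] @ addmul 6 7 q @ [Store 4 6, Const 7 1, Add 4 4 7, Add 5 5 7])) ;;
     Block [Const 6 K, Sub 3 4 6, Const 6 0, Add 8 2 6] ;;
     Rep 8 (Block ([Const 6 0] @ addmul 6 10 q @ [Const 7 0, Add 10 6 7]))"

definition stage_time :: "nat \<Rightarrow> nat \<Rightarrow> nat \<Rightarrow> nat" where
  "stage_time d A q = 2 + (2 * d * (1 + 5) + 1) + 2 + (2 * d * A * (q + 6 + 5) + 1) + 4 + (d * (q + 3 + 5) + 1)"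

definition stage_entry :: "nat \<Rightarrow> nat \<Rightarrow> mem \<Rightarrow> mem" where
  "stage_entry q A w i = q ^ (i div A) * w (i mod A)"

lemma stage_entry_low: "i < A \<Longrightarrow> stage_entry q A w i = w i"
  by (simp add: stage_entry_def)

lemma stage_entry_shift: "A > 0 \<Longrightarrow> stage_entry q A w (A + i) = q * stage_entry q A w i"
  by (simp add: stage_entry_def)

lemma hoare_stage:
  assumes "K \<ge> 13" "A > 0"
  shows "hoare (\<lambda>m. m 0 = H \<and> m 2 = d \<and> m 10 = u \<and> tabulates K A w m) (stage_code K q) (stage_time d A q)
    (\<lambda>m. m 0 = H \<and> m 2 = d \<and> m 10 = q ^ d * u \<and> tabulates K ((2 * d + 1) * A) (stage_entry q A w) m)"
proof -
  let ?w = "stage_entry q A w"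
  define I1 where "I1 c m \<longleftrightarrow> m 0 = H \<and> m 2 = d \<and> m 10 = u \<and> tabulates K A w m \<and> m 9 = c * A" for c and m :: mem
  define I2 where "I2 c m \<longleftrightarrow> m 0 = H \<and> m 2 = d \<and> m 10 = u \<and> m 5 = K + c \<and> m 4 = K + A + c \<and>
    (\<forall>i<A + c. m (K + i) = ?w i)" for c and m :: mem
  define I3 where "I3 c m \<longleftrightarrow> m 0 = H \<and> m 2 = d \<and> m 10 = q ^ c * u \<and>
    tabulates K ((2 * d + 1) * A) ?w m" for c and m :: mem
  let ?P = "\<lambda>m. m 0 = H \<and> m 2 = d \<and> m 10 = u \<and> tabulates K A w m"
  have 1: "hoare ?P (Block [Add 8 2 2, Const 9 0]) 2 (\<lambda>m. I1 0 m \<and> m 8 = 2 * d)"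
    by (rule hoare_block) (use assms in \<open>simp_all add: I1_def tabulates_def\<close>)
  have 2: "hoare (\<lambda>m. I1 0 m \<and> m 8 = 2 * d) (Rep 8 (Block [Add 9 9 3])) (2 * d * (1 + 5) + 1)
    (\<lambda>m. I1 (2 * d) m \<and> m 8 = 0)"
    by (rule hoare_rep[where I = I1]; (rule hoare_block)?)
      (use assms in \<open>simp_all add: I1_def tabulates_def\<close>)
  have 3: "hoare (\<lambda>m. I1 (2 * d) m \<and> m 8 = 0) (Block [Const 5 K, Add 4 5 3]) 2
    (\<lambda>m. I2 0 m \<and> m 9 = 2 * d * A)"
    by (rule hoare_block) (use assms in \<open>simp_all add: I1_def I2_def tabulates_def stage_entry_low\<close>)
  have 4: "hoare (\<lambda>m. I2 0 m \<and> m 9 = 2 * d * A)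
    (Rep 9 (Block ([Load 7 5, Const 6 0] @ addmul 6 7 q @ [Store 4 6, Const 7 1, Add 4 4 7, Add 5 5 7])))
    (2 * d * A * (q + 6 + 5) + 1) (\<lambda>m. I2 (2 * d * A) m \<and> m 9 = 0)"
  proof (rule hoare_rep[where I = I2], rule hoare_block)
    fix c m assume c: "c < 2 * d * A" and m: "I2 c m \<and> m 9 = 2 * d * A - c"
    let ?is = "[Load 7 5, Const 6 0] @ addmul 6 7 q @ [Store 4 6, Const 7 1, Add 4 4 7, Add 5 5 7]"
    let ?m = "m(K + A + c := ?w (A + c), 4 := K + A + Suc c, 5 := K + Suc c, 6 := ?w (A + c), 7 := 1)"
    \<comment> \<open>The read pointer trails the write pointer by \<open>A\<close>, so the cell
      read is already final; from \<open>c = A\<close> on it was written by this same loop.\<close>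
    have "m (K + c) = ?w c" using m assms(2) by (simp add: I2_def)
    then have e: "fold upd ?is m = ?m"
      using m assms by (auto simp: I2_def stage_entry_shift fun_eq_iff)
    have "(?m(9 := 2 * d * A - Suc c, 1 := 0)) (K + i) = ?w i" if "i < A + Suc c" for i
    proof (cases "i = A + c")
      case True
      then show ?thesis using assms by simp
    next
      case False
      then have "i < A + c" using that by simp
      then show ?thesis using False m assms unfolding I2_def by simp
    qed
    then have "I2 (Suc c) (?m(9 := 2 * d * A - Suc c, 1 := 0))"
      unfolding I2_def using m assms by (simp add: I2_def)
    then show "fold upd ?is m 9 = 2 * d * A - c \<and> I2 (Suc c) ((fold upd ?is m)(9 := 2 * d * A - Suc c, 1 := 0))"
      unfolding e using m assms by simp
  qed simp_all
  have 5: "hoare (\<lambda>m. I2 (2 * d * A) m \<and> m 9 = 0) (Block [Const 6 K, Sub 3 4 6, Const 6 0, Add 8 2 6]) 4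
    (\<lambda>m. I3 0 m \<and> m 8 = d)"
    by (rule hoare_block) (use assms in \<open>simp_all add: I2_def I3_def tabulates_def algebra_simps\<close>)
  \<comment> \<open>The matching denominator: the table contains the powers of \<open>q\<close> up
    to \<open>2 * d\<close>, and dividing by \<open>q ^ d\<close> centres the exponents at
    0.\<close>
  have 6: "hoare (\<lambda>m. I3 0 m \<and> m 8 = d) (Rep 8 (Block ([Const 6 0] @ addmul 6 10 q @ [Const 7 0, Add 10 6 7])))
    (d * (q + 3 + 5) + 1) (\<lambda>m. I3 d m \<and> m 8 = 0)"
    by (rule hoare_rep[where I = I3]; (rule hoare_block)?)
      (use assms in \<open>simp_all add: I3_def tabulates_def\<close>)
  show ?thesis unfolding stage_code_def stage_time_def
    by (rule hoare_conseq[OF hoare_seq[OF 1 hoare_seq[OF 2 hoare_seq[OF 3 hoare_seq[OF 4 hoare_seq[OF 5 6]]]]]])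
      (simp_all add: I3_def)
qed

fun stages :: "nat \<Rightarrow> nat list \<Rightarrow> com" where
  "stages K [] = Block []"
| "stages K (q # qs) = stage_code K q ;; stages K qs"

fun stages_time :: "nat \<Rightarrow> nat \<Rightarrow> nat list \<Rightarrow> nat" where
  "stages_time d A [] = 0"
| "stages_time d A (q # qs) = stage_time d A q + stages_time d ((2 * d + 1) * A) qs"

fun table :: "nat \<Rightarrow> nat \<Rightarrow> nat list \<Rightarrow> mem \<Rightarrow> mem" where
  "table d A [] w = w"
| "table d A (q # qs) w = table d ((2 * d + 1) * A) qs (stage_entry q A w)"

lemma hoare_stages:
  assumes "K \<ge> 13" "A > 0"
  shows "hoare (\<lambda>m. m 0 = H \<and> m 2 = d \<and> m 10 = u \<and> tabulates K A w m) (stages K qs) (stages_time d A qs)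
    (\<lambda>m. m 0 = H \<and> m 10 = prod_list qs ^ d * u \<and>
       tabulates K ((2 * d + 1) ^ length qs * A) (table d A qs w) m)"
  using assms(2)
proof (induction qs arbitrary: A w u)
  case Nil
  show ?case unfolding stages.simps by (rule hoare_block) simp_all
next
  case (Cons q qs)
  have "(2 * d + 1) * A > 0" using Cons.prems by simp
  note seq = hoare_seq[OF hoare_stage[OF assms(1) Cons.prems, where w = w and u = u and q = q] Cons.IH[OF this]]
  have "prod_list qs ^ d * (q ^ d * u) = prod_list (q # qs) ^ d * u"
    by (simp add: power_mult_distrib)
  moreover have "(2 * d + 1) ^ length qs * ((2 * d + 1) * A) = (2 * d + 1) ^ length (q # qs) * A"
    by (simp only: list.size(4) power_Suc power_add One_nat_def power_0 mult_ac add_0_right add_Suc_right)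
  ultimately show ?case using seq unfolding stages.simps stages_time.simps table.simps by metis
qed

text \<open>Samples are differences of neighbours, so neighbours are followed together. A stage
  consists of scaled copies of the whole previous table; the copy with index \<open>e q\<close>
  contains the pair multiplied by \<open>q ^ e q\<close>, still adjacent.\<close>

lemma table_pair:
  assumes "Suc j < A" "\<forall>q\<in>set qs. e q \<le> 2 * d"
  shows "\<exists>j'. Suc j' < (2 * d + 1) ^ length qs * A \<and>
    table d A qs w j' = prod_list (map (\<lambda>q. q ^ e q) qs) * w j \<and>
    table d A qs w (Suc j') = prod_list (map (\<lambda>q. q ^ e q) qs) * w (Suc j)"
  using assms
proof (induction qs arbitrary: A w j)
  case Nil
  then show ?case by auto
next
  case (Cons q qs)
  let ?j = "e q * A + j"
  have "e q * A \<le> 2 * d * A" using Cons.prems(2) by simp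
  then have "Suc ?j < (2 * d + 1) * A" using Cons.prems(1) unfolding add_mult_distrib by linarith
  from Cons.IH[OF this, of "stage_entry q A w"] Cons.prems(2) obtain j' where j':
    "Suc j' < (2 * d + 1) ^ length qs * ((2 * d + 1) * A)"
    "table d A (q # qs) w j' = prod_list (map (\<lambda>q. q ^ e q) qs) * stage_entry q A w ?j"
    "table d A (q # qs) w (Suc j') = prod_list (map (\<lambda>q. q ^ e q) qs) * stage_entry q A w (Suc ?j)"
    by auto
  have "stage_entry q A w ?j = q ^ e q * w j"
    using Cons.prems(1) by (simp add: stage_entry_def)
  moreover have "stage_entry q A w (Suc ?j) = q ^ e q * w (Suc j)"
    using Cons.prems(1) by (simp add: stage_entry_def flip: add_Suc_right)
  moreover have "(2 * d + 1) ^ length qs * ((2 * d + 1) * A) = (2 * d + 1) ^ length (q # qs) * A"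
    by (simp only: list.size(4) power_Suc power_add One_nat_def power_0 mult_ac add_0_right add_Suc_right)
  ultimately show ?case using j' by (intro exI[of _ j'] conjI) (metis, (simp add: mult_ac)+)
qed

section \<open>The whole program\<close>

text \<open>The output must start at address 1, where the registers live. So it is collected from address
  \<open>H\<close> on (with its length in front) and moved down at the end; the addresses below
  \<open>K\<close> are filled last, each cell serving as its own pointer.\<close>
definition low_code :: "nat \<Rightarrow> instr list" where
  "low_code n = concat (map (\<lambda>j. [Const j j, Add j j 0, Load j j]) [1..<n])"

lemma basic_low_code [simp]: "list_all basic (low_code n)"
  by (auto simp: low_code_def list_all_iff)

lemma fold_low_code:
  assumes "n \<le> H" "m 0 = H"
  shows "fold upd (low_code n) m = (\<lambda>a. if 1 \<le> a \<and> a < n then m (H + a) else m a)"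
  using assms
proof (induction n)
  case 0
  then show ?case by (auto simp: low_code_def)
next
  case (Suc n)
  show ?case
  proof (cases "n = 0")
    case True
    then show ?thesis by (auto simp: low_code_def)
  next
    case False
    let ?s = "\<lambda>a. if 1 \<le> a \<and> a < n then m (H + a) else m a"
    have IH: "fold upd (low_code n) m = ?s" using Suc by simp
    have "low_code (Suc n) = low_code n @ [Const n n, Add n n 0, Load n n]"
      using False by (simp add: low_code_def)
    then have "fold upd (low_code (Suc n)) m = fold upd [Const n n, Add n n 0, Load n n] ?s"
      by (simp only: fold_append o_apply IH)
    also have "\<dots> = ?s(n := m (H + n))" using False Suc.prems by (auto simp: fun_eq_iff add.commute)
    also have "\<dots> = (\<lambda>a. if 1 \<le> a \<and> a < Suc n then m (H + a) else m a)"
      using False by (auto simp: fun_eq_iff)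
    finally show ?thesis .
  qed
qed

text \<open>The loop serves the addresses from \<open>K\<close> on while the low cells can still act
  as its registers. Address 0 is replaced last, because all sources below \<open>K\<close> are
  located through the \<open>H\<close> stored in it.\<close>

definition finish_code :: "nat \<Rightarrow> com" where
  "finish_code K = Block [Const 6 1, Add 7 12 6, Add 5 0 6, Store 5 7, Sub 8 4 5, Store 0 8,
       Add 8 8 6, Const 9 K, Sub 8 8 9, Add 5 0 9] ;;
     Rep 8 (Block [Load 7 5, Store 9 7, Const 6 1, Add 5 5 6, Add 9 9 6]) ;;
     Block (low_code K @ [Load 0 0])"

lemma hoare_finish:
  fixes ws :: "nat list"
  assumes "K \<ge> 13" "K < H" "length ws + 1 < H"
  shows "hoare (\<lambda>m. m 0 = H \<and> m 12 = N \<and> m 4 = H + 2 + length ws \<and> (\<forall>i<length ws. m (H + 2 + i) = ws ! i))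
    (finish_code K) (10 + ((length ws + 2 - K) * (5 + 5) + 1) + (length (low_code K) + 1))
    (\<lambda>m. \<forall>pc. output_of (pc, m) = (N + 1) # ws)"
proof -
  define L where "L = length ws + 1"
  define S where "S = L # (N + 1) # ws"
  define I where "I c m \<longleftrightarrow> m 0 = H \<and> m 5 = H + K + c \<and> m 9 = K + c \<and> (\<forall>p\<le>L. m (H + p) = S ! p) \<and>
    (\<forall>p. K \<le> p \<and> p < K + c \<longrightarrow> m p = S ! p)" for c and m :: mem
  \<comment> \<open>Truncated to 0 if the whole output lies below \<open>K\<close>. Cells copied
    beyond its end are harmless, since \<open>output_of\<close> reads only as many as register 0
    says.\<close>
  let ?n = "length ws + 2 - K"
  let ?start = "[Const 6 1, Add 7 12 6, Add 5 0 6, Store 5 7, Sub 8 4 5, Store 0 8,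
       Add 8 8 6, Const 9 K, Sub 8 8 9, Add 5 0 9]"
  let ?copy = "[Load 7 5, Store 9 7, Const 6 1, Add 5 5 6, Add 9 9 6]"
  have 1: "hoare (\<lambda>m. m 0 = H \<and> m 12 = N \<and> m 4 = H + 2 + length ws \<and> (\<forall>i<length ws. m (H + 2 + i) = ws ! i))
    (Block ?start) 10 (\<lambda>m. I 0 m \<and> m 8 = ?n)"
  proof (rule hoare_block)
    fix m :: mem
    assume m: "m 0 = H \<and> m 12 = N \<and> m 4 = H + 2 + length ws \<and> (\<forall>i<length ws. m (H + 2 + i) = ws ! i)"
    let ?m = "m(6 := 1, 7 := N + 1, 5 := H + K, H + 1 := N + 1, H := L, 8 := ?n, 9 := K)"
    have e: "fold upd ?start m = ?m"
      using m assms by (auto simp: fun_eq_iff L_def)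
    have "?m (H + p) = S ! p" if "p \<le> L" for p
    proof -
      consider "p = 0" | "p = 1" | i where "p = Suc (Suc i)" by (metis One_nat_def not0_implies_Suc)
      then show ?thesis
      proof cases
        case 3
        then have "i < length ws" using that by (simp add: L_def)
        then have "m (H + p) = ws ! i" using m 3 by simp
        then show ?thesis using 3 assms by (simp add: S_def)
      qed (use assms in \<open>simp_all add: S_def\<close>)
    qed
    then show "I 0 (fold upd ?start m) \<and> fold upd ?start m 8 = ?n"
      unfolding e I_def using m assms by simp
  qed simp_all
  have 2: "hoare (\<lambda>m. I 0 m \<and> m 8 = ?n) (Rep 8 (Block ?copy)) (?n * (5 + 5) + 1) (\<lambda>m. I ?n m \<and> m 8 = 0)"
  proof (rule hoare_rep[where I = I], rule hoare_block)
    fix c m assume c: "c < ?n" and m: "I c m \<and> m 8 = ?n - c"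
    have cL: "K + c \<le> L" using c by (simp add: L_def)
    have src: "m (H + (K + c)) = S ! (K + c)" using m cL unfolding I_def by blast
    let ?m = "m(7 := S ! (K + c), K + c := S ! (K + c), 6 := 1, 5 := H + K + Suc c, 9 := K + Suc c)"
    have e: "fold upd ?copy m = ?m"
      using m src assms(1) by (simp add: I_def add.assoc)
    \<comment> \<open>Targets stay below \<open>H\<close>, so the copy never damages its
      source.\<close>
    have "K + c < H" using cL assms by (simp add: L_def)
    then have "I (Suc c) (?m(8 := ?n - Suc c, 1 := 0))"
      using m assms unfolding I_def by (auto simp: less_Suc_eq)
    then show "fold upd ?copy m 8 = ?n - c \<and> I (Suc c) ((fold upd ?copy m)(8 := ?n - Suc c, 1 := 0))"
      unfolding e using m assms(1) by simp
  qed simp_all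
  have 3: "hoare (\<lambda>m. I ?n m \<and> m 8 = 0) (Block (low_code K @ [Load 0 0])) (length (low_code K) + 1)
    (\<lambda>m. \<forall>pc. output_of (pc, m) = (N + 1) # ws)"
  proof (rule hoare_block)
    fix m assume "I ?n m \<and> m 8 = 0"
    then have m: "m 0 = H" "\<forall>p\<le>L. m (H + p) = S ! p" "\<forall>p. K \<le> p \<and> p < K + ?n \<longrightarrow> m p = S ! p"
      by (auto simp: I_def)
    let ?m = "fold upd (low_code K @ [Load 0 0]) m"
    have "fold upd (low_code K) m = (\<lambda>a. if 1 \<le> a \<and> a < K then m (H + a) else m a)"
      using fold_low_code m(1) assms(2) by simp
    then have e: "?m = (\<lambda>a. if 1 \<le> a \<and> a < K then m (H + a) else m a)(0 := m H)"
      using m(1) assms(1,2) by simp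
    have "m H = S ! 0" using m(2)[rule_format, of 0] by simp
    then have m0: "?m 0 = L" unfolding e by (simp add: S_def)
    have mp: "?m p = S ! p" if "1 \<le> p" "p \<le> L" for p
    proof (cases "p < K")
      case True
      then show ?thesis using that m(2) unfolding e by simp
    next
      case False
      then have "p < K + ?n" using that by (simp add: L_def)
      then show ?thesis using False that m(3) unfolding e by simp
    qed
    show "\<forall>pc. output_of (pc, ?m) = (N + 1) # ws"
    proof
      fix pc
      have "output_of (pc, ?m) = map (\<lambda>p. S ! p) [1..<L + 1]"
        unfolding output_of_def snd_conv m0 using mp by (intro map_cong) auto
      also have "\<dots> = (N + 1) # ws"
        by (rule nth_equalityI) (auto simp: S_def L_def simp del: upt_Suc)
      finally show "output_of (pc, ?m) = (N + 1) # ws" .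
    qed
  qed simp_all
  show ?thesis unfolding finish_code_def
    by (rule hoare_conseq[OF hoare_seq[OF 1 hoare_seq[OF 2 3]]]) simp_all
qed

definition program :: "int \<Rightarrow> nat \<Rightarrow> nat \<Rightarrow> nat \<Rightarrow> nat list \<Rightarrow> signature \<Rightarrow> com" where
  "program \<Delta> B E K qs sig = init_code B ;; base_code K ;; stages K qs ;;
     Block [Const 11 (K - 1), Const 6 1, Sub 12 3 6, Const 6 2, Add 4 0 6] ;;
     rels \<Delta> E 0 sig ;; finish_code K"

definition table_size :: "nat \<Rightarrow> nat \<Rightarrow> nat" where
  "table_size d l = (2 * d + 1) ^ l * (4 * d + 4)"

definition program_time :: "int \<Rightarrow> nat \<Rightarrow> nat \<Rightarrow> nat \<Rightarrow> nat list \<Rightarrow> signature \<Rightarrow> nat \<Rightarrow> nat" where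
  "program_time \<Delta> B E K qs sig d = (4 + (d * (B + 3 + 5) + 1)) + ((8 + ((2 * d + 1) * (4 + 5) + 1) + 2) +
     (stages_time d (4 * d + 4) qs + (5 + (rels_time \<Delta> E (table_size d (length qs) - 1) sig +
     (10 + ((rels_size (table_size d (length qs) - 1) sig + 2 - K) * (5 + 5) + 1) + (length (low_code K) + 1))))))"

lemma (in value_table) hoare_program:
  assumes "H = B ^ d" "one = prod_list qs ^ d * (H + d)" "N = table_size d (length qs) - 1"
    "w = table d (4 * d + 4) qs (base_entry H)" "rels_size N sig + 1 < H"
    and ok: "\<forall>(k, f)\<in>set sig. rel_ok k f"
  shows "hoare (\<lambda>m. m = snd (init_config d)) (program \<Delta> B E K qs sig) (program_time \<Delta> B E K qs sig d)
    (\<lambda>m. \<exists>gs. set gs = facts_of 0 sig \<and> (\<forall>pc. output_of (pc, m) = encode_struct (N + 1) gs))"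
proof -
  let ?A = "table_size d (length qs)"
  let ?u = "\<lambda>m. m 0 = H \<and> m 10 = one \<and> tabulates K ?A w m"
  have K: "K \<ge> 13" using E by simp
  have A: "?A = Suc N" using assms(3) by (simp add: table_size_def)
  have 1: "hoare (\<lambda>m. m = snd (init_config d)) (init_code B) (4 + (d * (B + 3 + 5) + 1))
     (\<lambda>m. m 0 = H \<and> m 2 = d \<and> (\<forall>a\<ge>9. m a = 0))"
    using hoare_init unfolding assms(1) .
  note 2 = hoare_base[OF K, of H d]
  have 3: "hoare (\<lambda>m. m 0 = H \<and> m 2 = d \<and> m 10 = H + d \<and> tabulates K (4 * d + 4) (base_entry H) m)
    (stages K qs) (stages_time d (4 * d + 4) qs) ?u"
    unfolding assms(2,4) table_size_def by (rule hoare_stages[OF K]) simp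
  have 4: "hoare ?u (Block [Const 11 (K - 1), Const 6 1, Sub 12 3 6, Const 6 2, Add 4 0 6]) 5
    (\<lambda>m. env m \<and> out [] m)"
    by (rule hoare_block) (use A K in \<open>simp_all add: env_def out_def tabulates_def\<close>)
  note 5 = hoare_rels[OF ok, of "[]" 0]
  have 6: "hoare (\<lambda>m. \<exists>gs. env m \<and> out ([] @ gs) m \<and> length (words gs) \<le> rels_size N sig \<and> set gs = facts_of 0 sig)
    (finish_code K) (10 + ((rels_size N sig + 2 - K) * (5 + 5) + 1) + (length (low_code K) + 1))
    (\<lambda>m. \<exists>gs. set gs = facts_of 0 sig \<and> (\<forall>pc. output_of (pc, m) = encode_struct (N + 1) gs))"
  proof (rule hoare_exists)
    fix gs
    show "hoare (\<lambda>m. env m \<and> out ([] @ gs) m \<and> length (words gs) \<le> rels_size N sig \<and> set gs = facts_of 0 sig)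
    (finish_code K) (10 + ((rels_size N sig + 2 - K) * (5 + 5) + 1) + (length (low_code K) + 1))
    (\<lambda>m. \<exists>gs. set gs = facts_of 0 sig \<and> (\<forall>pc. output_of (pc, m) = encode_struct (N + 1) gs))"
    proof (cases "length (words gs) \<le> rels_size N sig \<and> set gs = facts_of 0 sig")
      case True
      then have "length (words gs) + 1 < H" "K < H" using assms(5) H by auto
      from hoare_finish[OF K this(2,1), of N] show ?thesis
      proof (rule hoare_conseq)
        fix m assume "\<forall>pc. output_of (pc, m) = (N + 1) # words gs"
        then show "\<exists>gs. set gs = facts_of 0 sig \<and> (\<forall>pc. output_of (pc, m) = encode_struct (N + 1) gs)"
          using True by (intro exI[of _ gs]) (simp add: encode_struct_def words_def)
      next
        show "10 + ((length (words gs) + 2 - K) * (5 + 5) + 1) + (length (low_code K) + 1)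
          \<le> 10 + ((rels_size N sig + 2 - K) * (5 + 5) + 1) + (length (low_code K) + 1)"
          using True by (intro add_mono mult_le_mono diff_le_mono) simp_all
      qed (simp add: env_def out_def)
    next
      case False
      then show ?thesis unfolding hoare_def by blast
    qed
  qed
  show ?thesis unfolding program_def program_time_def assms(3)[symmetric]
    using hoare_seq[OF 1 hoare_seq[OF 2 hoare_seq[OF 3 hoare_seq[OF 4 hoare_seq[OF 5 6]]]]] .
qed

section \<open>Polynomial and exponential bounds\<close>

definition poly_bounded :: "(nat \<Rightarrow> nat) \<Rightarrow> bool" where
  "poly_bounded f \<longleftrightarrow> (\<exists>c e. \<forall>d\<ge>1. f d \<le> c * d ^ e)"

text \<open>The program can compute \<open>B ^ d\<close> only for a fixed \<open>B\<close>, so every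
  demand on the size of \<open>H\<close> has to be brought below one such power.\<close>

definition exp_bounded :: "(nat \<Rightarrow> nat) \<Rightarrow> bool" where
  "exp_bounded f \<longleftrightarrow> (\<exists>B. \<forall>d\<ge>1. f d \<le> B ^ d)"

lemma poly_bounded_const [intro]: "poly_bounded (\<lambda>_. c)"
  unfolding poly_bounded_def by (intro exI[of _ c] exI[of _ 0]) simp

lemma poly_bounded_id [intro]: "poly_bounded (\<lambda>d. d)"
  unfolding poly_bounded_def by (intro exI[of _ 1]) simp

lemma poly_bounded_add [intro]:
  assumes "poly_bounded f" "poly_bounded g"
  shows "poly_bounded (\<lambda>d. f d + g d)"
proof -
  obtain c e c' e' where f: "\<forall>d\<ge>1. f d \<le> c * d ^ e" and g: "\<forall>d\<ge>1. g d \<le> c' * d ^ e'"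
    using assms unfolding poly_bounded_def by blast
  have "f d + g d \<le> (c + c') * d ^ (e + e')" if "d \<ge> 1" for d
  proof -
    have "c * d ^ e \<le> c * d ^ (e + e')" "c' * d ^ e' \<le> c' * d ^ (e + e')"
      using that by (auto intro!: mult_le_mono2 power_increasing)
    then show ?thesis using f[rule_format, OF that] g[rule_format, OF that] unfolding add_mult_distrib by linarith
  qed
  then show ?thesis unfolding poly_bounded_def by blast
qed

lemma poly_bounded_mult [intro]:
  assumes "poly_bounded f" "poly_bounded g"
  shows "poly_bounded (\<lambda>d. f d * g d)"
proof -
  obtain c e c' e' where f: "\<forall>d\<ge>1. f d \<le> c * d ^ e" and g: "\<forall>d\<ge>1. g d \<le> c' * d ^ e'"
    using assms unfolding poly_bounded_def by blast
  have "f d * g d \<le> (c * c') * d ^ (e + e')" if "d \<ge> 1" for d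
    using mult_le_mono[OF f[rule_format, OF that] g[rule_format, OF that]]
    by (simp add: power_add mult_ac)
  then show ?thesis unfolding poly_bounded_def by blast
qed

lemma poly_bounded_power [intro]: "poly_bounded f \<Longrightarrow> poly_bounded (\<lambda>d. f d ^ k)"
  by (induction k) auto

lemma poly_bounded_diff [intro]: "poly_bounded f \<Longrightarrow> poly_bounded (\<lambda>d. f d - g d)"
  unfolding poly_bounded_def by (meson diff_le_self le_trans)

lemma exp_bounded_add:
  assumes "exp_bounded f" "exp_bounded g"
  shows "exp_bounded (\<lambda>d. f d + g d)"
proof -
  obtain B C where f: "\<forall>d\<ge>1. f d \<le> B ^ d" and g: "\<forall>d\<ge>1. g d \<le> C ^ d"
    using assms unfolding exp_bounded_def by blast
  have pow: "B ^ d + C ^ d \<le> (B + C) ^ d" if "d \<ge> 1" for d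
    using that
  proof (induction d rule: dec_induct)
    case (step n)
    have "B ^ Suc n + C ^ Suc n \<le> (B + C) * (B ^ n + C ^ n)" by (simp add: algebra_simps)
    also have "\<dots> \<le> (B + C) ^ Suc n" using step.IH by simp
    finally show ?case .
  qed simp
  have "f d + g d \<le> (B + C) ^ d" if "d \<ge> 1" for d
    using add_mono[OF f[rule_format, OF that] g[rule_format, OF that]] pow[OF that] by (rule order_trans)
  then show ?thesis unfolding exp_bounded_def by blast
qed

lemma exp_bounded_mult:
  assumes "exp_bounded f" "exp_bounded g"
  shows "exp_bounded (\<lambda>d. f d * g d)"
proof -
  obtain B C where f: "\<forall>d\<ge>1. f d \<le> B ^ d" and g: "\<forall>d\<ge>1. g d \<le> C ^ d"
    using assms unfolding exp_bounded_def by blast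
  have "f d * g d \<le> (B * C) ^ d" if "d \<ge> 1" for d
    using mult_le_mono[OF f[rule_format, OF that] g[rule_format, OF that]] by (simp add: power_mult_distrib)
  then show ?thesis unfolding exp_bounded_def by blast
qed

lemma exp_bounded_power: "exp_bounded (\<lambda>d. a ^ d)"
  unfolding exp_bounded_def by blast

text \<open>For \<open>d \<ge> 1\<close> one has \<open>c \<le> c ^ d\<close> and
  \<open>d \<le> 2 ^ d\<close>, so the base \<open>c * 2 ^ e\<close> works.\<close>

lemma poly_bounded_imp_exp_bounded:
  assumes "poly_bounded f"
  shows "exp_bounded f"
proof -
  obtain c e where f: "\<forall>d\<ge>1. f d \<le> c * d ^ e" using assms unfolding poly_bounded_def by blast
  have "f d \<le> (c * 2 ^ e) ^ d" if "d \<ge> 1" for d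
  proof -
    have "c \<le> c ^ d" using that by (cases "c = 0") (auto intro: self_le_power)
    moreover have "d ^ e \<le> (2 ^ d) ^ e" by (intro power_mono) auto
    ultimately have "c * d ^ e \<le> c ^ d * (2 ^ d) ^ e" by (rule mult_le_mono)
    also have "\<dots> = (c * 2 ^ e) ^ d" by (simp add: power_mult_distrib power_mult[symmetric] mult.commute)
    finally show ?thesis using f[rule_format, OF that] by simp
  qed
  then show ?thesis unfolding exp_bounded_def by blast
qed

lemma poly_bounded_table_size: "poly_bounded (\<lambda>d. table_size d l)"
  unfolding table_size_def by (intro poly_bounded_mult poly_bounded_add poly_bounded_power poly_bounded_const poly_bounded_id)

lemma poly_bounded_enum_time: "poly_bounded N \<Longrightarrow> poly_bounded (\<lambda>d. enum_time (N d) b k)"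
proof (induction k)
  case (Suc k)
  then have "poly_bounded (\<lambda>d. enum_time (N d) b k)" by blast
  then show ?case unfolding enum_time.simps using Suc.prems
    by (intro poly_bounded_mult poly_bounded_add poly_bounded_const)
qed (simp add: poly_bounded_const)

lemma poly_bounded_rels:
  assumes "poly_bounded N"
  shows "poly_bounded (\<lambda>d. rels_time \<Delta> E (N d) s)" "poly_bounded (\<lambda>d. rels_size (N d) s)"
proof (induction s)
  case Nil
  { case 1 then show ?case by (simp add: poly_bounded_const) }
  { case 2 then show ?case by (simp add: poly_bounded_const) }
next
  case (Cons kf s)
  obtain k f where kf: "kf = (k, f)" by (rule prod.exhaust)
  { case 1
    show ?case unfolding kf rels_time.simps
      using Cons.IH(1) poly_bounded_enum_time[OF assms] by (rule poly_bounded_add[rotated]) }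
  { case 2
    show ?case unfolding kf rels_size.simps
      using Cons.IH(2) assms by (intro poly_bounded_add[of "\<lambda>d. (k + 1) * N d ^ k"] poly_bounded_mult poly_bounded_const poly_bounded_power) }
qed

lemma poly_bounded_stages_time:
  "poly_bounded A \<Longrightarrow> poly_bounded (\<lambda>d. stages_time d (A d) qs)"
proof (induction qs arbitrary: A)
  case (Cons q qs)
  have "poly_bounded (\<lambda>d. (2 * d + 1) * A d)"
    using Cons.prems by (intro poly_bounded_add poly_bounded_mult poly_bounded_const poly_bounded_id)
  from Cons.IH[OF this] Cons.prems show ?case unfolding stages_time.simps stage_time_def
    by (intro poly_bounded_add poly_bounded_mult poly_bounded_const poly_bounded_id)
qed (simp add: poly_bounded_const)

lemma poly_bounded_program_time: "poly_bounded (program_time \<Delta> B E K qs sig)"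
proof -
  have N: "poly_bounded (\<lambda>d. table_size d (length qs) - 1)"
    by (intro poly_bounded_diff poly_bounded_table_size)
  have A: "poly_bounded (\<lambda>d. 4 * d + 4)"
    by (intro poly_bounded_add poly_bounded_mult poly_bounded_const poly_bounded_id)
  show ?thesis unfolding program_time_def
    by (intro poly_bounded_add poly_bounded_mult poly_bounded_const poly_bounded_id poly_bounded_diff
        poly_bounded_stages_time[OF A] poly_bounded_rels[OF N])
qed

section \<open>Correctness of the sampling\<close>

lemma finite_atoms: "finite (atoms f)"
  by (induction f) auto

lemma finite_atom_coeffs: "finite (atom_coeffs a)"
  by (cases a) auto

lemma finite_lin_coeffs: "finite (lin_coeffs l)"
  by (cases l) auto

lemma lin_vars_normal: "nf_atom_wf k a \<Longrightarrow> j \<in> lin_vars (normal \<Delta> a) \<Longrightarrow> j < k"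
  by (cases a) auto

lemma qf_wf_atoms: "qf_wf k f \<Longrightarrow> a \<in> atoms f \<Longrightarrow> nf_atom_wf k a"
  by (induction f) auto

text \<open>This is where freedom from negation enters: rounding has to preserve true atoms
  only.\<close>

lemma qf_sem_mono:
  "qf_sem f s \<Longrightarrow> (\<forall>a\<in>atoms f. nf_atom_sem a s \<longrightarrow> nf_atom_sem a s') \<Longrightarrow> qf_sem f s'"
  by (induction f) auto

lemma operand_comp: "operand (\<lambda>j. s (vs ! j)) p = operand s (map_option ((!) vs) p)"
  by (cases p) auto

lemma conj_vars_finite: "finite (conj_vars as)"
proof -
  have "finite (tatom_vars a)" for a by (cases a) auto
  then show ?thesis by (simp add: conj_vars_def)
qed

context value_table
begin

lemma facts_of_iff:
  "(j, t) \<in> facts_of i s \<longleftrightarrow> (\<exists>n<length s. j = i + n \<and> length t = fst (s ! n) \<and> set t \<subseteq> {1..N} \<and> sat (snd (s ! n)) t)"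
proof (induction s arbitrary: i)
  case (Cons kf s)
  obtain k f where kf: "kf = (k, f)" by (rule prod.exhaust)
  have "(j, t) \<in> sols i k f k (\<lambda>_. 0) \<longleftrightarrow> j = i + 0 \<and> length t = k \<and> set t \<subseteq> {1..N} \<and> sat f t"
    by (auto simp: sols_def)
  then show ?case unfolding kf facts_of.simps Un_iff Cons.IH list.size(4) add_0_right add_Suc_right Ex_less_Suc2
    by simp
qed simp

lemma samples_covered:
  assumes Q: "distinct qs" "\<forall>q\<in>set qs. q > 0"
    and one_eq: "one = prod_list qs ^ d * (H + d)" and N: "N = table_size d (length qs) - 1"
    and w: "w = table d (4 * d + 4) qs (base_entry H)" and x: "x \<in> samples (set qs) d H"
  shows "\<exists>t\<in>{1..N}. val t = x"
proof -
  have pair: "\<exists>t\<in>{1..N}. w (t - 1) = (\<Prod>q\<in>set qs. q ^ e q) * base_entry H j \<and>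
      w t = (\<Prod>q\<in>set qs. q ^ e q) * base_entry H (Suc j)"
    if h: "Suc j < 4 * d + 4" "\<forall>q\<in>set qs. e q \<le> 2 * d" for j e
  proof -
    have p: "prod_list (map (\<lambda>q. q ^ e q) qs) = (\<Prod>q\<in>set qs. q ^ e q)"
      using Q(1) by (simp add: prod.distinct_set_conv_list)
    obtain j' where "Suc j' < table_size d (length qs)"
      "w j' = (\<Prod>q\<in>set qs. q ^ e q) * base_entry H j"
      "w (Suc j') = (\<Prod>q\<in>set qs. q ^ e q) * base_entry H (Suc j)"
      using table_pair[OF h, of "base_entry H"] unfolding w p table_size_def by blast
    then show ?thesis unfolding N by (intro bexI[of _ "Suc j'"]) auto
  qed
  have prod: "prod_list qs = \<Prod>(set qs)" using Q(1) by (simp add: prod.distinct_set_conv_list)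
  consider "x = 0" | s u i where "x = s * rat_of_nat (u * (H + i)) / rat_of_nat one" "s \<in> {1, -1}"
      "u \<in> monomials (set qs) (2 * d)" "i \<le> 2 * d"
    using x unfolding samples_def one_eq prod by blast
  then show ?thesis
  proof cases
    case 1
    \<comment> \<open>The table begins with two zeros, whose difference represents 0.\<close>
    obtain t where "t \<in> {1..N}" "w (t - 1) = 0" "w t = 0"
      using pair[of 0 "\<lambda>_. 0"] by (auto simp: base_entry_def)
    then show ?thesis using 1 by (intro bexI[of _ t]) (simp_all add: val_def)
  next
    case 2
    obtain e where e: "u = (\<Prod>q\<in>set qs. q ^ e q)" "\<forall>q\<in>set qs. e q \<le> 2 * d"
      using 2(3) unfolding monomials_def by blast
    have b: "base_entry H (Suc (2 * i)) = 0" "base_entry H (Suc (Suc (2 * i))) = H + i"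
      "base_entry H (Suc (Suc (Suc (2 * i)))) = 0"
      by (simp_all add: base_entry_def)
    show ?thesis
    \<comment> \<open>An entry \<open>H + i\<close> followed by its zero gives the positive sample;
      the zero before it followed by the entry gives the negative one.\<close>
    proof (cases "s = 1")
      case True
      obtain t where "t \<in> {1..N}" "w (t - 1) = u * base_entry H (2 + 2 * i)" "w t = u * base_entry H (Suc (2 + 2 * i))"
        using pair[OF _ e(2), of "2 + 2 * i"] 2(4) unfolding e(1)[symmetric] by auto
      then show ?thesis using b 2(1) True by (intro bexI[of _ t]) (simp_all add: val_def)
    next
      case False
      obtain t where "t \<in> {1..N}" "w (t - 1) = u * base_entry H (1 + 2 * i)" "w t = u * base_entry H (Suc (1 + 2 * i))"
        using pair[OF _ e(2), of "1 + 2 * i"] 2(4) unfolding e(1)[symmetric] by auto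
      then show ?thesis using b 2(1,2) False by (intro bexI[of _ t]) (simp_all add: val_def)
    qed
  qed
qed

lemma relA_val:
  assumes "qf_wf k f" "sig ! i = (k, f)" "length t = k"
  shows "map (\<lambda>t. (val t, 0)) t \<in> relA sig i \<longleftrightarrow> sat f t"
  using assms qf_sem_cong[OF assms(1), of "\<lambda>j. map (\<lambda>t. (val t, 0)) t ! j" "\<lambda>j. (val (t ! j), 0)"]
  by (simp add: relA_def sat_def)

text \<open>It suffices that the table covers all samples. Further elements, such as differences
  across the border of two copies, or several elements with one value, do no harm: solutions in the
  output are mapped to solutions by \<open>val\<close>.\<close>

lemma sampling_output_facts:
  assumes ok: "\<forall>(k, f)\<in>set sig. rel_ok k f" and gs: "set gs = facts_of 0 sig"
    and Z: "finite Z" "\<not> Z \<subseteq> {0}" "\<forall>(k, f)\<in>set sig. \<forall>a\<in>atoms f. lin_coeffs (normal \<Delta> a) \<subseteq> Z"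
    and large: "H > 2 * d * \<Prod>(coeff_abs Z) ^ (2 * d + 1)"
    and cover: "\<forall>x\<in>samples (coeff_abs Z) d H. \<exists>t\<in>{1..N}. val t = x"
  shows "sampling_output sig d (N + 1) gs"
proof -
  let ?h = "\<lambda>t. (val t, 0)"
  have sig_nth: "sig ! i = (fst (sig ! i), snd (sig ! i))" for i by simp
  have okn: "rel_ok (fst (sig ! i)) (snd (sig ! i))" if "i < length sig" for i
    using ok that by (metis case_prodD nth_mem prod.collapse)
  have wf: "qf_wf (fst (sig ! i)) (snd (sig ! i))" if "i < length sig" for i
    using okn[OF that] by (simp add: rel_ok_def)
  have facts: "(i, t) \<in> set gs \<longleftrightarrow> i < length sig \<and> length t = fst (sig ! i) \<and> set t \<subseteq> {1..N} \<and> map ?h t \<in> relA sig i"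
    for i t
    unfolding gs facts_of_iff using relA_val[OF wf sig_nth] by auto
  have hom: "is_hom_to_Astar sig gs ?h"
    using facts by (auto simp: is_hom_to_Astar_def)
  have wfs: "wf_struct sig (N + 1) gs"
    using facts by (fastforce simp: wf_struct_def)
  have "sat_Astar sig as \<longleftrightarrow> sat_D (N + 1) gs as"
    if as: "\<forall>a\<in>set as. tatom_wf sig a" "card (conj_vars as) \<le> d" for as
  proof
    assume "sat_D (N + 1) gs as"
    then obtain s where s: "\<forall>a\<in>set as. holds_D gs s a" by (auto simp: sat_D_def)
    have "holds_Astar sig (?h \<circ> s) a" if "a \<in> set as" for a
      using s that by (cases a) (force simp: facts)+
    then show "sat_Astar sig as" unfolding sat_Astar_def by blast
  next
    assume "sat_Astar sig as"
    then obtain s where s: "\<forall>a\<in>set as. holds_Astar sig s a" by (auto simp: sat_Astar_def)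
    let ?V = "conj_vars as"
    show "sat_D (N + 1) gs as"
    proof (rule sample_assignment[OF Z(1,2) conj_vars_finite as(2) large, of s])
      fix s' assume s': "\<And>v. s' v \<in> samples (coeff_abs Z) d H" "\<And>v w. s v = s w \<Longrightarrow> s' v = s' w"
        "\<And>\<alpha> \<beta> p q \<sigma>. \<alpha> \<in> Z \<Longrightarrow> \<beta> \<in> Z \<Longrightarrow> p \<in> insert None (Some ` ?V) \<Longrightarrow> q \<in> insert None (Some ` ?V) \<Longrightarrow>
          sigma_sem \<sigma> (qscale (of_int \<alpha>) (operand s p)) (qscale (of_int \<beta>) (operand s q)) \<Longrightarrow>
          sigma_sem \<sigma> (qscale (of_int \<alpha>) (operand (\<lambda>v. (s' v, 0)) p))
            (qscale (of_int \<beta>) (operand (\<lambda>v. (s' v, 0)) q))"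
      \<comment> \<open>One representative per value: variables with equal values must go to the
        same element, although several elements may share a value.\<close>
      obtain pick where pick: "\<forall>x\<in>samples (coeff_abs Z) d H. pick x \<in> {1..N} \<and> val (pick x) = x"
        using cover bchoice[of "samples (coeff_abs Z) d H" "\<lambda>x t. t \<in> {1..N} \<and> val t = x"] by blast
      let ?r = "\<lambda>v. pick (s' v)"
      have r: "?r v \<in> {1..N}" "val (?r v) = s' v" for v using pick s'(1) by auto
      have "holds_D gs ?r a" if a: "a \<in> set as" for a
      proof (cases a)
        case (TEq v w)
        then show ?thesis using s a s'(2)[of v w] by auto
      next
        case (TRel i vs)
        have i: "i < length sig" "length vs = fst (sig ! i)" using as(1) a TRel by auto
        obtain k f where kf: "sig ! i = (k, f)" by (rule prod.exhaust)
        have wff: "qf_wf k f" and mem: "(k, f) \<in> set sig" and lk: "length vs = k"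
          using wf[OF i(1)] i nth_mem[OF i(1)] kf by auto
        have cf: "\<forall>a\<in>atoms f. \<forall>c\<in>atom_coeffs a. of_int (scaled \<Delta> c) = of_int \<Delta> * c"
          using okn[OF i(1)] kf by (simp add: rel_ok_def)
        have V: "vs ! j \<in> ?V" if "j < k" for j
          using a TRel lk that by (force simp: conj_vars_def)
        have "map s vs \<in> relA sig i" using s a TRel by auto
        then have "qf_sem f (\<lambda>j. map s vs ! j)" using kf by (simp add: relA_def)
        then have "qf_sem f (\<lambda>j. s (vs ! j))"
          using qf_sem_cong[OF wff, of "\<lambda>j. map s vs ! j" "\<lambda>j. s (vs ! j)"] lk by simp
        then have "qf_sem f (\<lambda>j. (s' (vs ! j), 0))"
        proof (rule qf_sem_mono, intro ballI impI)
          fix b assume b: "b \<in> atoms f" "nf_atom_sem b (\<lambda>j. s (vs ! j))"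
          obtain \<alpha> p \<sigma> \<beta> q where l: "normal \<Delta> b = (\<alpha>, p, \<sigma>, \<beta>, q)" by (rule prod_cases5)
          have cb: "\<forall>c\<in>atom_coeffs b. of_int (scaled \<Delta> c) = of_int \<Delta> * c" using cf b(1) by blast
          have "lin_coeffs (normal \<Delta> b) \<subseteq> Z" using Z(3) mem b(1) by blast
          then have \<alpha>\<beta>: "\<alpha> \<in> Z" "\<beta> \<in> Z" unfolding l by auto
          have "j < k" if "j \<in> set_option p \<union> set_option q" for j
            using lin_vars_normal[OF qf_wf_atoms[OF wff b(1)], of j \<Delta>] that unfolding l by simp
          then have pq: "map_option ((!) vs) p \<in> insert None (Some ` ?V)" "map_option ((!) vs) q \<in> insert None (Some ` ?V)"
            using V by (cases p; cases q; simp)+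
          have "lin_sem (normal \<Delta> b) (\<lambda>j. s (vs ! j))" using lin_sem_normal[OF \<Delta> cb] b(2) by blast
          then have "lin_sem (normal \<Delta> b) (\<lambda>j. (s' (vs ! j), 0))"
            using s'(3)[OF \<alpha>\<beta> pq] unfolding l lin_sem.simps operand_comp
              operand_comp[of "\<lambda>v. (s' v, 0)"] by blast
          then show "nf_atom_sem b (\<lambda>j. (s' (vs ! j), 0))" using lin_sem_normal[OF \<Delta> cb] by blast
        qed
        then have "sat f (map ?r vs)"
          unfolding sat_def
          using qf_sem_cong[OF wff, of "\<lambda>j. (s' (vs ! j), 0)" "\<lambda>j. (val (map ?r vs ! j), 0)"] lk r(2) by simp
        then have "map ?h (map ?r vs) \<in> relA sig i"
          using relA_val[OF wff kf, of "map ?r vs"] lk by (simp del: map_map)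
        moreover have "set (map ?r vs) \<subseteq> {1..N}" using r(1) by auto
        ultimately have "(i, map ?r vs) \<in> set gs" unfolding facts using i by (simp del: map_map)
        then show ?thesis using TRel by simp
      qed
      moreover have "\<forall>v\<in>?V. ?r v < N + 1" using r(1) by (simp add: less_Suc_eq_le)
      ultimately show "sat_D (N + 1) gs as" unfolding sat_D_def by (intro exI[of _ ?r]) blast
    qed
  qed
  then show ?thesis unfolding sampling_output_def using wfs hom by blast
qed

end

theorem theorem4:
  fixes sig :: signature
  assumes "\<forall>(k, \<phi>) \<in> set sig. qf_wf k \<phi>"
  shows "\<exists>P. efficient_sampling_algorithm sig P"
proof -
  have "finite (\<Union>(k, f)\<in>set sig. \<Union>a\<in>atoms f. atom_coeffs a)"
    by (auto simp: finite_atoms finite_atom_coeffs)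
  then obtain \<Delta> where den: "\<Delta> > 0"
    "\<forall>c\<in>(\<Union>(k, f)\<in>set sig. \<Union>a\<in>atoms f. atom_coeffs a). of_int (scaled \<Delta> c) = of_int \<Delta> * c"
    using common_denominator by metis
  \<comment> \<open>Including \<Delta> provides a nonzero coefficient even when the signature is
    empty.\<close>
  define Z where "Z = insert \<Delta> (\<Union>(k, f)\<in>set sig. \<Union>a\<in>atoms f. lin_coeffs (normal \<Delta> a))"
  have Z: "finite Z" "\<not> Z \<subseteq> {0}" "\<forall>(k, f)\<in>set sig. \<forall>a\<in>atoms f. lin_coeffs (normal \<Delta> a) \<subseteq> Z"
    using den(1) by (auto simp: Z_def finite_atoms finite_lin_coeffs)
  define qs where "qs = sorted_list_of_set (coeff_abs Z)"
  have qs: "set qs = coeff_abs Z" "distinct qs" using Z(1) by (simp_all add: qs_def coeff_abs_def)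
  have qs_pos: "\<forall>q\<in>set qs. q > 0" unfolding qs by (auto simp: coeff_abs_def)
  \<comment> \<open>Sums bound all arities and all depths at once, so any tuple fits below
    \<open>E\<close> and the scratch registers of any formula below \<open>K\<close>.\<close>
  define E where "E = 13 + sum_list (map fst sig)"
  define K where "K = E + 1 + sum_list (map (depth \<circ> snd) sig)"
  define N where "N d = table_size d (length qs) - 1" for d
  define P where "P = \<Prod>(coeff_abs Z)"
  have pN: "poly_bounded N" unfolding N_def by (intro poly_bounded_diff poly_bounded_table_size)
  \<comment> \<open>The demands on \<open>H\<close>: the first summand is the gap for strictness, as
    \<open>P * (P ^ 2) ^ d\<close> equals \<open>P ^ (2 * d + 1)\<close>; the others leave room
    below \<open>H\<close> for the table and for the final copy of the output.\<close>
  have "exp_bounded (\<lambda>d. 2 * d * P * (P ^ 2) ^ d + (rels_size (N d) sig + K + N d + 2))"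
    by (intro exp_bounded_add exp_bounded_mult exp_bounded_power poly_bounded_imp_exp_bounded
        poly_bounded_add poly_bounded_mult poly_bounded_const poly_bounded_id poly_bounded_rels pN)
  then obtain B where B: "\<forall>d\<ge>1. 2 * d * P * (P ^ 2) ^ d + (rels_size (N d) sig + K + N d + 2) \<le> B ^ d"
    unfolding exp_bounded_def by blast
  let ?prog = "program \<Delta> B E K qs sig"
  obtain c e where time: "\<forall>d\<ge>1. program_time \<Delta> B E K qs sig d \<le> c * d ^ e"
    using poly_bounded_program_time unfolding poly_bounded_def by blast
  have "halts_within (code ?prog 0 @ [Halt]) d (c * d ^ e) \<and>
        (\<exists>n facts. output_of (run (code ?prog 0 @ [Halt]) d (c * d ^ e)) = encode_struct n facts \<and>
                   sampling_output sig d n facts)" if d: "d \<ge> 1" for d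
  proof -
    define H where "H = B ^ d"
    have big: "2 * d * P ^ (2 * d + 1) < H" "rels_size (N d) sig + 1 < H" "K + N d < H"
      using B[rule_format, OF d] by (simp_all add: H_def power_mult mult.assoc)
    define one where "one = prod_list qs ^ d * (H + d)"
    define w where "w = table d (4 * d + 4) qs (base_entry H)"
    have "prod_list qs \<noteq> 0" using qs_pos by (auto simp: prod_list_zero_iff)
    then have "one > 0" using d by (simp add: one_def)
    then interpret value_table K H "N d" one E w \<Delta>
      using big(3) den(1) by unfold_locales (simp_all add: E_def K_def)
    have ok: "\<forall>(k, f)\<in>set sig. rel_ok k f"
    proof (clarify)
      fix k f assume kf: "(k, f) \<in> set sig"
      have "k \<le> sum_list (map fst sig)" "depth f \<le> sum_list (map (depth \<circ> snd) sig)"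
        using kf by (force intro: member_le_sum_list)+
      moreover have "qf_wf k f" using assms kf by blast
      moreover have "\<forall>a\<in>atoms f. \<forall>c\<in>atom_coeffs a. of_int (scaled \<Delta> c) = of_int \<Delta> * c"
        using den(2) kf by blast
      ultimately show "rel_ok k f" unfolding rel_ok_def by (simp add: E_def K_def)
    qed
    note hp = hoare_program[OF H_def one_def N_def w_def big(2) ok]
    have cov: "\<forall>x\<in>samples (coeff_abs Z) d H. \<exists>t\<in>{1..N d}. val t = x"
      using samples_covered[OF qs(2) qs_pos one_def N_def w_def] unfolding qs(1) by blast
    have "\<exists>gs. set gs = facts_of 0 sig \<and>
        (\<forall>pc. output_of (pc, snd (run (code ?prog 0 @ [Halt]) d (c * d ^ e))) = encode_struct (N d + 1) gs)"
      by (rule hoare_halts(2)[OF hp]) (use time d in auto)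
    then obtain gs where gs: "set gs = facts_of 0 sig"
      "output_of (run (code ?prog 0 @ [Halt]) d (c * d ^ e)) = encode_struct (N d + 1) gs"
      by (metis prod.collapse)
    have "sampling_output sig d (N d + 1) gs"
      by (rule sampling_output_facts[OF ok gs(1) Z]) (use big(1) cov in \<open>simp_all add: P_def\<close>)
    moreover have "halts_within (code ?prog 0 @ [Halt]) d (c * d ^ e)"
      by (rule hoare_halts(1)[OF hp]) (use time d in auto)
    ultimately show ?thesis using gs(2) by blast
  qed
  then show ?thesis unfolding efficient_sampling_algorithm_def by blast
qed

end
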